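(* $\mathrm{BMO}_0\subset(H^1)^*$. More precisely, there is a constant $C$ such that $$\left|\int_{\mathbb T}\varphi(e^{i\theta})\,\bar f(e^{i\theta})\,d\theta\right|\le C\,\|\varphi\|_{\mathrm{BMO}_0}\,\|f\|_{H^1}\qquad\text{for all }\varphi\in\mathrm{BMO}_0\text{ and all }f\in H^1.$$
   Context: $\mathbb T$ is the unit circle and $\mathbb D$ the open unit disc; $dA$ is area measure; for an arc $I\subset\mathbb T$, $|I|$ is its length, normalized so that $|\mathbb T|=1$. For a function $f\in L^1(\mathbb T)$, $f(z)$ denotes the harmonic extension of $f$ into $\mathbb D$, and $f'$ denotes the derivative of this extension; the functions $\varphi$ and $f$ are treated as analytic in $\mathbb D$, so that $f'$ and $\varphi'$ are complex derivatives. For an angle $\alpha$, fixed and small enough (any fixed $\alpha$ with $0<\alpha<1/20$ will do), let $$\Gamma_\alpha(e^{i\theta})=\left\{z\in\mathbb D:\ \frac{|e^{i\theta}-z|}{1-|z|}<\frac1{\sin\alpha}\right\}.$$ $H^1=H^1(\mathbb T)$ is the space of all $f\in L^1(\mathbb T)$ with $$\|f\|_{H^1}=\int_{\mathbb T}\Bigl(\int_{\Gamma_\alpha(e^{i\theta})}|f'(\xi)|^2\,dA(\xi)\Bigr)^{1/2}d\theta<\infty .$$ For an arc $I\subset\mathbb T$ the Carleson square is $Q_I=\{z\in\mathbb D:\ z/|z|\in I,\ |z|\ge1-|I|\}$. $\mathrm{BMO}_0=\mathrm{BMO}_0(\mathbb T)$ is the space of all $\varphi\in L^1(\mathbb T)$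 with $\varphi(0)=0$ and $$\|\varphi\|_{\mathrm{BMO}_0}=\sup_{\text{arc }I\subset\mathbb T}\Bigl(\frac1{|I|}\int_{Q_I}|\varphi'(\xi)|^2(1-|\xi|)\,dA(\xi)\Bigr)^{1/2}<\infty .$$ *)

theory Defs
  imports "HOL-Complex_Analysis.Complex_Analysis"
begin

text \<open>
  Functions on the unit circle are total functions \<open>complex \<Rightarrow> complex\<close> of which only the values
  \<open>f (cis \<theta>)\<close> matter. All quantities below depend only on the almost-everywhere class of
  \<open>\<theta> \<mapsto> f (cis \<theta>)\<close>. The integral \<open>d\<theta>\<close> is not normalized.
\<close>

definition circle_L1 :: "(complex \<Rightarrow> complex) set" where
  "circle_L1 = {f. (\<lambda>\<theta>. f (cis \<theta>)) absolutely_integrable_on {0..2 * pi}}"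

definition circle_integral :: "(complex \<Rightarrow> complex) \<Rightarrow> complex" where
  "circle_integral f = (LINT \<theta>:{0..2 * pi}|lebesgue. f (cis \<theta>))"

definition harmonic_ext :: "(complex \<Rightarrow> complex) \<Rightarrow> complex \<Rightarrow> complex" where
  "harmonic_ext f z =
     circle_integral (\<lambda>w. of_real ((1 - (cmod z)\<^sup>2) / (cmod (w - z))\<^sup>2) * f w) / of_real (2 * pi)"

definition cone :: "real \<Rightarrow> complex \<Rightarrow> complex set" where
  "cone \<alpha> w = {z. cmod z < 1 \<and> cmod (w - z) / (1 - cmod z) < 1 / sin \<alpha>}"

definition ennreal_sqrt :: "ennreal \<Rightarrow> ennreal" where
  "ennreal_sqrt x = (if x = \<infinity> then \<infinity> else ennreal (sqrt (enn2real x)))"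

definition H1_norm :: "real \<Rightarrow> (complex \<Rightarrow> complex) \<Rightarrow> ennreal" where
  "H1_norm \<alpha> f =
     (\<integral>\<^sup>+\<theta>\<in>{0..2 * pi}. ennreal_sqrt
        (\<integral>\<^sup>+\<xi>\<in>cone \<alpha> (cis \<theta>). ennreal ((cmod (deriv (harmonic_ext f) \<xi>))\<^sup>2) \<partial>lebesgue) \<partial>lebesgue)"

text \<open>
  Analyticity of the harmonic extension is part of membership in \<open>H1\<close> and in \<open>BMO0\<close>, so
  that \<^const>\<open>deriv\<close> is the complex derivative.
\<close>

definition H1 :: "real \<Rightarrow> (complex \<Rightarrow> complex) set" where
  "H1 \<alpha> = {f \<in> circle_L1. harmonic_ext f holomorphic_on ball 0 1 \<and> H1_norm \<alpha> f < \<infinity>}"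

text \<open>
  The arcs of positive length, up to endpoints, are \<open>{cis \<theta> | a \<le> \<theta> \<le> b}\<close> with
  \<open>0 < b - a \<le> 2 * pi\<close>; the normalized length is \<open>(b - a) / (2 * pi)\<close>. Including or excluding
  endpoints changes the Carleson square by a null set only. The origin, where \<open>z / \<bar>z\<bar>\<close>
  is undefined, never lies in the square, since here \<open>0 / 0 = 0\<close>.
\<close>

definition arc_length :: "real \<Rightarrow> real \<Rightarrow> real" where
  "arc_length a b = (b - a) / (2 * pi)"

definition carleson_square :: "real \<Rightarrow> real \<Rightarrow> complex set" where
  "carleson_square a b =
     {z. cmod z < 1 \<and> z / of_real (cmod z) \<in> cis ` {a..b} \<and> cmod z \<ge> 1 - arc_length a b}"

definition BMO0_norm :: "(complex \<Rightarrow> complex) \<Rightarrow> ennreal" where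
  "BMO0_norm \<phi> =
     (SUP (a, b) \<in> {(a, b). a < b \<and> b \<le> a + 2 * pi}. ennreal_sqrt
        (ennreal (1 / arc_length a b) *
         (\<integral>\<^sup>+\<xi>\<in>carleson_square a b.
            ennreal ((cmod (deriv (harmonic_ext \<phi>) \<xi>))\<^sup>2 * (1 - cmod \<xi>)) \<partial>lebesgue)))"

definition BMO0 :: "(complex \<Rightarrow> complex) set" where
  "BMO0 = {\<phi> \<in> circle_L1. harmonic_ext \<phi> holomorphic_on ball 0 1 \<and>
             harmonic_ext \<phi> 0 = 0 \<and> BMO0_norm \<phi> < \<infinity>}"

text \<open>
  For \<open>\<phi>\<close> in \<open>BMO0\<close> and \<open>f\<close> in \<open>H1\<close> the product \<open>\<phi> * cnj f\<close> need not be Lebesgue integrable on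
  the circle. As usual, the integral \<open>\<integral> \<phi> (cnj f) d\<theta>\<close> is read as the limit of the integrals of
  the dilates \<open>\<phi> (r e\<^sup>i\<^sup>\<theta>) * cnj (f (r e\<^sup>i\<^sup>\<theta>))\<close> as \<open>r\<close> increases to 1, and this limit has to be the
  Lebesgue integral whenever the latter exists.
\<close>

definition has_pairing :: "(complex \<Rightarrow> complex) \<Rightarrow> (complex \<Rightarrow> complex) \<Rightarrow> complex \<Rightarrow> bool" where
  "has_pairing \<phi> f L \<longleftrightarrow>
     ((\<lambda>r. circle_integral (\<lambda>w. harmonic_ext \<phi> (of_real r * w) * cnj (harmonic_ext f (of_real r * w))))
        \<longlongrightarrow> L) (at_left 1) \<and>
     ((\<lambda>w. \<phi> w * cnj (f w)) \<in> circle_L1 \<longrightarrow> L = circle_integral (\<lambda>w. \<phi> w * cnj (f w)))"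

end

theory Submission
  imports Defs "HOL-Real_Asymp.Real_Asymp"
begin

text \<open>Write \<open>F\<close> and \<open>G\<close> for the analytic extensions of \<open>\<phi>\<close> and \<open>f\<close>. Two independent facts are needed: the
integrals of the dilates converge to a limit with the right bound, and this limit is the Lebesgue
integral of \<open>\<phi> cnj f\<close> whenever that integral exists.

For the first, let \<open>p r\<close> be the integral of \<open>F cnj G\<close> over the circle of radius \<open>r\<close> and \<open>m r\<close> that
of \<open>F' cnj G'\<close>, both with respect to the angle. Moving \<open>z d/dz\<close> across the pairing gives
\<open>(r p')' = 4 r m\<close>, and two integrations with \<open>F 0 = 0\<close> give the Littlewood-Paley formula
\<open>p R = \<integral>\<^sub>0\<^sup>R 4 x ln (R/x) m x dx\<close> (\<open>has_integral_radial_pairing\<close>). Since \<open>x ln (1/x) \<le> 1 - x\<close>,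
everything is dominated by the area integral of \<open>\<bar>F' G'\<bar> (1 - \<bar>z\<bar>)\<close> once that is finite
(\<open>radial_pairing_limit\<close>). Its finiteness, with the bound by the two norms, is a stopping-time
argument (\<open>tent_estimate\<close>). From each boundary point, move up into its cone only as
long as the area integral of \<open>\<bar>F'\<bar>\<^sup>2\<close> over the part of the cone already seen stays below a multiple of
the squared Carleson norm. By the Carleson condition and Chebyshev, every \<open>z \<noteq> 0\<close> is still reached from a
set of boundary points of measure at least \<open>1 - \<bar>z\<bar>\<close>; hence the area integral is at most the integral over the
boundary of the stopped cone integrals of \<open>\<bar>F' G'\<bar>\<close>, and Cauchy-Schwarz on each stopped cone leaves
the Carleson norm times the area function of \<open>f\<close>.

For the second, suppose that \<open>\<phi> cnj f\<close>, equivalently \<open>\<phi> f\<close>, is integrable. Smirnov's principle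
(\<open>smirnov_product\<close>) says that \<open>\<bar>F G\<bar>\<close> is at most the Poisson integral of \<open>\<bar>\<phi> f\<bar>\<close>. But
\<open>\<bar>F cnj G\<bar> = \<bar>F G\<bar>\<close>, so the integrands \<open>F cnj G\<close> on the circles of radius \<open>r\<close> are dominated by
functions that converge in \<open>L\<^sup>1\<close>, and the limit may be taken under the integral
(\<open>pairing_limit_eq_integral\<close>).\<close>

section \<open>Polar coordinates\<close>

lemma lborel_complex_eq: "(lborel :: complex measure) = distr (lborel \<Otimes>\<^sub>M lborel) borel (\<lambda>(x,y). Complex x y)"
proof (rule lborel_eqI)
  fix l u :: complex
  assume le: "\<And>b. b \<in> Basis \<Longrightarrow> l \<bullet> b \<le> u \<bullet> b"
  have le': "Re l \<le> Re u" "Im l \<le> Im u"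
    using le[of 1] le[of \<i>] by (auto simp: Basis_complex_def)
  have mes: "(\<lambda>(x,y). Complex x y) \<in> lborel \<Otimes>\<^sub>M lborel \<rightarrow>\<^sub>M borel"
    by (simp add: lborel_prod) (intro borel_measurable_continuous_onI continuous_intros, simp add: case_prod_unfold continuous_on_Complex continuous_on_fst continuous_on_snd)
  have vim: "(\<lambda>(x,y). Complex x y) -` box l u \<inter> space (lborel \<Otimes>\<^sub>M lborel) = {Re l<..<Re u} \<times> {Im l<..<Im u}"
    by (auto simp: box_def Basis_complex_def space_pair_measure)
  show "emeasure (distr (lborel \<Otimes>\<^sub>M lborel) borel (\<lambda>(x,y). Complex x y)) (box l u) = (\<Prod>b\<in>Basis. (u - l) \<bullet> b)"
    using le' by (simp add: emeasure_distr mes vim lborel.emeasure_pair_measure_Times Basis_complex_def ennreal_mult)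
qed simp

lemma measurable_Complex [measurable]:
  assumes [measurable]: "f \<in> borel_measurable M" "g \<in> borel_measurable M"
  shows "(\<lambda>x. Complex (f x) (g x)) \<in> borel_measurable M"
  unfolding Complex_eq by measurable

lemma nn_integral_complex_iterated:
  fixes g :: "complex \<Rightarrow> ennreal"
  assumes [measurable]: "g \<in> borel_measurable borel"
  shows "(\<integral>\<^sup>+z. g z \<partial>lborel) = (\<integral>\<^sup>+x. \<integral>\<^sup>+y. g (Complex x y) \<partial>lborel \<partial>lborel)"
proof -
  have "(\<integral>\<^sup>+z. g z \<partial>lborel) = (\<integral>\<^sup>+z. g z \<partial>distr (lborel \<Otimes>\<^sub>M lborel) borel (\<lambda>(x,y). Complex x y))"
    using lborel_complex_eq by metis
  also have "\<dots> = (\<integral>\<^sup>+p. g (Complex (fst p) (snd p)) \<partial>(lborel \<Otimes>\<^sub>M lborel))"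
    by (subst nn_integral_distr) (auto simp: case_prod_unfold)
  also have "\<dots> = (\<integral>\<^sup>+x. \<integral>\<^sup>+y. g (Complex x y) \<partial>lborel \<partial>lborel)"
    by (subst lborel.nn_integral_fst[symmetric]) auto
  finally show ?thesis .
qed

lemma measurable_cos_tan [measurable]:
  fixes f :: "'a \<Rightarrow> real"
  assumes [measurable]: "f \<in> borel_measurable M"
  shows "(\<lambda>x. cos (f x)) \<in> borel_measurable M" "(\<lambda>x. tan (f x)) \<in> borel_measurable M" "(\<lambda>x. cis (f x)) \<in> borel_measurable M"
proof -
  have [measurable]: "cos \<in> borel_measurable (borel :: real measure)" "sin \<in> borel_measurable (borel :: real measure)"
    "cis \<in> borel_measurable borel"
    by (auto intro!: borel_measurable_continuous_onI continuous_intros)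
  show "(\<lambda>x. cos (f x)) \<in> borel_measurable M" "(\<lambda>x. tan (f x)) \<in> borel_measurable M" "(\<lambda>x. cis (f x)) \<in> borel_measurable M"
    unfolding tan_def by measurable
qed

lemma nn_integral_incseq_sets:
  assumes [measurable]: "h \<in> borel_measurable M" and A: "\<And>n. A n \<in> sets M" "incseq A"
  shows "(\<integral>\<^sup>+x\<in>(\<Union>n. A n). h x \<partial>M) = (SUP n. \<integral>\<^sup>+x\<in>A n. h x \<partial>M)"
proof -
  have "emeasure (density M h) (\<Union>n. A n) = (SUP n. emeasure (density M h) (A n))"
    by (rule SUP_emeasure_incseq[symmetric]) (use A in auto)
  moreover have "(\<Union>n. A n) \<in> sets M" using A(1) by blast
  ultimately show ?thesis using A(1) by (simp add: emeasure_density)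
qed

text \<open>This is \<open>y = x tan t\<close> for fixed \<open>x\<close>, the first half of passing to polar coordinates. The
substitution rule covers compact intervals, so the line is exhausted by \<open>[-x n, x n]\<close>.\<close>

lemma nn_integral_tan_substitution:
  fixes h :: "real \<Rightarrow> ennreal" and x :: real
  assumes [measurable]: "h \<in> borel_measurable borel" and x: "x > 0"
  shows "(\<integral>\<^sup>+y. h y \<partial>lborel) = (\<integral>\<^sup>+t\<in>{-pi/2<..<pi/2}. h (x * tan t) * ennreal (x / (cos t)\<^sup>2) \<partial>lborel)"
proof -
  let ?Y = "\<lambda>n. {- (x * real n)..x * real n}" and ?T = "\<lambda>n. {-arctan (real n)..arctan (real n)}"
  let ?k = "\<lambda>t. h (x * tan t) * ennreal (x / (cos t)\<^sup>2)"
  have c: "cos t > 0" if "t \<in> {-pi/2<..<pi/2}" for t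
    using that by (intro cos_gt_zero_pi) auto
  have sub: "(\<integral>\<^sup>+y\<in>?Y n. h y \<partial>lborel) = (\<integral>\<^sup>+t\<in>?T n. ?k t \<partial>lborel)" for n :: nat
  proof (cases "n = 0")
    case True
    have "(\<integral>\<^sup>+y\<in>{0}. g y \<partial>lborel) = 0" for g :: "real \<Rightarrow> ennreal"
    proof -
      have "(\<integral>\<^sup>+y\<in>{0}. g y \<partial>lborel) = (\<integral>\<^sup>+(y::real). 0 \<partial>lborel)"
        using AE_lborel_singleton[of "0::real"] by (intro nn_integral_cong_AE) (auto elim!: eventually_mono)
      then show ?thesis by simp
    qed
    then show ?thesis using True by simp
  next
    case False
    have b: "t \<in> {-pi/2<..<pi/2}" if "t \<in> ?T n" for t
      using that arctan_bounded[of "real n"] by auto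
    have "(\<integral>\<^sup>+y. h y * indicator {x * tan (- arctan (real n))..x * tan (arctan (real n))} y \<partial>lborel) = (\<integral>\<^sup>+t. ?k t * indicator (?T n) t \<partial>lborel)"
    proof (rule nn_integral_substitution_aux)
      show "((\<lambda>t. x * tan t) has_real_derivative x / (cos t)\<^sup>2) (at t)" if "t \<in> ?T n" for t
        using c[OF b[OF that]] by (auto intro!: derivative_eq_intros simp: field_simps)
      show "continuous_on (?T n) (\<lambda>t. x / (cos t)\<^sup>2)"
        using c b by (intro continuous_intros) force
      show "- arctan (real n) < arctan (real n)" using False by simp
    qed (use x in auto)
    then show ?thesis by (simp add: tan_minus tan_arctan)
  qed
  have Y: "(\<Union>n. ?Y n) = UNIV"
  proof -
    have "y \<in> (\<Union>n. ?Y n)" for y :: real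
    proof -
      obtain n where "\<bar>y / x\<bar> \<le> real n" using real_arch_simple by blast
      then have "\<bar>y\<bar> \<le> x * real n" using x by (simp add: field_simps)
      then have "y \<in> ?Y n" by (simp add: abs_le_iff)
      then show ?thesis by blast
    qed
    then show ?thesis by blast
  qed
  have T: "(\<Union>n. ?T n) = {-pi/2<..<pi/2}"
  proof
    show "(\<Union>n. ?T n) \<subseteq> {-pi/2<..<pi/2}"
    proof
      fix t assume "t \<in> (\<Union>n. ?T n)"
      then obtain n :: nat where "t \<in> ?T n" by blast
      then show "t \<in> {-pi/2<..<pi/2}" using arctan_bounded[of "real n"] by auto
    qed
    show "{-pi/2<..<pi/2} \<subseteq> (\<Union>n. ?T n)"
    proof
      fix t assume t: "t \<in> {-pi/2<..<pi/2}"
      obtain n where n: "\<bar>tan t\<bar> \<le> real n" using real_arch_simple by blast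
      have "arctan (tan t) = t" using t by (intro arctan_tan) auto
      moreover have "arctan (tan t) \<le> arctan (real n)" "arctan (- real n) \<le> arctan (tan t)"
        using n by (auto simp: arctan_le_iff abs_le_iff simp del: arctan_minus)
      ultimately have "t \<in> ?T n" by (auto simp: arctan_minus)
      then show "t \<in> (\<Union>n. ?T n)" by blast
    qed
  qed
  have Y_inc: "incseq ?Y"
  proof (intro incseq_SucI)
    fix n
    have "x * real n \<le> x * real (Suc n)" using x by simp
    then show "?Y n \<subseteq> ?Y (Suc n)" by (auto simp del: of_nat_Suc)
  qed
  have T_inc: "incseq ?T"
  proof (intro incseq_SucI)
    fix n
    have "arctan (real n) \<le> arctan (real (Suc n))" by (simp add: arctan_le_iff)
    then show "?T n \<subseteq> ?T (Suc n)" by (auto simp del: of_nat_Suc)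
  qed
  have "(\<integral>\<^sup>+y. h y \<partial>lborel) = (\<integral>\<^sup>+y\<in>(\<Union>n. ?Y n). h y \<partial>lborel)" by (simp only: Y) simp
  also have "\<dots> = (SUP n. \<integral>\<^sup>+y\<in>?Y n. h y \<partial>lborel)"
    by (rule nn_integral_incseq_sets[OF _ _ Y_inc]) auto
  also have "\<dots> = (SUP n. \<integral>\<^sup>+t\<in>?T n. ?k t \<partial>lborel)" by (simp only: sub)
  also have "\<dots> = (\<integral>\<^sup>+t\<in>(\<Union>n. ?T n). ?k t \<partial>lborel)"
    by (rule nn_integral_incseq_sets[OF _ _ T_inc, symmetric]) auto
  finally show ?thesis by (simp only: T)
qed

text \<open>In the right half plane polar coordinates are two one-dimensional substitutions: \<open>y = x tan t\<close>
for fixed \<open>x\<close>, and then \<open>x = r cos t\<close> for fixed \<open>t\<close>.\<close>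

lemma nn_integral_polar_half_plane:
  fixes g :: "complex \<Rightarrow> ennreal"
  assumes [measurable]: "g \<in> borel_measurable borel"
  shows "(\<integral>\<^sup>+x. \<integral>\<^sup>+y. indicator {0<..} x * g (Complex x y) \<partial>lborel \<partial>lborel) =
    (\<integral>\<^sup>+r. indicator {0<..} r * (ennreal r * (\<integral>\<^sup>+t. indicator {-pi/2<..<pi/2} t * g (of_real r * cis t) \<partial>lborel)) \<partial>lborel)"
proof -
  let ?A = "\<lambda>x t. indicator {0<..} x * (indicator {-pi/2<..<pi/2} t * (g (Complex x (x * tan t)) * ennreal (x / (cos t)\<^sup>2)))"
    and ?B = "\<lambda>r t. indicator {0<..} r * (ennreal r * (indicator {-pi/2<..<pi/2} t * g (of_real r * cis t)))"
  have "(\<integral>\<^sup>+x. \<integral>\<^sup>+y. indicator {0<..} x * g (Complex x y) \<partial>lborel \<partial>lborel) =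
     (\<integral>\<^sup>+x. \<integral>\<^sup>+t. ?A x t \<partial>lborel \<partial>lborel)"
  proof (rule nn_integral_cong)
    fix x :: real
    show "(\<integral>\<^sup>+y. indicator {0<..} x * g (Complex x y) \<partial>lborel) =
       (\<integral>\<^sup>+t. ?A x t \<partial>lborel)"
      using nn_integral_tan_substitution[of "\<lambda>y. g (Complex x y)" x] by (cases "x > 0") (auto simp: mult.commute)
  qed
  also have "\<dots> = (\<integral>\<^sup>+t. \<integral>\<^sup>+x. ?A x t \<partial>lborel \<partial>lborel)"
    by (rule lborel_pair.Fubini'[symmetric]) measurable
  also have "\<dots> = (\<integral>\<^sup>+t. \<integral>\<^sup>+r. ?B r t \<partial>lborel \<partial>lborel)"
  proof (rule nn_integral_cong)
    fix t :: real
    show "(\<integral>\<^sup>+x. ?A x t \<partial>lborel) =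
       (\<integral>\<^sup>+r. ?B r t \<partial>lborel)"
    proof (cases "t \<in> {-pi/2<..<pi/2}")
      case True
      have c: "cos t > 0" using True by (intro cos_gt_zero_pi) auto
      let ?k = "\<lambda>x. indicator {0<..} x * (g (Complex x (x * tan t)) * ennreal (x / (cos t)\<^sup>2))"
      have "(\<integral>\<^sup>+x. ?k x \<partial>lborel) = ennreal \<bar>cos t\<bar> * (\<integral>\<^sup>+r. ?k (0 + cos t * r) \<partial>lborel)"
        by (rule nn_integral_real_affine) (use c in auto)
      also have "\<dots> = (\<integral>\<^sup>+r. ennreal (cos t) * ?k (cos t * r) \<partial>lborel)"
        using c by (subst nn_integral_cmult) auto
      also have "\<dots> = (\<integral>\<^sup>+r. indicator {0<..} r * (ennreal r * g (of_real r * cis t)) \<partial>lborel)"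
      proof (rule nn_integral_cong)
        fix r :: real
        have 1: "Complex (cos t * r) (cos t * r * tan t) = of_real r * cis t"
          using c by (simp add: complex_eq_iff tan_def)
        have 2: "ennreal (cos t) * ennreal (cos t * r / (cos t)\<^sup>2) = ennreal r" if "r > 0"
          using c that by (subst ennreal_mult[symmetric]) (auto simp: power2_eq_square)
        show "ennreal (cos t) * ?k (cos t * r) = indicator {0<..} r * (ennreal r * g (of_real r * cis t))"
        proof (cases "r > 0")
          case True
          then have "ennreal (cos t) * ?k (cos t * r) = (ennreal (cos t) * ennreal (cos t * r / (cos t)\<^sup>2)) * g (of_real r * cis t)"
            using c unfolding 1 by (simp add: ac_simps)
          then show ?thesis using True by (simp add: 2)
        next
          case False
          then have "\<not> cos t * r > 0" using c by (simp add: zero_less_mult_iff)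
          then show ?thesis using False by simp
        qed
      qed
      finally show ?thesis using True by simp
    qed simp
  qed
  also have "\<dots> = (\<integral>\<^sup>+r. \<integral>\<^sup>+t. ?B r t \<partial>lborel \<partial>lborel)"
    by (rule lborel_pair.Fubini') measurable
  also have "\<dots> = (\<integral>\<^sup>+r. indicator {0<..} r * (ennreal r * (\<integral>\<^sup>+t. indicator {-pi/2<..<pi/2} t * g (of_real r * cis t) \<partial>lborel)) \<partial>lborel)"
    by (simp add: nn_integral_cmult)
  finally show ?thesis .
qed

lemma nn_integral_periodic_shift:
  fixes h :: "real \<Rightarrow> ennreal"
  assumes [measurable]: "h \<in> borel_measurable borel" and per: "\<And>t. h (t + 2 * pi) = h t"
    and ab: "a \<le> b" "b \<le> a + 2 * pi"
  shows "(\<integral>\<^sup>+t\<in>{a..a + 2 * pi}. h t \<partial>lborel) = (\<integral>\<^sup>+t\<in>{b..b + 2 * pi}. h t \<partial>lborel)"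
proof -
  have split: "(\<integral>\<^sup>+t\<in>{u..w}. h t \<partial>lborel) = (\<integral>\<^sup>+t\<in>{u..v}. h t \<partial>lborel) + (\<integral>\<^sup>+t\<in>{v..w}. h t \<partial>lborel)"
    if "u \<le> v" "v \<le> w" for u v w
  proof -
    have "(\<integral>\<^sup>+t\<in>{u..w}. h t \<partial>lborel) = (\<integral>\<^sup>+t. h t * indicator {u..v} t + h t * indicator {v..w} t \<partial>lborel)"
      using AE_lborel_singleton[of v] that
      by (intro nn_integral_cong_AE) (auto elim!: eventually_mono simp: indicator_def)
    then show ?thesis by (simp add: nn_integral_add)
  qed
  have "(\<integral>\<^sup>+t\<in>{a + 2 * pi..b + 2 * pi}. h t \<partial>lborel) = (\<integral>\<^sup>+t\<in>{a..b}. h t \<partial>lborel)"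
  proof -
    have "(\<integral>\<^sup>+t\<in>{a + 2 * pi..b + 2 * pi}. h t \<partial>lborel) = ennreal \<bar>1\<bar> * (\<integral>\<^sup>+t. h (2 * pi + 1 * t) * indicator {a + 2 * pi..b + 2 * pi} (2 * pi + 1 * t) \<partial>lborel)"
      by (rule nn_integral_real_affine) auto
    also have "\<dots> = (\<integral>\<^sup>+t\<in>{a..b}. h t \<partial>lborel)"
      by (simp add: per add.commute[of "2 * pi"]) (auto intro!: nn_integral_cong simp: indicator_def)
    finally show ?thesis .
  qed
  then show ?thesis
    using split[of a b "a + 2 * pi"] split[of b "a + 2 * pi" "b + 2 * pi"] ab by (simp add: add.commute)
qed

text \<open>The left half plane is minus the right half plane, and the imaginary axis is a null set.\<close>

lemma nn_integral_polar:
  fixes g :: "complex \<Rightarrow> ennreal"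
  assumes [measurable]: "g \<in> borel_measurable borel"
  shows "(\<integral>\<^sup>+z. g z \<partial>lborel) =
    (\<integral>\<^sup>+r\<in>{0<..}. ennreal r * (\<integral>\<^sup>+t\<in>{0..2 * pi}. g (of_real r * cis t) \<partial>lborel) \<partial>lborel)"
proof -
  let ?H = "\<lambda>x y. g (Complex x y)"
  let ?J = "\<lambda>r. \<integral>\<^sup>+t. indicator {-pi/2<..<pi/2} t * g (of_real r * cis t) \<partial>lborel"
    and ?K = "\<lambda>r. \<integral>\<^sup>+t. indicator {-pi/2<..<pi/2} t * g (- (of_real r * cis t)) \<partial>lborel"
  have "(\<integral>\<^sup>+z. g z \<partial>lborel) = (\<integral>\<^sup>+x. \<integral>\<^sup>+y. ?H x y \<partial>lborel \<partial>lborel)"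
    by (rule nn_integral_complex_iterated) simp
  also have "\<dots> = (\<integral>\<^sup>+x. (\<integral>\<^sup>+y. indicator {0<..} x * ?H x y \<partial>lborel) + (\<integral>\<^sup>+y. indicator {..<0} x * ?H x y \<partial>lborel) \<partial>lborel)"
    using AE_lborel_singleton[of "0::real"]
    by (intro nn_integral_cong_AE) (auto elim!: eventually_mono simp: indicator_def)
  also have "\<dots> = (\<integral>\<^sup>+x. \<integral>\<^sup>+y. indicator {0<..} x * ?H x y \<partial>lborel \<partial>lborel) + (\<integral>\<^sup>+x. \<integral>\<^sup>+y. indicator {..<0} x * ?H x y \<partial>lborel \<partial>lborel)"
    by (intro nn_integral_add) measurable
  also have "(\<integral>\<^sup>+x. \<integral>\<^sup>+y. indicator {..<0} x * ?H x y \<partial>lborel \<partial>lborel) =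
     (\<integral>\<^sup>+x. \<integral>\<^sup>+y. indicator {0<..} x * g (- Complex x y) \<partial>lborel \<partial>lborel)"
  proof -
    have [measurable]: "(\<lambda>x. \<integral>\<^sup>+y. indicator {..<0} x * ?H x y \<partial>lborel) \<in> borel_measurable borel"
      by measurable
    have "(\<integral>\<^sup>+x. \<integral>\<^sup>+y. indicator {..<0} x * ?H x y \<partial>lborel \<partial>lborel) =
       ennreal \<bar>-1\<bar> * (\<integral>\<^sup>+x. \<integral>\<^sup>+y. indicator {..<0} (0 + (-1) * x) * ?H (0 + (-1) * x) y \<partial>lborel \<partial>lborel)"
      by (rule nn_integral_real_affine[of "\<lambda>x. \<integral>\<^sup>+y. indicator {..<0} x * ?H x y \<partial>lborel"]) auto
    also have "\<dots> = (\<integral>\<^sup>+x. \<integral>\<^sup>+y. indicator {..<0} (-x) * ?H (-x) y \<partial>lborel \<partial>lborel)" by simp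
    also have "\<dots> = (\<integral>\<^sup>+x. \<integral>\<^sup>+y. indicator {0<..} x * g (- Complex x y) \<partial>lborel \<partial>lborel)"
    proof (rule nn_integral_cong)
      fix x :: real
      have "(\<integral>\<^sup>+y. indicator {..<0} (-x) * ?H (-x) y \<partial>lborel) = ennreal \<bar>-1\<bar> * (\<integral>\<^sup>+y. indicator {..<0} (-x) * ?H (-x) (0 + (-1) * y) \<partial>lborel)"
        by (rule nn_integral_real_affine) simp_all
      also have "\<dots> = (\<integral>\<^sup>+y. indicator {0<..} x * g (- Complex x y) \<partial>lborel)"
        by (auto intro!: nn_integral_cong simp: indicator_def complex_minus)
      finally show "(\<integral>\<^sup>+y. indicator {..<0} (-x) * ?H (-x) y \<partial>lborel) = (\<integral>\<^sup>+y. indicator {0<..} x * g (- Complex x y) \<partial>lborel)" .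
    qed
    finally show ?thesis .
  qed
  also have "\<dots> = (\<integral>\<^sup>+r. indicator {0<..} r * (ennreal r * ?K r) \<partial>lborel)"
    by (rule nn_integral_polar_half_plane) measurable
  also have "(\<integral>\<^sup>+x. \<integral>\<^sup>+y. indicator {0<..} x * ?H x y \<partial>lborel \<partial>lborel) =
     (\<integral>\<^sup>+r. indicator {0<..} r * (ennreal r * ?J r) \<partial>lborel)"
    by (rule nn_integral_polar_half_plane) measurable
  also have "\<dots> + (\<integral>\<^sup>+r. indicator {0<..} r * (ennreal r * ?K r) \<partial>lborel) =
     (\<integral>\<^sup>+r. indicator {0<..} r * (ennreal r * ?J r) +
        indicator {0<..} r * (ennreal r * ?K r) \<partial>lborel)"
    by (rule nn_integral_add[symmetric]) measurable
  also have "\<dots> = (\<integral>\<^sup>+r\<in>{0<..}. ennreal r * (\<integral>\<^sup>+t\<in>{0..2 * pi}. g (of_real r * cis t) \<partial>lborel) \<partial>lborel)"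
  proof (rule nn_integral_cong)
    fix r :: real
    let ?h = "\<lambda>t. g (of_real r * cis t)"
    have cis_per: "cis (t + 2 * pi) = cis t" "cis (- pi + t) = - cis t" for t
      by (simp_all add: complex_eq_iff cos_add sin_add)
    have per: "?h (t + 2 * pi) = ?h t" for t by (simp only: cis_per)
    have [measurable]: "(\<lambda>t. g (- (of_real r * cis t))) \<in> borel_measurable borel" "?h \<in> borel_measurable borel"
      by measurable
    have "?K r =
       ennreal \<bar>1\<bar> * (\<integral>\<^sup>+t. indicator {-pi/2<..<pi/2} (-pi + 1 * t) * g (- (of_real r * cis (-pi + 1 * t))) \<partial>lborel)"
      by (rule nn_integral_real_affine) auto
    also have "\<dots> = (\<integral>\<^sup>+t. indicator {-pi/2<..<pi/2} (-pi + 1 * t) * g (- (of_real r * cis (-pi + 1 * t))) \<partial>lborel)"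
      by simp
    also have "\<dots> = (\<integral>\<^sup>+t. indicator {pi/2<..<3*pi/2} t * ?h t \<partial>lborel)"
    proof (intro nn_integral_cong arg_cong2[where f = "(*)"])
      fix t :: real
      have "- (of_real r * cis (-pi + 1 * t)) = of_real r * cis t" using cis_per(2)[of t] by simp
      then show "g (- (of_real r * cis (-pi + 1 * t))) = ?h t" by simp
    qed (auto simp: indicator_def)
    finally have 2: "?K r = (\<integral>\<^sup>+t. indicator {pi/2<..<3*pi/2} t * ?h t \<partial>lborel)" .
    have "?J r + ?K r
      = (\<integral>\<^sup>+t. indicator {-pi/2<..<pi/2} t * ?h t + indicator {pi/2<..<3*pi/2} t * ?h t \<partial>lborel)"
      unfolding 2 by (rule nn_integral_add[symmetric]) measurable
    also have "\<dots> = (\<integral>\<^sup>+t\<in>{-pi/2..-pi/2 + 2 * pi}. ?h t \<partial>lborel)"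
    proof (rule nn_integral_cong_AE)
      show "AE t in lborel. indicator {-pi/2<..<pi/2} t * ?h t + indicator {pi/2<..<3*pi/2} t * ?h t = ?h t * indicator {-pi/2..-pi/2 + 2 * pi} t"
        using AE_lborel_singleton[of "-pi/2"] AE_lborel_singleton[of "pi/2"] AE_lborel_singleton[of "3*pi/2"]
        by eventually_elim (auto simp: indicator_def)
    qed
    also have "\<dots> = (\<integral>\<^sup>+t\<in>{0..0 + 2 * pi}. ?h t \<partial>lborel)"
      by (rule nn_integral_periodic_shift) (use per in auto)
    finally have sum: "?J r + ?K r
      = (\<integral>\<^sup>+t\<in>{0..2 * pi}. ?h t \<partial>lborel)" by (simp only: add_0)
    have alg: "indicator {0<..} r * (ennreal r * A) + indicator {0<..} r * (ennreal r * B) = ennreal r * (A + B) * indicator {0<..} r"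
      for A B :: ennreal
      by (simp add: distrib_left indicator_def)
    show "indicator {0<..} r * (ennreal r * ?J r) +
        indicator {0<..} r * (ennreal r * ?K r) =
        ennreal r * (\<integral>\<^sup>+t\<in>{0..2 * pi}. g (of_real r * cis t) \<partial>lborel) * indicator {0<..} r"
      unfolding alg sum ..
  qed
  finally show ?thesis .
qed

section \<open>The stopping-time estimate for cones and Carleson squares\<close>

lemma norm_cis_diff_scaled_sq:
  "(cmod (cis a - of_real r * cis b))\<^sup>2 = 1 + r\<^sup>2 - 2 * r * cos (a - b)"
proof -
  have "(cmod (cis a - of_real r * cis b))\<^sup>2 = (cos a - r * cos b)\<^sup>2 + (sin a - r * sin b)\<^sup>2"
    by (simp add: cmod_power2)
  also have "(ca - r * cb)\<^sup>2 + (sa - r * sb)\<^sup>2 = (ca * ca + sa * sa) + r\<^sup>2 * (cb * cb + sb * sb) - 2 * r * (ca * cb + sa * sb)"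
    for ca cb sa sb :: real by (simp add: power2_eq_square algebra_simps)
  finally show ?thesis
    by (simp only: sin_cos_squared_add3 cos_diff mult_1_right)
qed

lemma norm_cis_diff_sq: "(cmod (cis a - cis b))\<^sup>2 = (2 * sin ((a - b) / 2))\<^sup>2"
proof -
  have "(cmod (cis a - cis b))\<^sup>2 = 2 - 2 * cos (a - b)"
    using norm_cis_diff_scaled_sq[of a 1 b] by simp
  also have "\<dots> = 2 - 2 * cos (2 * ((a - b) / 2))" by (simp only: nonzero_mult_div_cancel_left times_divide_eq_right)
  also have "\<dots> = (2 * sin ((a - b) / 2))\<^sup>2"
    unfolding cos_double_sin by (simp add: power_mult_distrib)
  finally show ?thesis .
qed

lemma norm_cis_diff_le: "cmod (cis a - cis b) \<le> \<bar>a - b\<bar>"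
proof -
  have "(cmod (cis a - cis b))\<^sup>2 = (2 * \<bar>sin ((a - b) / 2)\<bar>)\<^sup>2"
    by (simp add: norm_cis_diff_sq power_mult_distrib)
  then have "cmod (cis a - cis b) = 2 * \<bar>sin ((a - b) / 2)\<bar>"
    by (rule power2_eq_imp_eq) simp_all
  then show ?thesis using abs_sin_x_le_abs_x[of "(a - b) / 2"] by (simp only: abs_divide) simp
qed

text \<open>Half angles keep the argument of the sine in \<open>[0, pi/4]\<close>, where \<open>sin x \<ge> x cos x\<close>
  already gives a linear lower bound.\<close>

lemma norm_cis_diff_ge:
  assumes "\<bar>a - b\<bar> \<le> pi"
  shows "\<bar>a - b\<bar> / 2 \<le> cmod (cis a - cis b)"
proof -
  define x where "x = \<bar>a - b\<bar> / 4"
  have x: "0 \<le> x" "x \<le> pi / 4" using assms by (auto simp: x_def)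
  have c: "cos x \<ge> sqrt 2 / 2"
    using cos_monotone_0_pi_le[of x "pi / 4"] x by (simp add: cos_45)
  have s: "sin x \<ge> x * (sqrt 2 / 2)"
  proof (cases "x = 0")
    case False
    then obtain z where z: "0 < z" "z < x" "sin x - sin 0 = (x - 0) * cos z"
      using MVT2[of 0 x sin cos] x DERIV_sin by force
    have "cos z \<ge> sqrt 2 / 2"
      using cos_monotone_0_pi_le[of z "pi / 4"] x z by (simp add: cos_45)
    then show ?thesis using z x by (simp add: mult_left_mono)
  qed simp
  have s0: "0 \<le> sin x" by (rule sin_ge_zero) (use x pi_gt_zero in linarith)+
  have "x * (sqrt 2 / 2) * (sqrt 2 / 2) \<le> sin x * cos x"
    using s c s0 by (intro mult_mono) simp_all
  moreover have "x * (sqrt 2 / 2) * (sqrt 2 / 2) = x / 2"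
    by (simp add: field_simps)
  ultimately have sc: "x \<le> 2 * (sin x * cos x)" by linarith
  have "sin (2 * x) = 2 * (sin x * cos x)" by (simp add: sin_double)
  moreover have "\<bar>sin ((a - b) / 2)\<bar> = \<bar>sin (2 * x)\<bar>"
  proof (cases "a \<ge> b")
    case False
    then have "2 * x = - ((a - b) / 2)" by (simp add: x_def field_simps)
    then show ?thesis by (simp only: sin_minus abs_minus_cancel)
  next
    case True
    then have "2 * x = (a - b) / 2" by (simp add: x_def field_simps)
    then show ?thesis by (simp only:)
  qed
  ultimately have "\<bar>2 * sin ((a - b) / 2)\<bar> = \<bar>2 * (2 * (sin x * cos x))\<bar>"
    by (simp only: abs_mult)
  then have "(cmod (cis a - cis b))\<^sup>2 = (2 * (2 * (sin x * cos x)))\<^sup>2"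
    unfolding norm_cis_diff_sq by (rule power2_eq_iff[THEN iffD2, OF abs_eq_iff[THEN iffD1]])
  then have "cmod (cis a - cis b) = 2 * (2 * (sin x * cos x))"
  proof (rule power2_eq_imp_eq)
    show "0 \<le> 2 * (2 * (sin x * cos x))" using sc x by linarith
  qed simp
  then show ?thesis using sc unfolding x_def by linarith
qed

lemma nn_integral_periodic_any:
  fixes h :: "real \<Rightarrow> ennreal"
  assumes [measurable]: "h \<in> borel_measurable borel" and per: "\<And>t. h (t + 2 * pi) = h t"
    and ab: "\<bar>a - b\<bar> \<le> 2 * pi"
  shows "(\<integral>\<^sup>+t\<in>{a..a + 2 * pi}. h t \<partial>lborel) = (\<integral>\<^sup>+t\<in>{b..b + 2 * pi}. h t \<partial>lborel)"
proof (cases "a \<le> b")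
  case True
  then show ?thesis using ab by (intro nn_integral_periodic_shift assms(1) per) auto
next
  case False
  then show ?thesis using ab by (intro nn_integral_periodic_shift[symmetric] assms(1) per) auto
qed

lemma cis_periodic: "cis (t + 2 * pi) = cis t"
  by (simp add: complex_eq_iff)

text \<open>The cone of aperture \<open>2\<close>. It lies inside all cones of the theorem, because \<open>1 / sin \<alpha> > 2\<close>, and
it is wide enough to contain \<open>z\<close> for all boundary points at angular distance less than \<open>1 - \<bar>z\<bar>\<close>.\<close>

definition near_cone :: "real \<Rightarrow> complex \<Rightarrow> bool" where
  "near_cone t z \<longleftrightarrow> cmod (cis t - z) < 2 * (1 - cmod z)"

lemma near_cone_periodic: "near_cone (t + 2 * pi) z = near_cone t z"
  by (simp add: near_cone_def cis_periodic)

lemma near_cone_measurable [measurable]: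
  assumes [measurable]: "f \<in> borel_measurable M" "g \<in> borel_measurable M"
  shows "Measurable.pred M (\<lambda>x. near_cone (f x) (g x))"
  unfolding near_cone_def by measurable

lemma polar_repr: "z = of_real (cmod z) * cis (Arg z)"
  by (metis rcis_cmod_Arg rcis_def)

lemma dist_circle_point: "cmod (cis (Arg z) - z) = \<bar>1 - cmod z\<bar>"
proof -
  have "cis (Arg z) - of_real (cmod z) * cis (Arg z) = of_real (1 - cmod z) * cis (Arg z)"
    by (simp add: algebra_simps)
  then have "cis (Arg z) - z = of_real (1 - cmod z) * cis (Arg z)"
    using polar_repr[of z] by metis
  then show ?thesis by (metis mult.right_neutral norm_cis norm_mult norm_of_real)
qed

lemma near_coneI:
  assumes "cmod z < 1" "\<bar>t - Arg z\<bar> < 1 - cmod z"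
  shows "near_cone t z"
proof -
  have "cmod (cis t - z) \<le> cmod (cis t - cis (Arg z)) + cmod (cis (Arg z) - z)"
    using norm_triangle_ineq[of "cis t - cis (Arg z)" "cis (Arg z) - z"] by simp
  also have "\<dots> < 2 * (1 - cmod z)"
    using norm_cis_diff_le[of t "Arg z"] assms by (simp add: dist_circle_point)
  finally show ?thesis by (simp add: near_cone_def)
qed

lemma near_coneD:
  assumes "near_cone t z" "\<bar>t - p\<bar> \<le> pi" "cis p = cis (Arg z)"
  shows "\<bar>t - p\<bar> < 6 * (1 - cmod z)"
proof -
  have z: "cmod z < 1" using le_less_trans[OF norm_ge_zero assms(1)[unfolded near_cone_def]] by simp
  have "cmod (cis t - cis p) \<le> cmod (cis t - z) + cmod (z - cis (Arg z))"
    using norm_triangle_ineq[of "cis t - z" "z - cis p"] assms(3) by simp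
  also have "cmod (z - cis (Arg z)) = 1 - cmod z"
    using dist_circle_point[of z] z by (simp add: norm_minus_commute)
  finally show ?thesis using norm_cis_diff_ge[OF assms(2)] assms(1) by (simp add: near_cone_def)
qed

lemma nn_integral_indicator_interval:
  assumes "u \<le> v"
  shows "(\<integral>\<^sup>+t. indicator {u<..<v} t \<partial>lborel) = ennreal (v - u)"
  using assms by simp

text \<open>The points whose cone contains \<open>z\<close> form an arc about \<open>Arg z\<close>; periodicity allows the period of
integration to be centred there.\<close>

lemma near_cone_arc_measure:
  assumes "0 \<le> a + pi" "a \<le> pi"
  shows "(\<integral>\<^sup>+t\<in>{a - pi..a - pi + 2 * pi}. indicator {t. near_cone t z} t \<partial>lborel) \<le> ennreal (12 * (1 - cmod z))"
proof (cases "cmod z < 1")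
  case z: True
  have A: "Arg z \<le> pi" "- pi < Arg z" using Arg_bounded[of z] by auto
  have "(\<integral>\<^sup>+t\<in>{a - pi..a - pi + 2 * pi}. indicator {t. near_cone t z} t \<partial>lborel) =
        (\<integral>\<^sup>+t\<in>{Arg z - pi..Arg z - pi + 2 * pi}. indicator {t. near_cone t z} t \<partial>lborel)"
  proof (rule nn_integral_periodic_any[of "indicator {t. near_cone t z}" "a - pi" "Arg z - pi"])
    show "\<bar>a - pi - (Arg z - pi)\<bar> \<le> 2 * pi" using assms A by linarith
    show "indicator {t. near_cone t z} (t + 2 * pi) = (indicator {t. near_cone t z} t :: ennreal)" for t
      by (simp add: indicator_def near_cone_periodic)
    have "{t. near_cone t z} \<in> sets borel" by measurable
    then show "indicator {t. near_cone t z} \<in> borel_measurable borel" by (rule borel_measurable_indicator)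
  qed
  also have "\<dots> \<le> (\<integral>\<^sup>+t. indicator {Arg z - 6 * (1 - cmod z)<..<Arg z + 6 * (1 - cmod z)} t \<partial>lborel)"
  proof (intro nn_integral_mono)
    fix t
    have "\<bar>t - Arg z\<bar> < 6 * (1 - cmod z)" if "near_cone t z" "t \<in> {Arg z - pi..Arg z - pi + 2 * pi}"
    proof -
      have "\<bar>t - Arg z\<bar> \<le> pi" using that(2) by (simp add: abs_le_iff)
      then show ?thesis by (rule near_coneD[OF that(1) _ refl])
    qed
    then show "indicator {t. near_cone t z} t * indicator {Arg z - pi..Arg z - pi + 2 * pi} t
        \<le> (indicator {Arg z - 6 * (1 - cmod z)<..<Arg z + 6 * (1 - cmod z)} t :: ennreal)"
      by (auto simp: indicator_def abs_less_iff)
  qed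
  also have "\<dots> = ennreal (12 * (1 - cmod z))"
    using z by (subst nn_integral_indicator_interval) auto
  finally show ?thesis .
next
  case False
  have "\<not> near_cone t z" for t
    using False le_less_trans[OF norm_ge_zero, of "cis t - z" "2 * (1 - cmod z)"] unfolding near_cone_def by auto
  then show ?thesis by simp
qed

lemma carleson_square_measurable [measurable]: "carleson_square a b \<in> sets borel"
proof -
  have "compact (cis ` {a..b})"
    by (intro compact_continuous_image continuous_intros) simp
  then have [measurable]: "cis ` {a..b} \<in> sets borel"
    by (intro borel_closed compact_imp_closed)
  show ?thesis unfolding carleson_square_def by measurable
qed

lemma ex_angle_near:
  obtains p where "cis p = cis s" "\<bar>t - p\<bar> \<le> pi"
proof
  let ?q = "Arg (cis (t - s))"
  have "cis ?q = cis (t - s)" by (simp add: cis_Arg sgn_div_norm)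
  then have "cis (t - ?q) = cis t / cis (t - s)" by (simp add: cis_divide[symmetric])
  also have "\<dots> = cis s" by (simp add: cis_divide)
  finally show "cis (t - ?q) = cis s" .
  show "\<bar>t - (t - ?q)\<bar> \<le> pi" using Arg_bounded[of "cis (t - s)"] by (simp add: abs_le_iff)
qed

definition truncated_area :: "(complex \<Rightarrow> ennreal) \<Rightarrow> real \<Rightarrow> real \<Rightarrow> ennreal" where
  "truncated_area A d t = (\<integral>\<^sup>+z. (A z)\<^sup>2 * indicator {z. near_cone t z \<and> 1 - cmod z \<le> d} z \<partial>lborel)"

text \<open>By Tonelli, averaging the truncated area integral over an arc of half-length \<open>\<delta> = 1 - \<bar>z\<bar>\<close>
integrates \<open>A\<^sup>2\<close> against the length of the arc that sees each point, which is at most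
\<open>12 (1 - \<bar>w\<bar>)\<close>. The points that are seen at all lie in a single Carleson square of size
comparable to \<open>\<delta>\<close>, of normalized length at most \<open>9/2 \<delta>\<close>.\<close>

lemma carleson_average:
  fixes A :: "complex \<Rightarrow> ennreal"
  assumes [measurable]: "A \<in> borel_measurable borel"
    and supp: "\<And>z. A z \<noteq> 0 \<Longrightarrow> 0 < cmod z \<and> cmod z < 1"
    and K: "0 \<le> K"
    and carl: "\<And>a b. a < b \<Longrightarrow> b \<le> a + 2 * pi \<Longrightarrow>
       (\<integral>\<^sup>+z\<in>carleson_square a b. (A z)\<^sup>2 * ennreal (1 - cmod z) \<partial>lborel) \<le> ennreal (K * arc_length a b)"
    and z: "0 < cmod z" "cmod z < 1" and d: "d < 2 * (1 - cmod z)"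
  shows "(\<integral>\<^sup>+t\<in>{Arg z - (1 - cmod z)<..<Arg z + (1 - cmod z)}. truncated_area A d t \<partial>lborel)
     \<le> ennreal (54 * K * (1 - cmod z))"
proof -
  define \<delta> where "\<delta> = 1 - cmod z"
  \<comment> \<open>The arc of half-length \<open>13 \<delta>\<close> about \<open>Arg z\<close>, or the whole circle if that arc would overlap itself.\<close>
  define a where "a = (if 26 * \<delta> \<le> 2 * pi then Arg z - 13 * \<delta> else Arg z - pi)"
  define b where "b = (if 26 * \<delta> \<le> 2 * pi then Arg z + 13 * \<delta> else Arg z + pi)"
  have \<delta>: "0 < \<delta>" "\<delta> < 1" "d < 2 * \<delta>" using z d by (auto simp: \<delta>_def)
  have ab: "a < b" "b \<le> a + 2 * pi" using \<delta> pi_gt_zero by (auto simp: a_def b_def)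
  have arc: "arc_length a b \<le> 9 / 2 * \<delta>"
  proof -
    have "b - a \<le> 26 * \<delta>" by (auto simp: a_def b_def)
    also have "26 * \<delta> \<le> 9 / 2 * \<delta> * (2 * pi)" using \<delta> pi_gt3 by simp
    finally show ?thesis by (simp add: arc_length_def divide_le_eq algebra_simps)
  qed
  have Az: "- pi < Arg z" "Arg z \<le> pi" using Arg_bounded[of z] by auto
  let ?I = "{Arg z - \<delta><..<Arg z + \<delta>}"
  let ?P = "\<lambda>t w. near_cone t w \<and> 1 - cmod w \<le> d"
  let ?J = "\<lambda>w. \<integral>\<^sup>+t. indicator ?I t * indicator {t. ?P t w} t \<partial>lborel"
  have sq: "w \<in> carleson_square a b" if w: "0 < cmod w" "cmod w < 1" and t: "t \<in> ?I" "?P t w" for w t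
  proof -
    have cA: "cis (Arg w) = w / of_real (cmod w)"
      using w by (simp add: cis_Arg sgn_eq)
    have wd: "1 - cmod w < 2 * \<delta>" using t \<delta> by simp
    show ?thesis
    proof (cases "26 * \<delta> \<le> 2 * pi")
      case True
      obtain p where p: "cis p = cis (Arg w)" "\<bar>t - p\<bar> \<le> pi" by (rule ex_angle_near)
      have "\<bar>t - p\<bar> < 6 * (1 - cmod w)" using near_coneD[OF _ p(2,1)] t by blast
      then have "\<bar>p - Arg z\<bar> \<le> 13 * \<delta>" using t(1) wd by (simp add: abs_le_iff abs_less_iff)
      then have 1: "p \<in> {a..b}" using True by (simp add: a_def b_def abs_le_iff)
      have "1 * \<delta> \<le> arc_length a b / 2"
      proof -
        have "2 * \<delta> * (2 * pi) \<le> 26 * \<delta>" using \<delta> pi_less_4 by simp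
        also have "\<dots> = b - a" using True by (simp add: a_def b_def)
        finally show ?thesis by (simp add: arc_length_def le_divide_eq field_simps)
      qed
      then have 2: "1 - arc_length a b \<le> cmod w" using wd by simp
      show ?thesis using w 2 imageI[OF 1, of cis] p(1) cA by (simp add: carleson_square_def)
    next
      case False
      obtain p where p: "cis p = cis (Arg w)" "\<bar>Arg z - p\<bar> \<le> pi" by (rule ex_angle_near)
      have 1: "p \<in> {a..b}" using False p(2) by (simp add: a_def b_def abs_le_iff)
      have "arc_length a b = 1" using False by (simp add: a_def b_def arc_length_def)
      then show ?thesis using w imageI[OF 1, of cis] p(1) cA by (simp add: carleson_square_def)
    qed
  qed
  have inner: "?J w \<le> ennreal (12 * (1 - cmod w))" for w
  proof -
    have "?J w \<le> (\<integral>\<^sup>+t\<in>{Arg z - pi..Arg z - pi + 2 * pi}. indicator {t. near_cone t w} t \<partial>lborel)"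
      using \<delta> pi_gt3 by (intro nn_integral_mono) (auto simp: indicator_def)
    also have "\<dots> \<le> ennreal (12 * (1 - cmod w))"
      using Az by (intro near_cone_arc_measure) auto
    finally show ?thesis .
  qed
  have pt: "(A w)\<^sup>2 * ?J w \<le> ennreal 12 * ((A w)\<^sup>2 * ennreal (1 - cmod w) * indicator (carleson_square a b) w)" for w
  proof (cases "A w = 0")
    case False
    then have w: "0 < cmod w" "cmod w < 1" using supp by auto
    show ?thesis
    proof (cases "w \<in> carleson_square a b")
      case True
      have "(A w)\<^sup>2 * ?J w \<le> (A w)\<^sup>2 * ennreal (12 * (1 - cmod w))"
        by (intro mult_left_mono inner) simp
      also have "\<dots> = ennreal 12 * ((A w)\<^sup>2 * ennreal (1 - cmod w))"
        using w by (subst ennreal_mult) (simp_all add: ac_simps)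
      finally show ?thesis using True by simp
    next
      case False
      then have "indicator ?I t * indicator {t. ?P t w} t = (0::ennreal)" for t
        using sq[OF w, of t] by (auto simp: indicator_def)
      then have "?J w = (\<integral>\<^sup>+(t::real). 0 \<partial>lborel)" by (intro nn_integral_cong)
      then show ?thesis by (simp only:) simp
    qed
  qed simp
  have "(\<integral>\<^sup>+t\<in>?I. truncated_area A d t \<partial>lborel) =
    (\<integral>\<^sup>+t. \<integral>\<^sup>+w. (A w)\<^sup>2 * (indicator ?I t * indicator {t. ?P t w} t) \<partial>lborel \<partial>lborel)"
    unfolding truncated_area_def
    by (subst nn_integral_multc[symmetric]) (auto intro!: nn_integral_cong simp: indicator_def)
  also have "\<dots> = (\<integral>\<^sup>+w. \<integral>\<^sup>+t. (A w)\<^sup>2 * (indicator ?I t * indicator {t. ?P t w} t) \<partial>lborel \<partial>lborel)"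
    by (rule lborel_pair.Fubini'[symmetric]) measurable
  also have "\<dots> = (\<integral>\<^sup>+w. (A w)\<^sup>2 * ?J w \<partial>lborel)"
    by (intro nn_integral_cong nn_integral_cmult) measurable
  also have "\<dots> \<le> (\<integral>\<^sup>+w. ennreal 12 * ((A w)\<^sup>2 * ennreal (1 - cmod w) * indicator (carleson_square a b) w) \<partial>lborel)"
    by (intro nn_integral_mono pt)
  also have "\<dots> = ennreal 12 * (\<integral>\<^sup>+w\<in>carleson_square a b. (A w)\<^sup>2 * ennreal (1 - cmod w) \<partial>lborel)"
    by (rule nn_integral_cmult) measurable
  also have "\<dots> \<le> ennreal 12 * ennreal (K * arc_length a b)"
    by (intro mult_left_mono carl ab) simp
  also have "\<dots> = ennreal (12 * (K * arc_length a b))"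
    by (rule ennreal_mult'[symmetric]) simp
  also have "\<dots> \<le> ennreal (54 * K * \<delta>)"
    using mult_left_mono[OF arc K] by (intro ennreal_leI) simp
  finally show ?thesis unfolding \<delta>_def .
qed

lemma truncated_area_measurable [measurable]:
  assumes [measurable]: "A \<in> borel_measurable borel"
  shows "truncated_area A d \<in> borel_measurable borel"
  unfolding truncated_area_def by measurable

lemma truncated_area_periodic: "truncated_area A d (t + 2 * pi) = truncated_area A d t"
  by (simp add: truncated_area_def near_cone_periodic)

text \<open>The stopping rule: the area integral over the part of the cone at \<open>t\<close> up to the height of \<open>z\<close> must
not exceed \<open>M\<^sup>2\<close>. Heights are rounded up to powers of \<open>1/2\<close>, so that the admissible heights, if
there are any, have a largest one.\<close>

definition good_pair :: "(complex \<Rightarrow> ennreal) \<Rightarrow> real \<Rightarrow> complex \<Rightarrow> real \<Rightarrow> bool" where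
  "good_pair A M z t \<longleftrightarrow> near_cone t z \<and>
     (\<exists>k::nat. (1/2) ^ Suc k < 1 - cmod z \<and> 1 - cmod z \<le> (1/2) ^ k \<and> truncated_area A ((1/2) ^ k) t \<le> ennreal (M\<^sup>2))"

lemma good_pair_measurable [measurable]:
  assumes [measurable]: "A \<in> borel_measurable borel" "f \<in> borel_measurable N" "g \<in> borel_measurable N"
  shows "Measurable.pred N (\<lambda>x. good_pair A M (f x) (g x))"
  unfolding good_pair_def by measurable

text \<open>All good points lie below the largest admissible dyadic height, where the truncated area integral is
at most \<open>M\<^sup>2\<close> by definition.\<close>

lemma good_pair_area:
  assumes [measurable]: "A \<in> borel_measurable borel"
  shows "(\<integral>\<^sup>+z. (A z)\<^sup>2 * indicator {z. good_pair A M z t} z \<partial>lborel) \<le> ennreal (M\<^sup>2)"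
proof (cases "\<exists>k. truncated_area A ((1/2) ^ k) t \<le> ennreal (M\<^sup>2)")
  case True
  \<comment> \<open>The least exponent belongs to the largest height, below which all other admissible heights lie.\<close>
  define k where "k = (LEAST k. truncated_area A ((1/2) ^ k) t \<le> ennreal (M\<^sup>2))"
  have k: "truncated_area A ((1/2) ^ k) t \<le> ennreal (M\<^sup>2)"
    unfolding k_def using True by (rule LeastI_ex)
  have "near_cone t z \<and> 1 - cmod z \<le> (1/2) ^ k" if g: "good_pair A M z t" for z
  proof -
    obtain j where j: "1 - cmod z \<le> (1/2) ^ j" "truncated_area A ((1/2) ^ j) t \<le> ennreal (M\<^sup>2)" "near_cone t z"
      using g unfolding good_pair_def by blast
    have "k \<le> j" unfolding k_def using j(2) by (rule Least_le)
    then have "(1/2 :: real) ^ j \<le> (1/2) ^ k" by (intro power_decreasing) auto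
    then show ?thesis using j by (intro conjI j(3) order_trans[OF j(1)])
  qed
  then have "(\<integral>\<^sup>+z. (A z)\<^sup>2 * indicator {z. good_pair A M z t} z \<partial>lborel) \<le> truncated_area A ((1/2) ^ k) t"
    unfolding truncated_area_def by (intro nn_integral_mono) (auto simp: indicator_def)
  then show ?thesis using k by simp
next
  case False
  then have "\<not> good_pair A M z t" for z by (auto simp: good_pair_def)
  then show ?thesis by simp
qed

lemma ex_dyadic_height:
  fixes x :: real
  assumes "0 < x" "x < 1"
  obtains k :: nat where "(1/2) ^ Suc k < x" "x \<le> (1/2) ^ k"
proof -
  have ex: "\<exists>n. (1/2) ^ n < x" using real_arch_pow_inv[OF assms(1), of "1/2"] by auto
  define n where "n = (LEAST n. (1/2) ^ n < x)"
  have n: "(1/2) ^ n < x" unfolding n_def using ex by (rule LeastI_ex)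
  have "n \<noteq> 0" using n assms by (cases n) auto
  then obtain k where k: "n = Suc k" by (cases n) auto
  have "\<not> (1/2) ^ k < x" using not_less_Least[of k "\<lambda>n. (1/2) ^ n < x"] k unfolding n_def by simp
  then show ?thesis using that[of k] n k by simp
qed

text \<open>Chebyshev's inequality: on the arc of length \<open>2 \<delta>\<close> about \<open>Arg z\<close> the truncated area integral
averages to at most \<open>M\<^sup>2 / 2\<close>, so that it exceeds \<open>M\<^sup>2\<close> on at most half of the arc.\<close>

lemma good_pair_measure:
  fixes A :: "complex \<Rightarrow> ennreal"
  assumes [measurable]: "A \<in> borel_measurable borel"
    and supp: "\<And>z. A z \<noteq> 0 \<Longrightarrow> 0 < cmod z \<and> cmod z < 1"
    and K: "0 \<le> K"
    and carl: "\<And>a b. a < b \<Longrightarrow> b \<le> a + 2 * pi \<Longrightarrow>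
       (\<integral>\<^sup>+z\<in>carleson_square a b. (A z)\<^sup>2 * ennreal (1 - cmod z) \<partial>lborel) \<le> ennreal (K * arc_length a b)"
    and M: "0 < M" "54 * K \<le> M\<^sup>2"
    and z: "0 < cmod z" "cmod z < 1"
  shows "ennreal (1 - cmod z) \<le> (\<integral>\<^sup>+t\<in>{0..2 * pi}. indicator {t. good_pair A M z t} t \<partial>lborel)"
proof -
  define \<delta> where "\<delta> = 1 - cmod z"
  have \<delta>: "0 < \<delta>" "\<delta> < 1" using z by (auto simp: \<delta>_def)
  obtain k :: nat where k: "(1/2) ^ Suc k < \<delta>" "\<delta> \<le> (1/2) ^ k" using ex_dyadic_height[OF \<delta>] .
  define d :: real where "d = (1/2) ^ k"
  have d: "d < 2 * (1 - cmod z)" using k by (simp add: d_def \<delta>_def)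
  have Az: "- pi < Arg z" "Arg z \<le> pi" using Arg_bounded[of z] by auto
  let ?I = "{Arg z - \<delta><..<Arg z + \<delta>}"
  let ?bad = "{t \<in> ?I. \<not> truncated_area A d t \<le> ennreal (M\<^sup>2)}"
  let ?good = "{t \<in> ?I. truncated_area A d t \<le> ennreal (M\<^sup>2)}"
  have "emeasure lborel {t \<in> ?I. 1 \<le> ennreal (1 / M\<^sup>2) * truncated_area A d t} \<le>
      ennreal (1 / M\<^sup>2) * (\<integral>\<^sup>+t. truncated_area A d t * indicator ?I t \<partial>lborel)"
    by (rule nn_integral_Markov_inequality) measurable
  also have "\<dots> \<le> ennreal (1 / M\<^sup>2) * ennreal (54 * K * \<delta>)"
    using carleson_average[OF assms(1) supp K carl z d] unfolding \<delta>_def by (intro mult_left_mono) auto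
  also have "\<dots> = ennreal (1 / M\<^sup>2 * (54 * K * \<delta>))"
    using M by (intro ennreal_mult'[symmetric]) simp
  also have "\<dots> \<le> ennreal \<delta>"
    using M \<delta> by (intro ennreal_leI) (simp add: divide_le_eq mult_right_mono mult.commute)
  finally have ch: "emeasure lborel {t \<in> ?I. 1 \<le> ennreal (1 / M\<^sup>2) * truncated_area A d t} \<le> ennreal \<delta>" .
  have "1 \<le> ennreal (1 / M\<^sup>2) * truncated_area A d t" if "\<not> truncated_area A d t \<le> ennreal (M\<^sup>2)" for t
  proof -
    have "1 = ennreal (1 / M\<^sup>2) * ennreal (M\<^sup>2)"
      using M by (subst ennreal_mult[symmetric]) auto
    also have "\<dots> \<le> ennreal (1 / M\<^sup>2) * truncated_area A d t"
      using that by (intro mult_left_mono) auto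
    finally show ?thesis .
  qed
  then have "?bad \<subseteq> {t \<in> ?I. 1 \<le> ennreal (1 / M\<^sup>2) * truncated_area A d t}" by blast
  then have bad: "emeasure lborel ?bad \<le> ennreal \<delta>"
    by (rule order_trans[OF emeasure_mono ch]) measurable
  have "ennreal (2 * \<delta>) = emeasure lborel ?I" using \<delta> by simp
  also have "\<dots> = emeasure lborel (?good \<union> ?bad)"
    by (rule arg_cong[where f = "emeasure lborel"]) auto
  also have "\<dots> = emeasure lborel ?good + emeasure lborel ?bad"
    by (rule plus_emeasure[symmetric]) (measurable, auto)
  also have "\<dots> \<le> emeasure lborel ?good + ennreal \<delta>"
    by (intro add_left_mono bad)
  finally have "ennreal \<delta> + ennreal \<delta> \<le> emeasure lborel ?good + ennreal \<delta>"
    using \<delta> by (simp add: ennreal_plus[symmetric] del: ennreal_plus)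
  then have "ennreal \<delta> \<le> emeasure lborel ?good"
    by (simp add: add.commute ennreal_add_left_cancel_le)
  also have "\<dots> = (\<integral>\<^sup>+t. indicator ?good t \<partial>lborel)" by simp
  also have "\<dots> \<le> (\<integral>\<^sup>+t\<in>{Arg z - pi..Arg z - pi + 2 * pi}. indicator {t. good_pair A M z t} t \<partial>lborel)"
  proof (intro nn_integral_mono)
    fix t
    have "good_pair A M z t \<and> t \<in> {Arg z - pi..Arg z - pi + 2 * pi}" if "t \<in> ?good"
    proof -
      have "near_cone t z" using that z by (intro near_coneI) (auto simp: \<delta>_def abs_less_iff)
      then have "good_pair A M z t"
        using that k unfolding good_pair_def d_def \<delta>_def by blast
      then show ?thesis using that \<delta> pi_gt3 by auto
    qed
    then show "indicator ?good t \<le> indicator {t. good_pair A M z t} t * (indicator {Arg z - pi..Arg z - pi + 2 * pi} t :: ennreal)"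
      by (cases "t \<in> ?good") (auto simp: indicator_def)
  qed
  also have "\<dots> = (\<integral>\<^sup>+t\<in>{0..0 + 2 * pi}. indicator {t. good_pair A M z t} t \<partial>lborel)"
  proof (rule nn_integral_periodic_any[of "indicator {t. good_pair A M z t}" "Arg z - pi" 0])
    show "\<bar>Arg z - pi - 0\<bar> \<le> 2 * pi" using Az by linarith
    show "indicator {t. good_pair A M z t} (t + 2 * pi) = (indicator {t. good_pair A M z t} t :: ennreal)" for t
      by (simp add: indicator_def good_pair_def near_cone_periodic truncated_area_periodic)
    have "{t. good_pair A M z t} \<in> sets borel" by measurable
    then show "indicator {t. good_pair A M z t} \<in> borel_measurable borel" by (rule borel_measurable_indicator)
  qed
  finally show ?thesis by (simp add: \<delta>_def)
qed

lemma ennreal_sqrt_measurable [measurable]: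
  assumes [measurable]: "f \<in> borel_measurable N"
  shows "(\<lambda>x. ennreal_sqrt (f x)) \<in> borel_measurable N"
  unfolding ennreal_sqrt_def by measurable

lemma le_ennreal_sqrt:
  assumes "x\<^sup>2 \<le> ennreal (M\<^sup>2) * y" "0 \<le> M"
  shows "x \<le> ennreal M * ennreal_sqrt y"
proof (cases "M = 0 \<or> y = \<infinity>")
  case True
  show ?thesis
  proof (cases "M = 0")
    case True
    then have "x\<^sup>2 = 0" using assms by simp
    then show ?thesis by simp
  next
    case False
    then show ?thesis using True assms(2) by (simp add: ennreal_sqrt_def ennreal_mult_top)
  qed
next
  case False
  then obtain s where s: "y = ennreal s" "0 \<le> s" by (cases y) auto
  have "x \<noteq> \<infinity>"
  proof
    assume "x = \<infinity>"
    then have "x\<^sup>2 = \<infinity>" by (simp add: power2_eq_square)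
    then show False using assms s by (simp add: ennreal_mult[symmetric] top_unique)
  qed
  then obtain r where r: "x = ennreal r" "0 \<le> r" by (cases x) auto
  have "r\<^sup>2 \<le> M\<^sup>2 * s"
    using assms r s by (simp add: ennreal_power ennreal_mult[symmetric] ennreal_le_iff)
  then have "r \<le> sqrt (M\<^sup>2 * s)" using r by (simp add: real_le_rsqrt)
  then have "r \<le> M * sqrt s" using assms by (simp add: real_sqrt_mult)
  then show ?thesis using r s assms by (simp add: ennreal_sqrt_def ennreal_mult[symmetric] ennreal_leI)
qed

text \<open>By \<open>good_pair_measure\<close> the weight \<open>1 - \<bar>z\<bar>\<close> may be replaced by the measure of the set of \<open>t\<close>
that form a good pair with \<open>z\<close>. After Tonelli, Cauchy-Schwarz is applied for each \<open>t\<close>, where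
\<open>good_pair_area\<close> bounds the factor that contains \<open>A\<close>.\<close>

theorem tent_estimate:
  fixes A B :: "complex \<Rightarrow> ennreal"
  assumes A[measurable]: "A \<in> borel_measurable borel" and [measurable]: "B \<in> borel_measurable borel"
    and supp: "\<And>z. A z \<noteq> 0 \<Longrightarrow> 0 < cmod z \<and> cmod z < 1"
    and K: "0 \<le> K"
    and carl: "\<And>a b. a < b \<Longrightarrow> b \<le> a + 2 * pi \<Longrightarrow>
       (\<integral>\<^sup>+z\<in>carleson_square a b. (A z)\<^sup>2 * ennreal (1 - cmod z) \<partial>lborel) \<le> ennreal (K * arc_length a b)"
    and M: "0 < M" "54 * K \<le> M\<^sup>2"
  shows "(\<integral>\<^sup>+z. A z * B z * ennreal (1 - cmod z) \<partial>lborel) \<le>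
     ennreal M * (\<integral>\<^sup>+t\<in>{0..2 * pi}. ennreal_sqrt (\<integral>\<^sup>+z\<in>{z. near_cone t z}. (B z)\<^sup>2 \<partial>lborel) \<partial>lborel)"
proof -
  let ?S = "\<lambda>t. \<integral>\<^sup>+z\<in>{z. near_cone t z}. (B z)\<^sup>2 \<partial>lborel"
  let ?g = "\<lambda>z t. indicator {t. good_pair A M z t} t :: ennreal"
  have "(\<integral>\<^sup>+z. A z * B z * ennreal (1 - cmod z) \<partial>lborel) \<le>
      (\<integral>\<^sup>+z. A z * B z * (\<integral>\<^sup>+t\<in>{0..2 * pi}. ?g z t \<partial>lborel) \<partial>lborel)"
  proof (intro nn_integral_mono)
    fix z
    show "A z * B z * ennreal (1 - cmod z) \<le> A z * B z * (\<integral>\<^sup>+t\<in>{0..2 * pi}. ?g z t \<partial>lborel)"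
    proof (cases "A z = 0")
      case False
      then show ?thesis
        using supp[of z] good_pair_measure[OF A supp K carl M, of z] by (intro mult_left_mono) auto
    qed simp
  qed
  also have "\<dots> = (\<integral>\<^sup>+z. \<integral>\<^sup>+t. A z * B z * (?g z t * indicator {0..2 * pi} t) \<partial>lborel \<partial>lborel)"
    by (intro nn_integral_cong nn_integral_cmult[symmetric]) measurable
  also have "\<dots> = (\<integral>\<^sup>+t. \<integral>\<^sup>+z. A z * B z * (?g z t * indicator {0..2 * pi} t) \<partial>lborel \<partial>lborel)"
    by (rule lborel_pair.Fubini') measurable
  also have "\<dots> \<le> (\<integral>\<^sup>+t. ennreal M * (ennreal_sqrt (?S t) * indicator {0..2 * pi} t) \<partial>lborel)"
  proof (intro nn_integral_mono)
    fix t
    let ?X = "\<lambda>z. A z * indicator {z. good_pair A M z t} z"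
    let ?Y = "\<lambda>z. B z * indicator {z. near_cone t z} z"
    have eq: "A z * B z * ?g z t = ?X z * ?Y z" for z
      by (auto simp: indicator_def good_pair_def)
    have "(\<integral>\<^sup>+z. ?X z * ?Y z \<partial>lborel)\<^sup>2 \<le> (\<integral>\<^sup>+z. (?X z)\<^sup>2 \<partial>lborel) * (\<integral>\<^sup>+z. (?Y z)\<^sup>2 \<partial>lborel)"
      by (rule Cauchy_Schwarz_nn_integral) measurable
    also have "(\<integral>\<^sup>+z. (?X z)\<^sup>2 \<partial>lborel) = (\<integral>\<^sup>+z. (A z)\<^sup>2 * indicator {z. good_pair A M z t} z \<partial>lborel)"
      by (intro nn_integral_cong) (auto simp: indicator_def)
    also have "(\<integral>\<^sup>+z. (?Y z)\<^sup>2 \<partial>lborel) = ?S t"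
      by (intro nn_integral_cong) (auto simp: indicator_def)
    also have "(\<integral>\<^sup>+z. (A z)\<^sup>2 * indicator {z. good_pair A M z t} z \<partial>lborel) * ?S t
      \<le> ennreal (M\<^sup>2) * ?S t"
      by (intro mult_right_mono good_pair_area A) simp
    finally have "(\<integral>\<^sup>+z. ?X z * ?Y z \<partial>lborel) \<le> ennreal M * ennreal_sqrt (?S t)"
      using M by (intro le_ennreal_sqrt) auto
    then show "(\<integral>\<^sup>+z. A z * B z * (?g z t * indicator {0..2 * pi} t) \<partial>lborel) \<le>
        ennreal M * (ennreal_sqrt (?S t) * indicator {0..2 * pi} t)"
      by (cases "t \<in> {0..2 * pi}") (auto simp: eq)
  qed
  also have "\<dots> = ennreal M * (\<integral>\<^sup>+t\<in>{0..2 * pi}. ennreal_sqrt (?S t) \<partial>lborel)"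
    by (rule nn_integral_cmult) measurable
  finally show ?thesis .
qed

section \<open>Poisson integrals of integrable functions on the circle\<close>

abbreviation circ :: "real measure" where
  "circ \<equiv> lebesgue_on {0..2 * pi}"

lemma finite_measure_circ: "finite_measure circ"
  by (rule finite_measureI) (simp add: emeasure_restrict_space space_restrict_space)

lemma pair_circ: "pair_sigma_finite circ circ"
proof -
  interpret finite_measure circ by (rule finite_measure_circ)
  show ?thesis unfolding pair_sigma_finite_def using sigma_finite_measure_axioms by blast
qed

lemma continuous_measurable_circ:
  fixes f :: "real \<Rightarrow> 'b::euclidean_space"
  assumes "continuous_on UNIV f"
  shows "f \<in> borel_measurable circ"
  by (rule continuous_imp_measurable_on_sets_lebesgue[OF continuous_on_subset[OF assms]]) auto

lemma id_measurable_circ [measurable]: "(\<lambda>x. x) \<in> borel_measurable circ"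
  by (rule continuous_measurable_circ) simp

lemma circle_L1_iff: "f \<in> circle_L1 \<longleftrightarrow> integrable circ (\<lambda>t. f (cis t))"
  by (simp add: circle_L1_def set_integrable_def integrable_restrict_space)

lemma circle_integral_eq: "circle_integral f = (\<integral>t. f (cis t) \<partial>circ)"
  by (simp add: circle_integral_def set_lebesgue_integral_def integral_restrict_space)

lemma nn_integral_circ: "(\<integral>\<^sup>+t. h t \<partial>circ) = (\<integral>\<^sup>+t\<in>{0..2 * pi}. h t \<partial>lborel)"
  by (simp add: nn_integral_restrict_space nn_integral_completion)

lemma integral_circ_continuous:
  fixes f :: "real \<Rightarrow> 'b::euclidean_space"
  assumes "continuous_on {0..2 * pi} f"
  shows "integrable circ f" "(\<integral>t. f t \<partial>circ) = integral {0..2 * pi} f"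
proof -
  have "f absolutely_integrable_on {0..2 * pi}"
    using assms by (rule absolutely_integrable_continuous_real)
  then have f: "set_integrable lebesgue {0..2 * pi} f" .
  then show "integrable circ f"
    by (simp add: set_integrable_def integrable_restrict_space)
  have "(\<integral>t. f t \<partial>circ) = (LINT t:{0..2 * pi}|lebesgue. f t)"
    by (simp add: set_lebesgue_integral_def integral_restrict_space)
  also have "\<dots> = integral {0..2 * pi} f"
    by (rule set_lebesgue_integral_eq_integral(2)[OF f])
  finally show "(\<integral>t. f t \<partial>circ) = integral {0..2 * pi} f" .
qed

definition poisson_kernel :: "complex \<Rightarrow> real \<Rightarrow> real" where
  "poisson_kernel z t = (1 - (cmod z)\<^sup>2) / (cmod (cis t - z))\<^sup>2"

lemma circle_dist_pos: "cmod z < 1 \<Longrightarrow> 1 - cmod z \<le> cmod (cis t - z)"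
  using norm_triangle_ineq2[of "cis t" z] by simp

lemma poisson_kernel_nonneg: "cmod z < 1 \<Longrightarrow> 0 \<le> poisson_kernel z t"
  by (simp add: poisson_kernel_def power_le_one)

lemma poisson_kernel_le:
  assumes "cmod z < 1"
  shows "poisson_kernel z t \<le> (1 + cmod z) / (1 - cmod z)"
proof -
  have "poisson_kernel z t \<le> (1 - (cmod z)\<^sup>2) / (1 - cmod z)\<^sup>2"
    unfolding poisson_kernel_def using assms circle_dist_pos[OF assms, of t]
    by (intro frac_le power_mono) (simp_all add: power_le_one)
  also have "\<dots> = (1 + cmod z) / (1 - cmod z)"
  proof -
    have "1 - (cmod z)\<^sup>2 = (1 - cmod z) * (1 + cmod z)"
      by (simp add: power2_eq_square algebra_simps)
    then show ?thesis using assms by (simp only: power2_eq_square) simp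
  qed
  finally show ?thesis .
qed

lemma poisson_kernel_continuous:
  assumes "cmod z < 1"
  shows "continuous_on S (poisson_kernel z)"
proof -
  have "cmod (cis t - z) \<noteq> 0" for t using circle_dist_pos[OF assms, of t] assms by linarith
  then show ?thesis unfolding poisson_kernel_def by (intro continuous_intros) auto
qed

lemma poisson_kernel_measurable [measurable]:
  assumes [measurable]: "f \<in> borel_measurable M" "g \<in> borel_measurable M"
  shows "(\<lambda>x. poisson_kernel (f x) (g x)) \<in> borel_measurable M"
  unfolding poisson_kernel_def by measurable

text \<open>This symmetry turns the integral over the centre of the kernel into an integral over its angle, which
is what the contraction property needs.\<close>

lemma poisson_kernel_sym: "poisson_kernel (of_real r * cis s) t = poisson_kernel (of_real r * cis t) s"
proof -
  have "cos (t - s) = cos (s - t)" by (simp only: cos_diff mult.commute)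
  then show ?thesis
    unfolding poisson_kernel_def norm_mult norm_cis norm_cis_diff_scaled_sq by simp
qed

text \<open>Cauchy's formula for \<open>q w (1 - \<bar>z\<bar>\<^sup>2) / (1 - cnj z w)\<close>: at \<open>w = z\<close> the extra factor is \<open>1\<close>, and
on the unit circle it turns the Cauchy kernel into the Poisson kernel.\<close>

lemma poisson_formula:
  assumes q: "q holomorphic_on ball 0 \<rho>" and \<rho>: "\<rho> > 1" and z: "cmod z < 1"
  shows "(\<integral>t. of_real (poisson_kernel z t) * q (cis t) \<partial>circ) = of_real (2 * pi) * q z"
proof -
  let ?h = "\<lambda>w. q w * (of_real (1 - (cmod z)\<^sup>2) / (1 - cnj z * w))"
  have nz: "1 - cnj z * w \<noteq> 0" if "cmod w \<le> 1" for w
  proof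
    assume "1 - cnj z * w = 0"
    then have "cmod (cnj z * w) = 1" by (metis eq_iff_diff_eq_0 norm_one)
    moreover have "cmod z * cmod w \<le> cmod z * 1" using that by (intro mult_left_mono) auto
    ultimately show False using z by (simp add: norm_mult)
  qed
  have "q holomorphic_on cball 0 1"
    using \<rho> by (intro holomorphic_on_subset[OF q]) auto
  then have hol: "?h holomorphic_on cball 0 1"
    using nz by (intro holomorphic_intros) auto
  have "((\<lambda>u. ?h u / (u - z)) has_contour_integral (2 * of_real pi * \<i> * ?h z)) (circlepath 0 1)"
    using hol z by (intro Cauchy_integral_circlepath_simple) auto
  then have "((\<lambda>t. ?h (0 + of_real 1 * cis t) / (0 + of_real 1 * cis t - z) * of_real 1 * \<i> * cis t) has_integral (2 * of_real pi * \<i> * ?h z)) {0..2 * pi}"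
    unfolding circlepath_def by (subst (asm) has_contour_integral_part_circlepath_iff) auto
  moreover have "?h (0 + of_real 1 * cis t) / (0 + of_real 1 * cis t - z) * of_real 1 * \<i> * cis t =
      \<i> * (of_real (poisson_kernel z t) * q (cis t))" for t
  proof -
    have nz1: "cis t - z \<noteq> 0" using circle_dist_pos[OF z, of t] z by auto
    have nz2: "1 - cnj z * cis t \<noteq> 0" by (rule nz) simp
    have "of_real ((cmod (cis t - z))\<^sup>2) = (cis t - z) * cnj (cis t - z)"
      by (rule complex_norm_square)
    also have "cnj (cis t - z) * cis t = 1 - cnj z * cis t"
      by (simp add: algebra_simps cis_cnj cis_mult)
    then have "(cis t - z) * cnj (cis t - z) = (cis t - z) * (1 - cnj z * cis t) / cis t"
      by (simp add: field_simps)
    finally have eq: "of_real ((cmod (cis t - z))\<^sup>2) = (cis t - z) * (1 - cnj z * cis t) / cis t" .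
    have "complex_of_real (poisson_kernel z t) = of_real (1 - (cmod z)\<^sup>2) / of_real ((cmod (cis t - z))\<^sup>2)"
      by (simp only: poisson_kernel_def of_real_divide)
    also have "\<dots> = of_real (1 - (cmod z)\<^sup>2) * cis t / ((cis t - z) * (1 - cnj z * cis t))"
      unfolding eq by simp
    finally have "complex_of_real (poisson_kernel z t) = of_real (1 - (cmod z)\<^sup>2) * cis t / ((cis t - z) * (1 - cnj z * cis t))" .
    then show ?thesis by (simp add: mult_ac)
  qed
  ultimately have "((\<lambda>t. \<i> * (of_real (poisson_kernel z t) * q (cis t))) has_integral (2 * of_real pi * \<i> * ?h z)) {0..2 * pi}"
    by simp
  then have I: "((\<lambda>t. -\<i> * (\<i> * (of_real (poisson_kernel z t) * q (cis t)))) has_integral (-\<i> * (2 * of_real pi * \<i> * ?h z))) {0..2 * pi}"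
    by (rule has_integral_mult_right)
  have hz: "?h z = q z"
  proof -
    have "of_real (1 - (cmod z)\<^sup>2) = 1 - cnj z * z"
      by (simp only: of_real_diff of_real_1 complex_norm_square mult.commute)
    then show ?thesis using nz[of z] z by simp
  qed
  have "-\<i> * (2 * of_real pi * \<i> * q z) = of_real (2 * pi) * q z"
    and "-\<i> * (\<i> * w) = w" for w
    by (simp_all add: mult_ac)
  with I[unfolded hz] have "((\<lambda>t. of_real (poisson_kernel z t) * q (cis t)) has_integral (of_real (2 * pi) * q z)) {0..2 * pi}"
    by (simp only:)
  moreover have "continuous_on {0..2 * pi} (\<lambda>t. of_real (poisson_kernel z t) * q (cis t))"
  proof (intro continuous_intros poisson_kernel_continuous z)
    have "continuous_on (ball 0 \<rho>) q" using q by (rule holomorphic_on_imp_continuous_on)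
    then show "continuous_on {0..2 * pi} (\<lambda>t. q (cis t))"
      by (rule continuous_on_compose2) (use \<rho> in \<open>auto intro!: continuous_intros\<close>)
  qed
  ultimately show ?thesis by (simp add: integral_circ_continuous integral_unique)
qed

lemma poisson_kernel_integrable:
  assumes "cmod z < 1"
  shows "integrable circ (poisson_kernel z)"
proof -
  have "integrable circ (\<lambda>t. complex_of_real (poisson_kernel z t))"
    using assms by (intro integral_circ_continuous continuous_intros poisson_kernel_continuous)
  from integrable_Re[OF this] show ?thesis by simp
qed

lemma poisson_kernel_integral:
  assumes "cmod z < 1"
  shows "(\<integral>t. poisson_kernel z t \<partial>circ) = 2 * pi"
proof -
  have "(\<integral>t. complex_of_real (poisson_kernel z t) \<partial>circ) = of_real (2 * pi)"
    using poisson_formula[of "\<lambda>_. 1" 2 z] assms by simp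
  then show ?thesis unfolding integral_complex_of_real of_real_eq_iff .
qed

lemma poisson_kernel_nn_integral:
  assumes "cmod z < 1"
  shows "(\<integral>\<^sup>+t. ennreal (poisson_kernel z t) \<partial>circ) = ennreal (2 * pi)"
  using assms by (subst nn_integral_eq_integral)
    (auto simp: poisson_kernel_integral poisson_kernel_integrable poisson_kernel_nonneg)

text \<open>The boundary function is given in terms of the angle, which keeps all integrals on an interval of the
line.\<close>

definition poisson_integral :: "(real \<Rightarrow> complex) \<Rightarrow> complex \<Rightarrow> complex" where
  "poisson_integral u z = (\<integral>t. of_real (poisson_kernel z t) * u t \<partial>circ) / of_real (2 * pi)"

lemma harmonic_ext_eq: "harmonic_ext f z = poisson_integral (\<lambda>t. f (cis t)) z"
  by (simp only: harmonic_ext_def circle_integral_eq poisson_integral_def poisson_kernel_def)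

lemma poisson_mult_integrable:
  assumes u: "integrable circ (u :: real \<Rightarrow> complex)" and z: "cmod z < 1"
  shows "integrable circ (\<lambda>t. of_real (poisson_kernel z t) * u t)"
proof (rule Bochner_Integration.integrable_bound)
  show "integrable circ (\<lambda>t. (1 + cmod z) / (1 - cmod z) * norm (u t))"
    using u by simp
  have [measurable]: "u \<in> borel_measurable circ" using u by simp
  show "(\<lambda>t. of_real (poisson_kernel z t) * u t) \<in> borel_measurable circ"
    by measurable
  show "AE t in circ. norm (of_real (poisson_kernel z t) * u t) \<le> norm ((1 + cmod z) / (1 - cmod z) * norm (u t))"
  proof (rule AE_I2)
    fix t
    have "poisson_kernel z t * norm (u t) \<le> (1 + cmod z) / (1 - cmod z) * norm (u t)"
      by (intro mult_right_mono poisson_kernel_le z norm_ge_zero)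
    then show "norm (of_real (poisson_kernel z t) * u t) \<le> norm ((1 + cmod z) / (1 - cmod z) * norm (u t))"
      using z poisson_kernel_nonneg[OF z, of t] by (simp add: norm_mult)
  qed
qed

lemma poisson_integral_norm_le:
  assumes u: "integrable circ u" and z: "cmod z < 1"
  shows "cmod (poisson_integral u z) \<le> (\<integral>t. poisson_kernel z t * cmod (u t) \<partial>circ) / (2 * pi)"
proof -
  have "cmod (\<integral>t. of_real (poisson_kernel z t) * u t \<partial>circ) \<le> (\<integral>t. cmod (of_real (poisson_kernel z t) * u t) \<partial>circ)"
    by (rule integral_norm_bound)
  also have "\<dots> = (\<integral>t. poisson_kernel z t * cmod (u t) \<partial>circ)"
    using poisson_kernel_nonneg[OF z] by (simp add: norm_mult)
  finally show ?thesis by (simp add: poisson_integral_def norm_divide divide_right_mono)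
qed

lemma poisson_integral_diff:
  assumes "integrable circ u" "integrable circ v" "cmod z < 1"
  shows "poisson_integral (\<lambda>t. u t - v t) z = poisson_integral u z - poisson_integral v z"
  using poisson_mult_integrable[OF assms(1,3)] poisson_mult_integrable[OF assms(2,3)]
  by (simp add: poisson_integral_def right_diff_distrib diff_divide_distrib)

lemma poisson_integral_measurable [measurable]:
  assumes [measurable]: "u \<in> borel_measurable circ" "f \<in> borel_measurable M"
  shows "(\<lambda>x. poisson_integral u (f x)) \<in> borel_measurable M"
proof -
  interpret finite_measure circ by (rule finite_measure_circ)
  show ?thesis unfolding poisson_integral_def by measurable
qed

lemma poisson_integral_contraction:
  assumes u: "integrable circ u" and r: "0 \<le> r" "r < 1"
  shows "integrable circ (\<lambda>s. poisson_integral u (of_real r * cis s))"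
    and "(\<integral>s. cmod (poisson_integral u (of_real r * cis s)) \<partial>circ) \<le> (\<integral>t. cmod (u t) \<partial>circ)"
proof -
  let ?k = "\<lambda>s t. ennreal (1 / (2 * pi)) * (ennreal (poisson_kernel (of_real r * cis s) t) * ennreal (cmod (u t)))"
    and ?P = "\<lambda>s. poisson_integral u (of_real r * cis s)"
  interpret pair_sigma_finite circ circ by (rule pair_circ)
  have [measurable]: "u \<in> borel_measurable circ" using u by simp
  have z: "cmod (of_real r * cis s) < 1" for s using r by (simp add: norm_mult)
  have "(\<integral>\<^sup>+s. ennreal (cmod (?P s)) \<partial>circ) \<le>
     (\<integral>\<^sup>+s. \<integral>\<^sup>+t. ?k s t \<partial>circ \<partial>circ)"
  proof (intro nn_integral_mono)
    fix s
    have "ennreal (cmod (?P s)) \<le>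
      ennreal ((\<integral>t. poisson_kernel (of_real r * cis s) t * cmod (u t) \<partial>circ) / (2 * pi))"
      by (intro ennreal_leI poisson_integral_norm_le u z)
    also have "\<dots> = ennreal (\<integral>t. 1 / (2 * pi) * (poisson_kernel (of_real r * cis s) t * cmod (u t)) \<partial>circ)"
      by simp
    also have "\<dots> = (\<integral>\<^sup>+t. ennreal (1 / (2 * pi) * (poisson_kernel (of_real r * cis s) t * cmod (u t))) \<partial>circ)"
    proof (rule nn_integral_eq_integral[symmetric])
      have "integrable circ (\<lambda>t. cmod (of_real (poisson_kernel (of_real r * cis s) t) * u t))"
        by (intro integrable_norm poisson_mult_integrable u z)
      then show "integrable circ (\<lambda>t. 1 / (2 * pi) * (poisson_kernel (of_real r * cis s) t * cmod (u t)))"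
        using poisson_kernel_nonneg[OF z] by (simp add: norm_mult)
    qed (use poisson_kernel_nonneg[OF z] in auto)
    also have "\<dots> = (\<integral>\<^sup>+t. ?k s t \<partial>circ)"
    proof (rule nn_integral_cong)
      fix t
      show "ennreal (1 / (2 * pi) * (poisson_kernel (of_real r * cis s) t * cmod (u t))) =
        ?k s t"
        by (subst ennreal_mult', simp) (subst ennreal_mult, simp_all add: poisson_kernel_nonneg z)
    qed
    finally show "ennreal (cmod (?P s)) \<le>
      (\<integral>\<^sup>+t. ?k s t \<partial>circ)" .
  qed
  also have "\<dots> = (\<integral>\<^sup>+t. \<integral>\<^sup>+s. ?k s t \<partial>circ \<partial>circ)"
    by (rule Fubini') measurable
  also have "\<dots> = (\<integral>\<^sup>+t. ennreal (cmod (u t)) \<partial>circ)"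
  proof (rule nn_integral_cong)
    fix t
    have "(\<integral>\<^sup>+s. ?k s t \<partial>circ)
      = (\<integral>\<^sup>+s. ennreal (1 / (2 * pi)) * ennreal (cmod (u t)) * ennreal (poisson_kernel (of_real r * cis t) s) \<partial>circ)"
    proof (rule nn_integral_cong)
      fix s
      show "?k s t
        = ennreal (1 / (2 * pi)) * ennreal (cmod (u t)) * ennreal (poisson_kernel (of_real r * cis t) s)"
        unfolding poisson_kernel_sym[of r s t] by (simp only: ac_simps)
    qed
    also have "\<dots> = ennreal (1 / (2 * pi)) * ennreal (cmod (u t)) * ennreal (2 * pi)"
      by (subst nn_integral_cmult) (simp_all add: poisson_kernel_nn_integral z)
    also have "\<dots> = ennreal (1 / (2 * pi) * cmod (u t) * (2 * pi))"
      by (simp only: ennreal_mult'[symmetric] ennreal_mult''[symmetric] norm_ge_zero mult_nonneg_nonneg) (simp add: ennreal_mult''[symmetric])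
    finally show "(\<integral>\<^sup>+s. ?k s t \<partial>circ)
      = ennreal (cmod (u t))" by simp
  qed
  also have "\<dots> = ennreal (\<integral>t. cmod (u t) \<partial>circ)"
    using u by (intro nn_integral_eq_integral) auto
  finally have le: "(\<integral>\<^sup>+s. ennreal (cmod (?P s)) \<partial>circ) \<le> ennreal (\<integral>t. cmod (u t) \<partial>circ)" .
  then show int: "integrable circ (\<lambda>s. ?P s)"
    by (intro integrableI_bounded) (measurable, auto simp: top_unique less_top[symmetric])
  have "ennreal (\<integral>s. cmod (?P s) \<partial>circ) \<le> ennreal (\<integral>t. cmod (u t) \<partial>circ)"
    using le int by (subst (asm) nn_integral_eq_integral) auto
  then show "(\<integral>s. cmod (?P s) \<partial>circ) \<le> (\<integral>t. cmod (u t) \<partial>circ)"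
    by (simp add: ennreal_le_iff integral_nonneg_AE)
qed

text \<open>Truncate \<open>u\<close>, approximate almost everywhere by continuous functions, clip these at a fixed height
so that dominated convergence applies, and multiply by cut-off functions that vanish at both ends
of the period.\<close>

lemma continuous_approx_circ:
  fixes u :: "real \<Rightarrow> complex"
  assumes u: "integrable circ u" and e: "0 < e"
  obtains k where "continuous_on UNIV k" "k 0 = k (2 * pi)" "(\<integral>t. cmod (u t - k t) \<partial>circ) < e"
proof -
  have [measurable]: "u \<in> borel_measurable circ" using u by simp
  have fin: "integrable circ (\<lambda>_. c)" for c :: real
    using finite_measure_circ by (rule finite_measure.integrable_const)
  define v where "v = (\<lambda>(n::nat) t. if cmod (u t) \<le> real n then u t else 0)"
  have [measurable]: "v n \<in> borel_measurable circ" for n unfolding v_def by measurable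
  have "(\<lambda>n. \<integral>t. cmod (u t - v n t) \<partial>circ) \<longlonglongrightarrow> (\<integral>t. 0 \<partial>circ)"
  proof (rule integral_dominated_convergence[where w = "\<lambda>t. cmod (u t)"])
    show "AE t in circ. (\<lambda>n. cmod (u t - v n t)) \<longlonglongrightarrow> 0"
    proof (rule AE_I2)
      fix t
      obtain N where "cmod (u t) \<le> real N" using real_arch_simple by blast
      then have "\<forall>n\<ge>N. cmod (u t - v n t) = 0" by (auto simp: v_def)
      then show "(\<lambda>n. cmod (u t - v n t)) \<longlonglongrightarrow> 0"
        by (intro tendsto_eventually) (auto simp: eventually_sequentially)
    qed
  qed (use u in \<open>auto simp: v_def\<close>)
  then have "\<forall>\<^sub>F n in sequentially. (\<integral>t. cmod (u t - v n t) \<partial>circ) < e / 2"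
    by (rule order_tendstoD(2)) (use e in simp)
  then obtain N where N: "(\<integral>t. cmod (u t - v N t) \<partial>circ) < e / 2"
    by (meson eventually_happens' sequentially_bot)
  have "v N measurable_on {0..2 * pi}" by (simp add: measurable_on_iff_borel_measurable)
  then obtain Z g where Z: "negligible Z" and g: "\<And>n. continuous_on UNIV (g n)"
      and lim: "\<And>x. x \<notin> Z \<Longrightarrow> (\<lambda>n. g n x) \<longlonglongrightarrow> (if x \<in> {0..2 * pi} then v N x else 0)"
    unfolding measurable_on_def by blast
  define B where "B = real N + 1"
  have B: "B > 0" by (simp add: B_def)
  \<comment> \<open>A continuous retraction of the plane onto the disc of radius \<open>B\<close>.\<close>
  define clip where "clip = (\<lambda>w::complex. w / of_real (max 1 (cmod w / B)))"
  have clip_cont: "continuous_on UNIV clip"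
    using B unfolding clip_def by (intro continuous_intros) auto
  have clip_le: "cmod (clip w) \<le> B" for w
  proof -
    have "B \<noteq> 0" using B by (rule less_imp_neq[symmetric])
    then have "cmod w = cmod w / B * B" by simp
    also have "\<dots> \<le> max 1 (cmod w / B) * B" using B by (intro mult_right_mono) auto
    finally have "cmod w / max 1 (cmod w / B) \<le> B"
      by (subst pos_divide_le_eq) (simp_all add: ac_simps)
    moreover have "cmod (clip w) = cmod w / max 1 (cmod w / B)"
      by (simp add: clip_def norm_divide)
    ultimately show ?thesis by simp
  qed
  have clip_id: "clip w = w" if "cmod w \<le> B" for w
  proof -
    have "cmod w / B \<le> 1" using that B by simp
    then have "max 1 (cmod w / B) = 1" by simp
    then show ?thesis by (simp add: clip_def)
  qed
  \<comment> \<open>Vanishes at \<open>0\<close> and at \<open>2 pi\<close>, so that the approximants close up to functions on the circle.\<close>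
  define c where "c = (\<lambda>(n::nat) t. max 0 (min 1 (real n * min t (2 * pi - t))))"
  define k where "k = (\<lambda>n t. of_real (c n t) * clip (g n t))"
  have c: "0 \<le> c n t" "c n t \<le> 1" for n t by (auto simp: c_def)
  have k_le: "cmod (k n t) \<le> B" for n t
  proof -
    have "c n t * cmod (clip (g n t)) \<le> 1 * B" by (intro mult_mono c clip_le) auto
    then show ?thesis using c(1)[of n t] by (simp add: k_def norm_mult)
  qed
  have k_cont: "continuous_on UNIV (k n)" for n
    unfolding k_def c_def
    by (intro continuous_intros continuous_on_compose2[OF clip_cont g]) auto
  have [measurable]: "k n \<in> borel_measurable circ" for n by (intro continuous_measurable_circ k_cont)
  have k_end: "k n 0 = k n (2 * pi)" for n by (simp add: k_def c_def)
  have v_le: "cmod (v N t) \<le> B" for t by (auto simp: v_def B_def)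
  have "(\<lambda>n. \<integral>t. cmod (v N t - k n t) \<partial>circ) \<longlonglongrightarrow> (\<integral>t. 0 \<partial>circ)"
  proof (rule integral_dominated_convergence[where w = "\<lambda>_. 2 * B"])
    have "AE t in lebesgue. t \<notin> Z \<union> {0, 2 * pi}"
      using Z by (intro AE_not_in) (auto simp: negligible_iff_null_sets[symmetric])
    then have AE: "AE t in circ. t \<notin> Z \<union> {0, 2 * pi}"
      by (subst AE_restrict_space_iff) auto
    have pt: "(\<lambda>n. cmod (v N t - k n t)) \<longlonglongrightarrow> 0" if t: "t \<notin> Z \<union> {0, 2 * pi}" "t \<in> {0..2 * pi}" for t
    proof -
      have "(\<lambda>n. g n t) \<longlonglongrightarrow> v N t" using lim[of t] t by auto
      moreover have "isCont clip (v N t)"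
        using clip_cont by (simp add: continuous_on_eq_continuous_at)
      ultimately have "(\<lambda>n. clip (g n t)) \<longlonglongrightarrow> clip (v N t)"
        by (rule isCont_tendsto_compose[rotated])
      moreover have "clip (v N t) = v N t" by (rule clip_id[OF v_le])
      moreover have "(\<lambda>n. c n t) \<longlonglongrightarrow> 1"
      proof -
        have m: "0 < min t (2 * pi - t)" using t by auto
        obtain n0 where n0: "1 / min t (2 * pi - t) \<le> real n0" using real_arch_simple by blast
        have "c n t = 1" if "n \<ge> n0" for n
        proof -
          have "1 / min t (2 * pi - t) \<le> real n" using n0 that by linarith
          then have "1 \<le> real n * min t (2 * pi - t)" using m by (simp only: divide_le_eq if_True)
          then show ?thesis by (simp add: c_def)
        qed
        then show ?thesis by (intro tendsto_eventually) (auto simp: eventually_sequentially)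
      qed
      ultimately have "(\<lambda>n. v N t - of_real (c n t) * clip (g n t)) \<longlonglongrightarrow> v N t - of_real 1 * v N t"
        by (intro tendsto_intros) simp_all
      then show ?thesis unfolding k_def by (intro tendsto_norm_zero) simp
    qed
    show "AE t in circ. (\<lambda>n. cmod (v N t - k n t)) \<longlonglongrightarrow> 0"
      using AE by (rule AE_mp) (auto intro!: AE_I2 pt simp: space_restrict_space)
    show "AE t in circ. norm (cmod (v N t - k n t)) \<le> 2 * B" for n
    proof (rule AE_I2)
      fix t
      show "norm (cmod (v N t - k n t)) \<le> 2 * B"
        using norm_triangle_ineq4[of "v N t" "k n t"] v_le[of t] k_le[of n t] by simp
    qed
  qed (auto intro: fin)
  then have "\<forall>\<^sub>F n in sequentially. (\<integral>t. cmod (v N t - k n t) \<partial>circ) < e / 2"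
    by (rule order_tendstoD(2)) (use e in simp)
  then obtain n where n: "(\<integral>t. cmod (v N t - k n t) \<partial>circ) < e / 2"
    by (meson eventually_happens' sequentially_bot)
  have iv: "integrable circ (v N)" and ik: "integrable circ (k n)"
    by (rule Bochner_Integration.integrable_bound[OF fin[of B]]; use v_le k_le B in simp)+
  have "(\<integral>t. cmod (u t - k n t) \<partial>circ) \<le> (\<integral>t. cmod (u t - v N t) + cmod (v N t - k n t) \<partial>circ)"
  proof (rule integral_mono)
    fix t show "cmod (u t - k n t) \<le> cmod (u t - v N t) + cmod (v N t - k n t)"
      using norm_triangle_ineq[of "u t - v N t" "v N t - k n t"] by simp
  qed (use u iv ik in auto)
  also have "\<dots> = (\<integral>t. cmod (u t - v N t) \<partial>circ) + (\<integral>t. cmod (v N t - k n t) \<partial>circ)"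
    using u iv ik by (intro Bochner_Integration.integral_add) auto
  also have "\<dots> < e" using N n by simp
  finally show ?thesis using that[of "k n"] k_cont k_end by blast
qed

lemma cis_eq_cases:
  assumes "cis s = cis t" "s \<in> {0..2 * pi}" "t \<in> {0..2 * pi}"
  shows "s = t \<or> (s = 0 \<and> t = 2 * pi) \<or> (s = 2 * pi \<and> t = 0)"
proof -
  have "cos s = cos t" "sin s = sin t"
    using arg_cong[OF assms(1), of Re] arg_cong[OF assms(1), of Im] by simp_all
  then obtain n :: int where n: "s = t + 2 * pi * of_int n"
    using sin_cos_eq_iff[of s t] by blast
  have st: "0 \<le> s" "s \<le> 2 * pi" "0 \<le> t" "t \<le> 2 * pi" using assms by auto
  have nn: "real_of_int n * (2 * pi) = s - t" using n by (simp add: algebra_simps)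
  have "real_of_int n * (2 * pi) \<le> 1 * (2 * pi)" unfolding nn using st by simp
  moreover have "(-1) * (2 * pi) \<le> real_of_int n * (2 * pi)" unfolding nn using st by simp
  moreover have "0 < 2 * pi" using pi_gt_zero by linarith
  ultimately have "real_of_int n \<le> 1" "-1 \<le> real_of_int n"
    using mult_right_le_imp_le[of _ "2 * pi"] by blast+
  then consider "n = 0" | "n = 1" | "n = -1" by linarith
  then show ?thesis
  proof cases
    case 1
    then show ?thesis using n by simp
  next
    case 2
    then have "s = t + 2 * pi" using n by simp
    then show ?thesis using st by linarith
  next
    case 3
    then have "s = t - 2 * pi" using n by simp
    then show ?thesis using st by linarith
  qed
qed

text \<open>A modulus of continuity of this shape lets a single moment of the Poisson kernel control the
approximation, with no separation of near and far points. The constant exists because the pairs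
with \<open>\<bar>k s - k t\<bar> \<ge> e\<close> form a compact set on which \<open>cis s\<close> and \<open>cis t\<close> differ.\<close>

lemma circle_modulus_of_continuity:
  fixes k :: "real \<Rightarrow> complex"
  assumes k: "continuous_on UNIV k" "k 0 = k (2 * pi)" and e: "0 < e"
  obtains C where "0 \<le> C"
    "\<And>s t. s \<in> {0..2 * pi} \<Longrightarrow> t \<in> {0..2 * pi} \<Longrightarrow> cmod (k s - k t) \<le> e + C * (cmod (cis s - cis t))\<^sup>2"
proof -
  let ?S = "{0..2 * pi} \<times> {0..2 * pi}"
  define F where "F = (\<lambda>(s, t). cmod (k s - k t))"
  define G where "G = (\<lambda>(s, t). cmod (cis s - cis t))"
  have contF: "continuous_on ?S F"
    unfolding F_def case_prod_unfold by (intro continuous_intros continuous_on_compose2[OF k(1)]) auto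
  have contG: "continuous_on ?S G"
    unfolding G_def case_prod_unfold by (intro continuous_intros)
  have S: "compact ?S" by (intro compact_Times compact_Icc)
  define T where "T = {p \<in> ?S. e \<le> F p}"
  have "T = ?S \<inter> (?S \<inter> F -` {e..})" by (auto simp: T_def)
  moreover have "closed (?S \<inter> F -` {e..})"
    by (intro continuous_closed_preimage contF compact_imp_closed S closed_atLeast)
  ultimately have T: "compact T" using S by (metis compact_Int_closed)
  obtain B where "\<forall>y\<in>F ` ?S. norm y \<le> B"
    using compact_imp_bounded[OF compact_continuous_image[OF contF S]] unfolding bounded_iff by blast
  then have B: "F p \<le> B" if "p \<in> ?S" for p
    using that by (metis abs_le_D1 image_eqI real_norm_def)
  have F0: "0 \<le> F p" for p by (simp add: F_def case_prod_unfold)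
  show ?thesis
  proof (cases "T = {}")
    case True
    have "cmod (k s - k t) \<le> e + 0 * (cmod (cis s - cis t))\<^sup>2" if "s \<in> {0..2 * pi}" "t \<in> {0..2 * pi}" for s t
    proof -
      have "(s, t) \<notin> T" "(s, t) \<in> ?S" using True that by simp_all
      then have "F (s, t) < e" unfolding T_def by simp
      then show ?thesis by (simp add: F_def)
    qed
    then show ?thesis using that[of 0] by blast
  next
    case False
    have "continuous_on T G" by (rule continuous_on_subset[OF contG]) (auto simp: T_def)
    then obtain p where p: "p \<in> T" "\<And>q. q \<in> T \<Longrightarrow> G p \<le> G q"
      using continuous_attains_inf[OF T False] by blast
    have Gp: "0 < G p"
    proof (rule ccontr)
      assume "\<not> 0 < G p"
      then have "cis (fst p) = cis (snd p)" by (simp add: G_def case_prod_unfold)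
      moreover have "fst p \<in> {0..2 * pi}" "snd p \<in> {0..2 * pi}" using p(1) unfolding T_def by (simp_all add: mem_Times_iff)
      ultimately have "k (fst p) = k (snd p)" using cis_eq_cases[of "fst p" "snd p"] k(2) by metis
      then have "F p = 0" by (simp add: F_def case_prod_unfold)
      then show False using p(1) e by (simp add: T_def)
    qed
    define C where "C = B / (G p)\<^sup>2"
    have B0: "0 \<le> B"
    proof -
      have "p \<in> ?S" using p(1) unfolding T_def by simp
      then show ?thesis using B[of p] F0[of p] by linarith
    qed
    have C: "0 \<le> C" using B0 by (simp add: C_def)
    have "cmod (k s - k t) \<le> e + C * (cmod (cis s - cis t))\<^sup>2" if st: "s \<in> {0..2 * pi}" "t \<in> {0..2 * pi}" for s t
    proof (cases "(s, t) \<in> T")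
      case True
      have "B = C * (G p)\<^sup>2" using Gp by (simp add: C_def)
      also have "\<dots> \<le> C * (G (s, t))\<^sup>2"
        using C p(2)[OF True] Gp by (intro mult_left_mono power_mono) auto
      finally have "B \<le> C * (cmod (cis s - cis t))\<^sup>2" by (simp add: G_def)
      moreover have "cmod (k s - k t) \<le> B" using B[of "(s, t)"] st by (simp add: F_def)
      ultimately show ?thesis using e by linarith
    next
      case False
      then have "cmod (k s - k t) < e" using st by (simp add: T_def F_def)
      moreover have "0 \<le> C * (cmod (cis s - cis t))\<^sup>2" using C by simp
      ultimately show ?thesis by linarith
    qed
    then show ?thesis using that C by blast
  qed
qed

text \<open>On the circle \<open>\<bar>cis t - cis s\<bar>\<^sup>2 = 2 - 2 Re (cis t cnj (cis s))\<close>, and the Poisson formula evaluates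
the integral of the last term.\<close>

lemma poisson_kernel_second_moment:
  assumes r: "0 \<le> r" "r < 1"
  shows "integrable circ (\<lambda>t. poisson_kernel (of_real r * cis s) t * (cmod (cis t - cis s))\<^sup>2)"
    and "(\<integral>t. poisson_kernel (of_real r * cis s) t * (cmod (cis t - cis s))\<^sup>2 \<partial>circ) = 2 * pi * (2 - 2 * r)"
proof -
  let ?z = "of_real r * cis s"
  have z: "cmod ?z < 1" using r by (simp add: norm_mult)
  let ?P = "poisson_kernel ?z"
  have sq: "(cmod (cis t - cis s))\<^sup>2 = 2 - 2 * Re (cis t * cnj (cis s))" for t
    using norm_cis_diff_scaled_sq[of t 1 s] by (simp add: cos_diff)
  have iP: "integrable circ (\<lambda>t. complex_of_real (?P t) * cis t)"
    by (intro integral_circ_continuous continuous_intros poisson_kernel_continuous z)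
  then have iPs: "integrable circ (\<lambda>t. complex_of_real (?P t) * cis t * cnj (cis s))"
    by (rule integrable_mult_left)
  have eq: "?P t * (cmod (cis t - cis s))\<^sup>2 = 2 * ?P t - 2 * Re (complex_of_real (?P t) * cis t * cnj (cis s))" for t
    by (simp add: sq algebra_simps)
  show "integrable circ (\<lambda>t. ?P t * (cmod (cis t - cis s))\<^sup>2)"
    unfolding eq by (intro Bochner_Integration.integrable_diff integrable_mult_right integrable_Re[OF iPs] poisson_kernel_integrable z)
  have "(\<integral>t. ?P t * (cmod (cis t - cis s))\<^sup>2 \<partial>circ) = 2 * (\<integral>t. ?P t \<partial>circ) - 2 * (\<integral>t. Re (complex_of_real (?P t) * cis t * cnj (cis s)) \<partial>circ)"
    unfolding eq
    by (simp only: Bochner_Integration.integral_diff[OF integrable_mult_right[OF poisson_kernel_integrable[OF z]] integrable_mult_right[OF integrable_Re[OF iPs]]]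
        integral_mult_right_zero)
  also have "(\<integral>t. Re (complex_of_real (?P t) * cis t * cnj (cis s)) \<partial>circ) = Re (\<integral>t. complex_of_real (?P t) * cis t * cnj (cis s) \<partial>circ)"
    by (rule integral_Re[OF iPs])
  also have "(\<integral>t. complex_of_real (?P t) * cis t * cnj (cis s) \<partial>circ) = (\<integral>t. complex_of_real (?P t) * cis t \<partial>circ) * cnj (cis s)"
    by (rule integral_mult_left_zero)
  also have "(\<integral>t. complex_of_real (?P t) * cis t \<partial>circ) = of_real (2 * pi) * ?z"
    by (rule poisson_formula[of "\<lambda>w. w" 2]) (use z in auto)
  also have "of_real (2 * pi) * ?z * cnj (cis s) = of_real (2 * pi * r) * (cis s * cnj (cis s))" by simp
  also have "cis s * cnj (cis s) = 1" by (simp add: cis_cnj cis_mult)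
  also have "2 * (\<integral>t. ?P t \<partial>circ) - 2 * Re (of_real (2 * pi * r) * 1) = 2 * pi * (2 - 2 * r)"
    unfolding poisson_kernel_integral[OF z] by (simp add: algebra_simps)
  finally show "(\<integral>t. ?P t * (cmod (cis t - cis s))\<^sup>2 \<partial>circ) = 2 * pi * (2 - 2 * r)" .
qed

lemma poisson_integral_near_continuous:
  assumes k: "continuous_on UNIV k" and C: "0 \<le> C" and e: "0 < e"
    and mod: "\<And>s t. s \<in> {0..2 * pi} \<Longrightarrow> t \<in> {0..2 * pi} \<Longrightarrow> cmod (k s - k t) \<le> e + C * (cmod (cis s - cis t))\<^sup>2"
    and r: "0 \<le> r" "r < 1" and s: "s \<in> {0..2 * pi}"
  shows "cmod (poisson_integral k (of_real r * cis s) - k s) \<le> e + C * (2 - 2 * r)"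
proof -
  let ?z = "of_real r * cis s"
  have z: "cmod ?z < 1" using r by (simp add: norm_mult)
  let ?P = "poisson_kernel ?z"
  have ik: "integrable circ k" by (intro integral_circ_continuous continuous_on_subset[OF k]) simp
  have fin: "integrable circ (\<lambda>_. c)" for c :: complex
    using finite_measure_circ by (rule finite_measure.integrable_const)
  have "(\<integral>t. complex_of_real (?P t) * k s \<partial>circ) = (\<integral>t. complex_of_real (?P t) \<partial>circ) * k s"
    by (rule integral_mult_left_zero)
  then have "poisson_integral (\<lambda>_. k s) ?z = k s"
    by (simp add: poisson_integral_def poisson_kernel_integral[OF z])
  then have "poisson_integral k ?z - k s = poisson_integral (\<lambda>t. k t - k s) ?z"
    by (simp add: poisson_integral_diff[OF ik fin z])
  then have "cmod (poisson_integral k ?z - k s) \<le> (\<integral>t. ?P t * cmod (k t - k s) \<partial>circ) / (2 * pi)"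
    using poisson_integral_norm_le[of "\<lambda>t. k t - k s" ?z] ik fin z by simp
  also have "(\<integral>t. ?P t * cmod (k t - k s) \<partial>circ) \<le> (\<integral>t. e * ?P t + C * (?P t * (cmod (cis t - cis s))\<^sup>2) \<partial>circ)"
  proof (rule integral_mono_AE)
    have "integrable circ (\<lambda>t. cmod (complex_of_real (?P t) * (k t - k s)))"
      by (intro integrable_norm poisson_mult_integrable z Bochner_Integration.integrable_diff ik fin)
    then show "integrable circ (\<lambda>t. ?P t * cmod (k t - k s))"
      using poisson_kernel_nonneg[OF z] by (simp add: norm_mult)
    show "integrable circ (\<lambda>t. e * ?P t + C * (?P t * (cmod (cis t - cis s))\<^sup>2))"
      by (intro Bochner_Integration.integrable_add integrable_mult_right poisson_kernel_integrable[OF z] poisson_kernel_second_moment[OF r])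
    show "AE t in circ. ?P t * cmod (k t - k s) \<le> e * ?P t + C * (?P t * (cmod (cis t - cis s))\<^sup>2)"
    proof (rule AE_I2)
      fix t assume "t \<in> space circ"
      then have "cmod (k t - k s) \<le> e + C * (cmod (cis t - cis s))\<^sup>2"
        using s by (intro mod) (auto simp: space_restrict_space)
      then have "?P t * cmod (k t - k s) \<le> ?P t * (e + C * (cmod (cis t - cis s))\<^sup>2)"
        using poisson_kernel_nonneg[OF z] by (rule mult_left_mono)
      then show "?P t * cmod (k t - k s) \<le> e * ?P t + C * (?P t * (cmod (cis t - cis s))\<^sup>2)"
        by (simp add: algebra_simps)
    qed
  qed
  also have "\<dots> = e * (2 * pi) + C * (2 * pi * (2 - 2 * r))"
    by (subst Bochner_Integration.integral_add)
      (simp_all add: poisson_kernel_integrable[OF z] poisson_kernel_second_moment[OF r] poisson_kernel_integral[OF z])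
  finally show ?thesis by (simp add: divide_right_mono add_divide_distrib)
qed

text \<open>Continuous functions converge uniformly, and for the small remainder in \<open>L\<^sup>1\<close> the contraction property
suffices.\<close>

theorem poisson_integral_L1_convergence:
  assumes u: "integrable circ u"
  shows "((\<lambda>r. \<integral>s. cmod (poisson_integral u (of_real r * cis s) - u s) \<partial>circ) \<longlongrightarrow> 0) (at_left 1)"
proof (rule tendstoI)
  fix \<epsilon> :: real assume \<epsilon>: "0 < \<epsilon>"
  obtain k where k: "continuous_on UNIV k" "k 0 = k (2 * pi)" and uk: "(\<integral>t. cmod (u t - k t) \<partial>circ) < \<epsilon> / 4"
    using continuous_approx_circ[OF u, of "\<epsilon> / 4"] \<epsilon> by auto
  define e where "e = \<epsilon> / (16 * pi)"
  have e: "0 < e" using \<epsilon> by (simp add: e_def)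
  obtain C where C: "0 \<le> C" and mod: "\<And>s t. s \<in> {0..2 * pi} \<Longrightarrow> t \<in> {0..2 * pi} \<Longrightarrow> cmod (k s - k t) \<le> e + C * (cmod (cis s - cis t))\<^sup>2"
    using circle_modulus_of_continuity[OF k e] by blast
  have ik: "integrable circ k" by (intro integral_circ_continuous continuous_on_subset[OF k(1)]) simp
  have fin: "integrable circ (\<lambda>_. c)" for c :: real
    using finite_measure_circ by (rule finite_measure.integrable_const)
  have "((\<lambda>r. 2 * pi * (C * (2 - 2 * r))) \<longlongrightarrow> 2 * pi * (C * (2 - 2 * 1))) (at_left (1::real))"
    by (intro tendsto_intros)
  then have "\<forall>\<^sub>F r in at_left 1. 2 * pi * (C * (2 - 2 * r)) < \<epsilon> / 8"
    by (rule order_tendstoD(2)) (use \<epsilon> in simp)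
  moreover have "\<forall>\<^sub>F r in at_left (1::real). r \<in> {0<..<1}"
    by (rule eventually_at_left_real) simp
  ultimately show "\<forall>\<^sub>F r in at_left 1. dist (\<integral>s. cmod (poisson_integral u (of_real r * cis s) - u s) \<partial>circ) 0 < \<epsilon>"
  proof eventually_elim
    case (elim r)
    then have r: "0 \<le> r" "r < 1" by auto
    let ?P = "\<lambda>w s. poisson_integral w (of_real r * cis s)"
    have z: "cmod (of_real r * cis s) < 1" for s using r by (simp add: norm_mult)
    have iuk: "integrable circ (\<lambda>t. u t - k t)" using u ik by simp
    note c = poisson_integral_contraction[OF iuk r]
    have iPk: "integrable circ (\<lambda>s. ?P k s)" "integrable circ (\<lambda>s. ?P u s)"
      by (intro poisson_integral_contraction ik u r)+
    have "(\<integral>s. cmod (?P u s - u s) \<partial>circ) \<le>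
      (\<integral>s. cmod (?P (\<lambda>t. u t - k t) s) + cmod (?P k s - k s) + cmod (u s - k s) \<partial>circ)"
    proof (rule integral_mono)
      fix s
      have "?P u s - u s = ?P (\<lambda>t. u t - k t) s
          + (?P k s - k s) - (u s - k s)"
        by (simp add: poisson_integral_diff[OF u ik z])
      then show "cmod (?P u s - u s) \<le> cmod (?P (\<lambda>t. u t - k t) s)
          + cmod (?P k s - k s) + cmod (u s - k s)"
        by (metis (no_types, lifting) add_right_mono norm_triangle_ineq norm_triangle_ineq4 order_trans)
    qed (intro integrable_norm Bochner_Integration.integrable_add Bochner_Integration.integrable_diff c(1) iPk ik u)+
    also have "\<dots> = (\<integral>s. cmod (?P (\<lambda>t. u t - k t) s) \<partial>circ) +
        (\<integral>s. cmod (?P k s - k s) \<partial>circ) + (\<integral>s. cmod (u s - k s) \<partial>circ)"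
      using c(1) iPk ik u by simp
    also have "(\<integral>s. cmod (?P k s - k s) \<partial>circ) \<le> (\<integral>s. e + C * (2 - 2 * r) \<partial>circ)"
    proof (rule integral_mono)
      fix s assume "s \<in> space circ"
      then show "cmod (?P k s - k s) \<le> e + C * (2 - 2 * r)"
        using poisson_integral_near_continuous[OF k(1) C e mod r, of s] by (simp add: space_restrict_space)
    qed (use iPk ik fin in auto)
    also have "(\<integral>s. e + C * (2 - 2 * r) \<partial>circ) = 2 * pi * e + 2 * pi * (C * (2 - 2 * r))"
      by (simp add: measure_restrict_space space_restrict_space algebra_simps)
    also have "2 * pi * e = \<epsilon> / 8" by (simp add: e_def)
    finally have "(\<integral>s. cmod (?P u s - u s) \<partial>circ) < \<epsilon>"
      using c(2) uk elim(1) \<epsilon> by linarith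
    moreover have "0 \<le> (\<integral>s. cmod (?P u s - u s) \<partial>circ)"
      by simp
    ultimately show ?case by (simp add: dist_real_def)
  qed
qed

lemma real_poisson_integrable:
  fixes p :: "real \<Rightarrow> real"
  assumes p: "integrable circ p" and z: "cmod z < 1"
  shows "integrable circ (\<lambda>t. poisson_kernel z t * p t)"
proof -
  have "integrable circ (\<lambda>t. of_real (poisson_kernel z t) * complex_of_real (p t))"
    using p by (intro poisson_mult_integrable z) simp
  from integrable_Re[OF this] show ?thesis by simp
qed

lemma holomorphic_le_poisson_dilate:
  assumes q: "q holomorphic_on ball 0 1" and r: "0 < r" "r < 1" and z: "cmod z < 1"
  shows "cmod (q (of_real r * z)) \<le> (\<integral>t. poisson_kernel z t * cmod (q (of_real r * cis t)) \<partial>circ) / (2 * pi)"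
proof -
  have "(\<lambda>w. q (of_real r * w)) holomorphic_on ball 0 (1 / r)"
  proof (rule holomorphic_on_compose_gen[OF _ q, unfolded o_def])
    show "(\<lambda>w. of_real r * w) holomorphic_on ball 0 (1 / r)" by (intro holomorphic_intros)
    show "(\<lambda>w. of_real r * w) ` ball 0 (1 / r) \<subseteq> (ball 0 1 :: complex set)"
    proof (rule image_subsetI)
      fix w :: complex assume "w \<in> ball 0 (1 / r)"
      then have "r * cmod w < 1" using r by (simp add: pos_less_divide_eq mult.commute)
      then show "of_real r * w \<in> ball 0 1" using r by (simp add: norm_mult)
    qed
  qed
  then have "(\<integral>t. of_real (poisson_kernel z t) * q (of_real r * cis t) \<partial>circ) = of_real (2 * pi) * q (of_real r * z)"
    by (rule poisson_formula) (use r z in auto)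
  then have "2 * pi * cmod (q (of_real r * z)) = cmod (\<integral>t. of_real (poisson_kernel z t) * q (of_real r * cis t) \<partial>circ)"
    by (simp add: norm_mult)
  also have "\<dots> \<le> (\<integral>t. cmod (of_real (poisson_kernel z t) * q (of_real r * cis t)) \<partial>circ)"
    by (rule integral_norm_bound)
  also have "\<dots> = (\<integral>t. poisson_kernel z t * cmod (q (of_real r * cis t)) \<partial>circ)"
    using poisson_kernel_nonneg[OF z] by (simp add: norm_mult)
  finally show ?thesis by (simp add: pos_le_divide_eq mult.commute)
qed

section \<open>The pairing of dilates as an area integral\<close>

definition radial_pairing :: "(complex \<Rightarrow> complex) \<Rightarrow> (complex \<Rightarrow> complex) \<Rightarrow> real \<Rightarrow> complex" where
  "radial_pairing F G r = integral {0..2 * pi} (\<lambda>t. F (of_real r * cis t) * cnj (G (of_real r * cis t)))"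

lemma holomorphic_circle_continuous:
  assumes F: "F holomorphic_on ball 0 1" and S: "\<And>p. p \<in> S \<Longrightarrow> \<bar>fst p\<bar> < 1"
  shows "continuous_on S (\<lambda>p. F (of_real (fst p) * cis (snd p)))"
  by (rule continuous_on_compose2[OF holomorphic_on_imp_continuous_on[OF F]])
    (use S in \<open>auto intro!: continuous_intros simp: norm_mult\<close>)

lemma holomorphic_circle_continuous1:
  assumes F: "F holomorphic_on ball 0 1" and r: "\<bar>r\<bar> < 1"
  shows "continuous_on A (\<lambda>t. F (of_real r * cis t))"
  by (rule continuous_on_compose2[OF holomorphic_on_imp_continuous_on[OF F]])
    (use r in \<open>auto intro!: continuous_intros simp: norm_mult\<close>)

lemma holomorphic_z_deriv:
  "F holomorphic_on ball 0 1 \<Longrightarrow> (\<lambda>z. z * deriv F z) holomorphic_on ball 0 1"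
  by (intro holomorphic_intros holomorphic_deriv) auto

lemma holomorphic_circle_deriv:
  assumes F: "F holomorphic_on ball 0 1" and r: "\<bar>r\<bar> < 1"
  shows "((\<lambda>x. F (of_real x * cis t)) has_vector_derivative cis t * deriv F (of_real r * cis t)) (at r within A)"
    and "((\<lambda>t. F (of_real r * cis t)) has_vector_derivative \<i> * (of_real r * cis t * deriv F (of_real r * cis t))) (at t within B)"
proof -
  have "cmod (of_real r * cis t) < 1" using r by (simp add: norm_mult)
  then have d: "(F has_field_derivative deriv F (of_real r * cis t)) (at (of_real r * cis t))"
    using holomorphic_derivI[OF F, of "of_real r * cis t"] by simp
  have "((\<lambda>x. of_real x * cis t) has_vector_derivative of_real 1 * cis t) (at r within A)"
    by (rule has_vector_derivative_mult_left[OF has_vector_derivative_of_real[OF DERIV_ident]])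
  from field_vector_diff_chain_within[OF this has_field_derivative_at_within[OF d]]
  show "((\<lambda>x. F (of_real x * cis t)) has_vector_derivative cis t * deriv F (of_real r * cis t)) (at r within A)"
    by (simp add: o_def)
  have "((\<lambda>x. of_real x * \<i>) has_vector_derivative of_real 1 * \<i>) (at t within B)"
    by (rule has_vector_derivative_mult_left[OF has_vector_derivative_of_real[OF DERIV_ident]])
  from field_vector_diff_chain_within[OF this DERIV_subset[OF DERIV_exp subset_UNIV]]
  have "((\<lambda>x. exp (of_real x * \<i>)) has_vector_derivative \<i> * exp (of_real t * \<i>)) (at t within B)"
    by (simp add: o_def)
  then have "(cis has_vector_derivative \<i> * cis t) (at t within B)"
    by (simp only: mult.commute[of _ \<i>] cis_conv_exp[symmetric])
  from has_vector_derivative_mult_right[OF this, of "of_real r"]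
  have "((\<lambda>t. of_real r * cis t) has_vector_derivative of_real r * (\<i> * cis t)) (at t within B)" .
  from field_vector_diff_chain_within[OF this has_field_derivative_at_within[OF d]]
  show "((\<lambda>t. F (of_real r * cis t)) has_vector_derivative \<i> * (of_real r * cis t * deriv F (of_real r * cis t))) (at t within B)"
    by (simp add: o_def mult_ac)
qed

lemma radial_pairing_integrable:
  assumes "F holomorphic_on ball 0 1" "G holomorphic_on ball 0 1" "\<bar>r\<bar> < 1"
  shows "(\<lambda>t. F (of_real r * cis t) * cnj (G (of_real r * cis t))) integrable_on {0..2 * pi}"
  by (intro integrable_continuous_real continuous_on_mult continuous_on_cnj
      holomorphic_circle_continuous1[OF assms(1,3)] holomorphic_circle_continuous1[OF assms(2,3)])

text \<open>The operator \<open>z d/dz\<close> moves across the pairing because the angular derivative of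
  \<open>F cnj G\<close> integrates to zero over the circle.\<close>

lemma radial_pairing_swap:
  assumes F: "F holomorphic_on ball 0 1" and G: "G holomorphic_on ball 0 1" and r: "\<bar>r\<bar> < 1"
  shows "radial_pairing (\<lambda>z. z * deriv F z) G r = radial_pairing F (\<lambda>z. z * deriv G z) r"
proof -
  let ?z = "\<lambda>t. of_real r * cis t"
  let ?D = "\<lambda>t. \<i> * (?z t * deriv F (?z t)) * cnj (G (?z t)) + F (?z t) * cnj (\<i> * (?z t * deriv G (?z t)))"
  have "(?D has_integral F (?z (2 * pi)) * cnj (G (?z (2 * pi))) - F (?z 0) * cnj (G (?z 0))) {0..2 * pi}"
  proof (rule fundamental_theorem_of_calculus)
    fix t
    have "((\<lambda>t. F (?z t) * cnj (G (?z t))) has_vector_derivative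
       F (?z t) * cnj (\<i> * (?z t * deriv G (?z t))) + \<i> * (?z t * deriv F (?z t)) * cnj (G (?z t))) (at t within {0..2 * pi})"
      by (intro has_vector_derivative_mult has_vector_derivative_cnj holomorphic_circle_deriv(2)[OF F r] holomorphic_circle_deriv(2)[OF G r])
    then show "((\<lambda>t. F (?z t) * cnj (G (?z t))) has_vector_derivative ?D t) (at t within {0..2 * pi})"
      by (simp only: add.commute)
  qed simp
  then have 0: "integral {0..2 * pi} ?D = 0" by (simp add: integral_unique)
  have eq: "?D t = \<i> * (?z t * deriv F (?z t) * cnj (G (?z t)) - F (?z t) * cnj (?z t * deriv G (?z t)))" for t
    by (simp add: algebra_simps)
  have "\<i> * (integral {0..2 * pi} (\<lambda>t. ?z t * deriv F (?z t) * cnj (G (?z t))) - integral {0..2 * pi} (\<lambda>t. F (?z t) * cnj (?z t * deriv G (?z t)))) = 0"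
  proof -
    note i1 = radial_pairing_integrable[OF holomorphic_z_deriv[OF F] G r]
    note i2 = radial_pairing_integrable[OF F holomorphic_z_deriv[OF G] r]
    show ?thesis using 0 unfolding eq integral_mult_right integral_diff[OF i1 i2] .
  qed
  then show ?thesis by (simp add: radial_pairing_def)
qed

text \<open>Differentiation under the integral gives one term for each factor, and \<open>radial_pairing_swap\<close> makes
the two terms equal.\<close>

lemma radial_pairing_deriv:
  assumes F: "F holomorphic_on ball 0 1" and G: "G holomorphic_on ball 0 1" and r: "0 < r" "r < 1"
  shows "(radial_pairing F G has_vector_derivative (2 / of_real r) * radial_pairing (\<lambda>z. z * deriv F z) G r) (at r)"
proof -
  let ?U = "{0<..<1::real}"
  let ?f = "\<lambda>x t. F (of_real x * cis t) * cnj (G (of_real x * cis t))"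
  let ?fx = "\<lambda>x t. F (of_real x * cis t) * cnj (cis t * deriv G (of_real x * cis t)) + cis t * deriv F (of_real x * cis t) * cnj (G (of_real x * cis t))"
  have dF: "deriv F holomorphic_on ball 0 1" "deriv G holomorphic_on ball 0 1"
    using F G by (auto intro: holomorphic_deriv)
  have "((\<lambda>x. integral (cbox 0 (2 * pi)) (?f x)) has_vector_derivative integral (cbox 0 (2 * pi)) (?fx r)) (at r within ?U)"
  proof (rule leibniz_rule_vector_derivative)
    show "((\<lambda>x. ?f x t) has_vector_derivative ?fx x t) (at x within ?U)" if "x \<in> ?U" for x t
      using that by (intro has_vector_derivative_mult has_vector_derivative_cnj
          holomorphic_circle_deriv(1)[OF F] holomorphic_circle_deriv(1)[OF G]) auto
    show "?f x integrable_on cbox 0 (2 * pi)" if "x \<in> ?U" for x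
      using that by (intro integrable_continuous continuous_on_mult continuous_on_cnj
          holomorphic_circle_continuous1[OF F] holomorphic_circle_continuous1[OF G]) auto
    note c = holomorphic_circle_continuous[where S = "?U \<times> cbox 0 (2 * pi)"]
    have c2: "continuous_on (?U \<times> cbox 0 (2 * pi)) (\<lambda>p. cis (snd p))" by (intro continuous_intros)
    show "continuous_on (?U \<times> cbox 0 (2 * pi)) (\<lambda>(x, t). ?fx x t)"
      unfolding case_prod_unfold
      by (intro continuous_on_add continuous_on_mult continuous_on_cnj c[OF F] c[OF G] c[OF dF(1)] c[OF dF(2)] c2) auto
    show "r \<in> ?U" using r by simp
    show "convex ?U" by (rule convex_real_interval)
  qed
  then have d: "(radial_pairing F G has_vector_derivative integral {0..2 * pi} (?fx r)) (at r)"
    using r unfolding radial_pairing_def[abs_def] by (subst (asm) at_within_open) simp_all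
  let ?z = "\<lambda>t. of_real r * cis t"
  have r': "\<bar>r\<bar> < 1" using r by simp
  have eq: "?fx r t = (F (?z t) * cnj (?z t * deriv G (?z t)) + ?z t * deriv F (?z t) * cnj (G (?z t))) / of_real r" for t
    using r by (simp add: add_divide_distrib distrib_left)
  note i1 = radial_pairing_integrable[OF holomorphic_z_deriv[OF F] G r']
  note i2 = radial_pairing_integrable[OF F holomorphic_z_deriv[OF G] r']
  have "integral {0..2 * pi} (?fx r) = (radial_pairing F (\<lambda>z. z * deriv G z) r + radial_pairing (\<lambda>z. z * deriv F z) G r) / of_real r"
    unfolding eq divide_inverse integral_mult_left radial_pairing_def by (simp only: integral_add[OF i2 i1])
  also have "\<dots> = (2 / of_real r) * radial_pairing (\<lambda>z. z * deriv F z) G r"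
    by (simp add: radial_pairing_swap[OF F G r'])
  finally show ?thesis using d by simp
qed

definition circle_mean :: "(complex \<Rightarrow> complex) \<Rightarrow> real \<Rightarrow> real" where
  "circle_mean g r = integral {0..2 * pi} (\<lambda>t. cmod (g (of_real r * cis t)))"

lemma circle_mean_nonneg: "0 \<le> circle_mean g r"
  unfolding circle_mean_def
  by (cases "(\<lambda>t. cmod (g (of_real r * cis t))) integrable_on {0..2 * pi}")
    (simp_all add: integral_nonneg not_integrable_integral)

lemma circle_mean_continuous:
  assumes "g holomorphic_on ball 0 1"
  shows "continuous_on {-1<..<1} (circle_mean g)"
proof -
  have "continuous_on {-1<..<1} (\<lambda>r. integral (cbox 0 (2 * pi)) (\<lambda>t. cmod (g (of_real r * cis t))))"
  proof (rule integral_continuous_on_param)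
    show "continuous_on ({-1<..<1} \<times> cbox 0 (2 * pi)) (\<lambda>(r, t). cmod (g (of_real r * cis t)))"
      unfolding case_prod_unfold by (intro continuous_on_norm holomorphic_circle_continuous[OF assms]) auto
  qed
  then show ?thesis by (simp add: circle_mean_def[abs_def])
qed

lemma radial_pairing_continuous:
  assumes "F holomorphic_on ball 0 1" "G holomorphic_on ball 0 1"
  shows "continuous_on {-1<..<1} (radial_pairing F G)"
proof -
  note c = holomorphic_circle_continuous[where S = "{-1<..<1} \<times> cbox 0 (2 * pi)"]
  have "continuous_on {-1<..<1} (\<lambda>r. integral (cbox 0 (2 * pi)) (\<lambda>t. F (of_real r * cis t) * cnj (G (of_real r * cis t))))"
  proof (rule integral_continuous_on_param)
    show "continuous_on ({-1<..<1} \<times> cbox 0 (2 * pi)) (\<lambda>(r, t). F (of_real r * cis t) * cnj (G (of_real r * cis t)))"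
      unfolding case_prod_unfold
      by (intro continuous_on_mult continuous_on_cnj c[OF assms(1)] c[OF assms(2)]) auto
  qed
  then show ?thesis by (simp add: radial_pairing_def[abs_def])
qed

lemma radial_pairing_le_circle_mean:
  assumes F: "F holomorphic_on ball 0 1" and G: "G holomorphic_on ball 0 1" and r: "\<bar>r\<bar> < 1"
  shows "cmod (radial_pairing F G r) \<le> circle_mean (\<lambda>z. F z * G z) r"
  unfolding radial_pairing_def circle_mean_def
proof (rule integral_norm_bound_integral)
  note c = holomorphic_circle_continuous1[OF F r] holomorphic_circle_continuous1[OF G r]
  show "(\<lambda>t. F (of_real r * cis t) * cnj (G (of_real r * cis t))) integrable_on {0..2 * pi}"
    by (rule radial_pairing_integrable[OF F G r])
  show "(\<lambda>t. cmod (F (of_real r * cis t) * G (of_real r * cis t))) integrable_on {0..2 * pi}"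
    by (rule integrable_continuous_real[OF continuous_on_norm[OF continuous_on_mult[OF c]]])
qed (simp add: norm_mult)

lemma circle_mean_nn:
  assumes g: "g holomorphic_on ball 0 1" and r: "\<bar>r\<bar> < 1"
  shows "(\<integral>\<^sup>+t\<in>{0..2 * pi}. ennreal (cmod (g (of_real r * cis t))) \<partial>lborel) = ennreal (circle_mean g r)"
proof -
  have c: "continuous_on {0..2 * pi} (\<lambda>t. cmod (g (of_real r * cis t)))"
    by (rule continuous_on_norm[OF holomorphic_circle_continuous1[OF g r]])
  have "(\<integral>\<^sup>+t\<in>{0..2 * pi}. ennreal (cmod (g (of_real r * cis t))) \<partial>lborel) = (\<integral>\<^sup>+t. ennreal (cmod (g (of_real r * cis t))) \<partial>circ)"
    by (rule nn_integral_circ[symmetric])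
  also have "\<dots> = ennreal (\<integral>t. cmod (g (of_real r * cis t)) \<partial>circ)"
    by (rule nn_integral_eq_integral[OF integral_circ_continuous(1)[OF c]]) simp
  finally show ?thesis by (simp add: integral_circ_continuous(2)[OF c] circle_mean_def)
qed

text \<open>On the disc of radius \<open>1/2\<close> the Poisson kernel of a circle of radius at least \<open>3/4\<close> is at
  most \<open>5\<close>, because the ratio of the radii is at most \<open>2/3\<close>.\<close>

lemma circle_mean_inner_le:
  assumes g: "g holomorphic_on ball 0 1" and r: "0 \<le> r" "r \<le> 1 / 2" and s: "3 / 4 \<le> s" "s < 1"
  shows "circle_mean g r \<le> 5 * circle_mean g s"
proof -
  have s1: "\<bar>s\<bar> < 1" "\<bar>r\<bar> < 1" using r s by auto
  note cs = holomorphic_circle_continuous1[OF g s1(1)]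
  have pt: "cmod (g (of_real r * cis t)) \<le> 5 * circle_mean g s / (2 * pi)" for t
  proof -
    define z where "z = of_real (r / s) * cis t"
    have "r * 3 \<le> 2 * s" using r s by linarith
    then have zr: "cmod z \<le> 2 / 3" using r s by (simp add: z_def norm_mult norm_divide divide_le_eq)
    then have z: "cmod z < 1" by linarith
    have "of_real s * z = of_real r * cis t" using s by (simp add: z_def)
    then have "2 * pi * cmod (g (of_real r * cis t)) \<le> (\<integral>u. poisson_kernel z u * cmod (g (of_real s * cis u)) \<partial>circ)"
      using holomorphic_le_poisson_dilate[OF g _ s(2) z] s by (simp add: pos_le_divide_eq mult.commute)
    also have "\<dots> \<le> (\<integral>u. 5 * cmod (g (of_real s * cis u)) \<partial>circ)"
    proof (rule integral_mono)
      show "integrable circ (\<lambda>u. poisson_kernel z u * cmod (g (of_real s * cis u)))"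
        by (intro real_poisson_integrable[OF _ z] integrable_norm integral_circ_continuous(1)[OF cs])
      show "integrable circ (\<lambda>u. 5 * cmod (g (of_real s * cis u)))"
        by (intro integrable_mult_right integrable_norm integral_circ_continuous(1)[OF cs])
      fix u
      have "poisson_kernel z u \<le> (1 + cmod z) / (1 - cmod z)" by (rule poisson_kernel_le[OF z])
      also have "\<dots> \<le> 5" using zr by (simp add: divide_le_eq)
      finally show "poisson_kernel z u * cmod (g (of_real s * cis u)) \<le> 5 * cmod (g (of_real s * cis u))"
        by (rule mult_right_mono) simp
    qed
    also have "\<dots> = 5 * circle_mean g s"
      by (simp add: circle_mean_def integral_circ_continuous(2)[OF continuous_on_norm[OF cs]])
    finally show ?thesis by (simp add: pos_le_divide_eq mult.commute)
  qed
  have "circle_mean g r \<le> integral {0..2 * pi} (\<lambda>t. 5 * circle_mean g s / (2 * pi))"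
    unfolding circle_mean_def[of g r]
    by (rule integral_le[OF integrable_continuous_real[OF continuous_on_norm[OF holomorphic_circle_continuous1[OF g s1(2)]]]])
      (use pt in \<open>auto intro: integrable_const_ivl\<close>)
  also have "\<dots> = 5 * circle_mean g s" by simp
  finally show ?thesis .
qed

text \<open>Put \<open>E x = 2 ln (R/x) q x + p x\<close>, where \<open>p\<close> is the pairing of \<open>F\<close> and \<open>G\<close>, \<open>q\<close> that of \<open>z F'\<close>
and \<open>G\<close>, and \<open>m\<close> that of \<open>F'\<close> and \<open>G'\<close>. From \<open>x p' = 2 q\<close> and \<open>q' = 2 x m\<close> the terms with \<open>q\<close> cancel in \<open>E'\<close>. At \<open>R\<close> the
logarithm vanishes and at \<open>0\<close> everything does, since \<open>F 0 = 0\<close> and \<open>q x\<close> is of order \<open>x\<close>.\<close>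

lemma has_integral_radial_pairing:
  assumes F: "F holomorphic_on ball 0 1" and G: "G holomorphic_on ball 0 1" and F0: "F 0 = 0"
    and R: "0 < R" "R < 1"
  shows "((\<lambda>x. of_real (4 * (x * ln (R / x))) * radial_pairing (deriv F) (deriv G) x) has_integral radial_pairing F G R) {0..R}"
proof -
  let ?zF = "\<lambda>z. z * deriv F z"
  let ?m = "radial_pairing (deriv F) (deriv G)"
  let ?q = "radial_pairing ?zF G"
  have dF: "deriv F holomorphic_on ball 0 1" "deriv G holomorphic_on ball 0 1"
    using F G by (auto intro: holomorphic_deriv)
  note zF = holomorphic_z_deriv[OF F]
  define E where "E = (\<lambda>x. of_real (2 * ln (R / x)) * ?q x + radial_pairing F G x)"
  have q_deriv: "(?q has_vector_derivative of_real (2 * x) * ?m x) (at x)" if x: "0 < x" "x < 1" for x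
  proof -
    have "(?q has_vector_derivative (2 / of_real x) * radial_pairing (\<lambda>z. z * deriv ?zF z) G x) (at x)"
      by (rule radial_pairing_deriv[OF zF G x])
    also have "radial_pairing (\<lambda>z. z * deriv ?zF z) G x = radial_pairing ?zF (\<lambda>z. z * deriv G z) x"
      using x by (intro radial_pairing_swap[OF zF G]) simp
    also have "\<dots> = of_real (x\<^sup>2) * ?m x"
    proof -
      have "of_real x * cis t * deriv F (of_real x * cis t) * cnj (of_real x * cis t * deriv G (of_real x * cis t)) =
          of_real (x\<^sup>2) * (deriv F (of_real x * cis t) * cnj (deriv G (of_real x * cis t)))" for t
      proof -
        have "cis t * cnj (cis t) = 1" by (simp add: cis_cnj cis_mult)
        then have "of_real x * cis t * a * cnj (of_real x * cis t * b) = of_real (x\<^sup>2) * (a * cnj b)" for a b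
          by (simp add: power2_eq_square mult_ac)
        then show ?thesis by blast
      qed
      then show ?thesis unfolding radial_pairing_def by (simp only: integral_mult_right)
    qed
    also have "(2 / of_real x) * (of_real (x\<^sup>2) * ?m x) = of_real (2 * x) * ?m x"
      using x by (simp add: power2_eq_square)
    finally show ?thesis .
  qed
  have E_deriv: "(E has_vector_derivative of_real (4 * (x * ln (R / x))) * ?m x) (at x)" if x: "0 < x" "x < R" for x
  proof -
    have x1: "x < 1" using x R by simp
    have "((\<lambda>x. 2 * ln (R / x)) has_real_derivative - (2 / x)) (at x)"
      using x R by (auto intro!: derivative_eq_intros simp: power2_eq_square)
    then have l: "((\<lambda>x. complex_of_real (2 * ln (R / x))) has_vector_derivative of_real (- (2 / x))) (at x)"
      by (rule has_vector_derivative_of_real)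
    have "(E has_vector_derivative (of_real (2 * ln (R / x)) * (of_real (2 * x) * ?m x) + of_real (- (2 / x)) * ?q x) + (2 / of_real x) * ?q x) (at x)"
      unfolding E_def
      by (intro has_vector_derivative_add has_vector_derivative_mult l q_deriv[OF x(1) x1] radial_pairing_deriv[OF F G x(1) x1])
    also have "(of_real (2 * ln (R / x)) * (of_real (2 * x) * ?m x) + of_real (- (2 / x)) * ?q x) + (2 / of_real x) * ?q x =
        of_real (4 * (x * ln (R / x))) * ?m x"
      by (simp add: mult_ac)
    finally show ?thesis .
  qed
  have q1: "?q x = of_real x * integral {0..2 * pi} (\<lambda>t. cis t * deriv F (of_real x * cis t) * cnj (G (of_real x * cis t)))" for x
    unfolding radial_pairing_def by (simp only: mult.assoc integral_mult_right)
  define Q where "Q = (\<lambda>x. integral {0..2 * pi} (\<lambda>t. cis t * deriv F (of_real x * cis t) * cnj (G (of_real x * cis t))))"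
  have Q_cont: "continuous_on {0..R} Q"
  proof -
    note c = holomorphic_circle_continuous[where S = "{0..R} \<times> cbox 0 (2 * pi)"]
    have c2: "continuous_on ({0..R} \<times> cbox 0 (2 * pi)) (\<lambda>p. cis (snd p))" by (intro continuous_intros)
    have "continuous_on {0..R} (\<lambda>x. integral (cbox 0 (2 * pi)) (\<lambda>t. cis t * deriv F (of_real x * cis t) * cnj (G (of_real x * cis t))))"
    proof (rule integral_continuous_on_param)
      show "continuous_on ({0..R} \<times> cbox 0 (2 * pi)) (\<lambda>(x, t). cis t * deriv F (of_real x * cis t) * cnj (G (of_real x * cis t)))"
        unfolding case_prod_unfold
        by (intro continuous_on_mult continuous_on_cnj c2 c[OF dF(1)] c[OF G]) (use R in auto)
    qed
    then show ?thesis by (simp add: Q_def)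
  qed
  have E_eq: "E x = of_real (2 * (x * ln (R / x))) * Q x + radial_pairing F G x" for x
    by (simp add: E_def q1 Q_def mult_ac)
  have xln: "continuous_on {0..R} (\<lambda>x. x * ln (R / x))"
  proof (rule continuous_on_eq_continuous_within[THEN iffD2], rule ballI)
    fix x assume x: "x \<in> {0..R}"
    show "continuous (at x within {0..R}) (\<lambda>x. x * ln (R / x))"
    proof (cases "x = 0")
      case True
      have "((\<lambda>x. x * ln (R / x)) \<longlongrightarrow> 0) (at_right 0)" using R by real_asymp
      then have "((\<lambda>x. x * ln (R / x)) \<longlongrightarrow> 0) (at 0 within {0..R})"
        using R by (simp add: at_within_Icc_at_right)
      then show ?thesis using True by (simp add: continuous_within)
    next
      case False
      then have "isCont (\<lambda>x. x * ln (R / x)) x" using x R by (intro continuous_intros) auto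
      then show ?thesis by (rule continuous_at_imp_continuous_at_within)
    qed
  qed
  have "((\<lambda>x. of_real (4 * (x * ln (R / x))) * ?m x) has_integral E R - E 0) {0..R}"
  proof (rule fundamental_theorem_of_calculus_interior)
    have "continuous_on {0..R} (\<lambda>x. complex_of_real (2 * (x * ln (R / x))) * Q x + radial_pairing F G x)"
      using R by (intro continuous_on_add continuous_on_mult continuous_on_of_real continuous_on_const xln Q_cont
          continuous_on_subset[OF radial_pairing_continuous[OF F G]]) auto
    then show "continuous_on {0..R} E" unfolding E_eq[abs_def] .
    show "(E has_vector_derivative of_real (4 * (x * ln (R / x))) * ?m x) (at x)" if "x \<in> {0<..<R}" for x
      using E_deriv that by simp
  qed (use R in simp)
  moreover have "E 0 = 0" by (simp add: E_eq radial_pairing_def F0)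
  moreover have "E R = radial_pairing F G R" using R by (simp add: E_def)
  ultimately show ?thesis by simp
qed

lemma nn_integral_disc_circle_mean:
  assumes g: "g holomorphic_on ball 0 1"
  shows "(\<integral>\<^sup>+z. ennreal (cmod (g z) * (1 - cmod z)) * indicator (ball 0 1) z \<partial>lborel) =
    (\<integral>\<^sup>+r\<in>{0<..<1}. ennreal (r * (1 - r) * circle_mean g r) \<partial>lborel)"
proof -
  let ?k = "\<lambda>z. ennreal (cmod (g z) * (1 - cmod z)) * indicator (ball 0 1) z"
  have meas: "(\<lambda>z. ?k z) \<in> borel_measurable borel"
  proof -
    have "continuous_on (ball 0 1) (\<lambda>z. cmod (g z) * (1 - cmod z))"
      by (intro continuous_intros holomorphic_on_imp_continuous_on[OF g])
    then have "(\<lambda>z. indicator (ball 0 1) z *\<^sub>R (cmod (g z) * (1 - cmod z))) \<in> borel_measurable borel"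
      by (intro borel_measurable_continuous_on_indicator) auto
    from measurable_compose[OF this measurable_ennreal]
    show ?thesis
      by (rule measurable_cong[THEN iffD1, rotated]) (auto simp: indicator_def)
  qed
  have "(\<integral>\<^sup>+z. ?k z \<partial>lborel) =
    (\<integral>\<^sup>+r\<in>{0<..}. ennreal r * (\<integral>\<^sup>+t\<in>{0..2 * pi}. ennreal (cmod (g (of_real r * cis t)) * (1 - cmod (of_real r * cis t))) *
        indicator (ball 0 1) (of_real r * cis t) \<partial>lborel) \<partial>lborel)"
    by (rule nn_integral_polar[OF meas])
  also have "\<dots> = (\<integral>\<^sup>+r\<in>{0<..<1}. ennreal (r * (1 - r) * circle_mean g r) \<partial>lborel)"
  proof (rule nn_integral_cong)
    fix r :: real
    let ?in = "\<integral>\<^sup>+t\<in>{0..2 * pi}. ennreal (cmod (g (of_real r * cis t)) * (1 - cmod (of_real r * cis t))) *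
        indicator (ball 0 1) (of_real r * cis t) \<partial>lborel"
    show "ennreal r * ?in * indicator {0<..} r = ennreal (r * (1 - r) * circle_mean g r) * indicator {0<..<1} r"
    proof (cases "0 < r \<and> r < 1")
      case True
      then have r: "0 < r" "r < 1" "\<bar>r\<bar> < 1" by auto
      have "?in = (\<integral>\<^sup>+t. ennreal (1 - r) * (ennreal (cmod (g (of_real r * cis t))) * indicator {0..2 * pi} t) \<partial>lborel)"
      proof (rule nn_integral_cong)
        fix t
        have "ennreal (cmod (g (of_real r * cis t)) * (1 - r)) = ennreal (1 - r) * ennreal (cmod (g (of_real r * cis t)))"
          using r by (subst mult.commute) (simp add: ennreal_mult)
        then show "ennreal (cmod (g (of_real r * cis t)) * (1 - cmod (of_real r * cis t))) *
            indicator (ball 0 1) (of_real r * cis t) * indicator {0..2 * pi} t =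
            ennreal (1 - r) * (ennreal (cmod (g (of_real r * cis t))) * indicator {0..2 * pi} t)"
          using r by (simp add: norm_mult mult.assoc)
      qed
      also have "\<dots> = ennreal (1 - r) * (\<integral>\<^sup>+t\<in>{0..2 * pi}. ennreal (cmod (g (of_real r * cis t))) \<partial>lborel)"
      proof (rule nn_integral_cmult)
        have "continuous_on UNIV (\<lambda>t. cmod (g (of_real r * cis t)))"
          by (rule continuous_on_norm[OF holomorphic_circle_continuous1[OF g r(3)]])
        from borel_measurable_continuous_onI[OF this]
        have "(\<lambda>t. ennreal (cmod (g (of_real r * cis t)))) \<in> borel_measurable lborel"
          by (intro measurable_compose[OF _ measurable_ennreal]) simp
        then show "(\<lambda>t. ennreal (cmod (g (of_real r * cis t))) * indicator {0..2 * pi} t) \<in> borel_measurable lborel"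
          by (intro borel_measurable_times_ennreal borel_measurable_indicator) simp_all
      qed
      also have "\<dots> = ennreal ((1 - r) * circle_mean g r)"
        using r circle_mean_nonneg[of g r] unfolding circle_mean_nn[OF g r(3)] by (subst ennreal_mult) simp_all
      finally have "?in = ennreal ((1 - r) * circle_mean g r)" .
      then show ?thesis using r circle_mean_nonneg[of g r] by (simp add: ennreal_mult mult.assoc)
    next
      case False
      show ?thesis
      proof (cases "0 < r")
        case True
        then have "of_real r * cis t \<notin> ball 0 1" for t using False by (simp add: norm_mult)
        then show ?thesis using False by simp
      next
        case False
        then show ?thesis by simp
      qed
    qed
  qed
  finally show ?thesis .
qed

lemma x_ln_inverse_le:
  fixes x :: real
  assumes "0 < x" "x \<le> R" "R \<le> 1"
  shows "0 \<le> x * ln (R / x)" "x * ln (R / x) \<le> 1 - x"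
proof -
  show "0 \<le> x * ln (R / x)" using assms by simp
  have "ln (R / x) \<le> R / x - 1" using assms by (intro ln_le_minus_one) simp
  also have "\<dots> \<le> 1 / x - 1" using assms by (simp add: divide_right_mono)
  finally have "x * ln (R / x) \<le> x * (1 / x - 1)" using assms by (intro mult_left_mono) auto
  also have "\<dots> = 1 - x" using assms by (simp add: right_diff_distrib)
  finally show "x * ln (R / x) \<le> 1 - x" .
qed

text \<open>On \<open>[3/4, 7/8]\<close> the weight \<open>s (1 - s)\<close> is at least \<open>3/32\<close> and the mean at least a fifth of the mean at
\<open>r\<close>; the interval has length \<open>1/8\<close>, and \<open>1280/3 < 427\<close>.\<close>

lemma circle_mean_pointwise_bound:
  assumes g: "g holomorphic_on ball 0 1"
    and X: "(\<integral>\<^sup>+r\<in>{0<..<1}. ennreal (r * (1 - r) * circle_mean g r) \<partial>lborel) = ennreal x" "0 \<le> x"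
    and r: "0 < r" "r \<le> 1 / 2"
  shows "circle_mean g r \<le> 427 * x"
proof -
  have "ennreal (3 / 160 * circle_mean g r * (1 / 8)) = (\<integral>\<^sup>+s\<in>{3 / 4..7 / 8 :: real}. ennreal (3 / 160 * circle_mean g r) \<partial>lborel)"
    using circle_mean_nonneg[of g r] by (subst nn_integral_cmult_indicator) (simp_all flip: ennreal_mult)
  also have "\<dots> \<le> (\<integral>\<^sup>+s\<in>{0<..<1}. ennreal (s * (1 - s) * circle_mean g s) \<partial>lborel)"
  proof (rule nn_integral_mono)
    fix s :: real
    have "3 / 160 * circle_mean g r \<le> s * (1 - s) * circle_mean g s" if s: "s \<in> {3 / 4..7 / 8}"
    proof -
      have "3 / 4 * (1 / 8) * circle_mean g s \<le> s * (1 - s) * circle_mean g s"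
        using s circle_mean_nonneg[of g s] by (intro mult_right_mono mult_mono) auto
      moreover have "circle_mean g r \<le> 5 * circle_mean g s"
        using r s by (intro circle_mean_inner_le g) auto
      ultimately show ?thesis by linarith
    qed
    then show "ennreal (3 / 160 * circle_mean g r) * indicator {3 / 4..7 / 8} s \<le>
        ennreal (s * (1 - s) * circle_mean g s) * indicator {0<..<1} s"
      by (cases "s \<in> {3 / 4..7 / 8}") (auto intro!: ennreal_leI)
  qed
  also have "\<dots> = ennreal x" by (rule X)
  finally have "3 / 160 * circle_mean g r * (1 / 8) \<le> x" using X(2) by (simp add: ennreal_le_iff)
  then show ?thesis using X(2) by simp
qed

text \<open>The factor \<open>r\<close> of polar coordinates is missing in the dominating function \<open>4 (1 - r) M r\<close>, where
\<open>M\<close> denotes the circle mean of \<open>\<bar>F' G'\<bar>\<close>. For \<open>r > 1/2\<close> it costs a factor \<open>2\<close>, and for small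
\<open>r\<close> the pointwise bound on \<open>M\<close> is used. The constant is \<open>4 * 427 + 8\<close>.\<close>

theorem radial_pairing_limit:
  assumes F: "F holomorphic_on ball 0 1" and G: "G holomorphic_on ball 0 1" and F0: "F 0 = 0"
    and X: "(\<integral>\<^sup>+z. ennreal (cmod (deriv F z * deriv G z) * (1 - cmod z)) * indicator (ball 0 1) z \<partial>lborel) = ennreal x" "0 \<le> x"
  obtains L where "(radial_pairing F G \<longlongrightarrow> L) (at_left 1)" "cmod L \<le> 1716 * x"
proof -
  define g where "g = (\<lambda>z. deriv F z * deriv G z)"
  have dF: "deriv F holomorphic_on ball 0 1" "deriv G holomorphic_on ball 0 1"
    using F G by (auto intro: holomorphic_deriv)
  have g: "g holomorphic_on ball 0 1" unfolding g_def using dF by (intro holomorphic_on_mult)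
  have Xr: "(\<integral>\<^sup>+r\<in>{0<..<1}. ennreal (r * (1 - r) * circle_mean g r) \<partial>lborel) = ennreal x"
    using X(1) unfolding nn_integral_disc_circle_mean[OF g, symmetric] by (simp add: g_def)
  let ?m = "radial_pairing (deriv F) (deriv G)"
  define w where "w = (\<lambda>r. indicator {0<..<1} r *\<^sub>R (4 * (1 - r) * circle_mean g r))"
  have w_nonneg: "0 \<le> w r" for r using circle_mean_nonneg[of g r] by (auto simp: w_def indicator_def)
  have cmeas: "(\<lambda>r. indicator {0<..<1} r *\<^sub>R circle_mean g r) \<in> borel_measurable borel"
    by (intro borel_measurable_continuous_on_indicator continuous_on_subset[OF circle_mean_continuous[OF g]]) auto
  have wmeas: "w \<in> borel_measurable borel"
  proof -
    have "w = (\<lambda>r. (4 * (1 - r)) * (indicator {0<..<1} r *\<^sub>R circle_mean g r))"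
      by (auto simp: w_def indicator_def)
    then show ?thesis using cmeas by simp
  qed
  have w_le: "ennreal (w r) \<le> ennreal (1708 * x) * indicator {0<..<1} r + ennreal 8 * (ennreal (r * (1 - r) * circle_mean g r) * indicator {0<..<1} r)" for r
  proof (cases "0 < r \<and> r < 1")
    case True
    then have r: "0 < r" "r < 1" by auto
    have p: "0 \<le> r * (1 - r) * circle_mean g r" using r circle_mean_nonneg[of g r] by simp
    have "4 * (1 - r) * circle_mean g r \<le> 1708 * x + 8 * (r * (1 - r) * circle_mean g r)"
    proof (cases "r \<le> 1 / 2")
      case True
      have "4 * (1 - r) * circle_mean g r \<le> 4 * 1 * circle_mean g r"
        using r circle_mean_nonneg[of g r] by (intro mult_right_mono) auto
      also have "\<dots> \<le> 1708 * x" using circle_mean_pointwise_bound[OF g Xr X(2) r(1) True] by simp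
      finally show ?thesis using p by linarith
    next
      case False
      have "1 * ((1 - r) * circle_mean g r) \<le> 2 * r * ((1 - r) * circle_mean g r)"
        using False r circle_mean_nonneg[of g r] by (intro mult_right_mono) auto
      moreover have "4 * (1 - r) * circle_mean g r = 4 * (1 * ((1 - r) * circle_mean g r))"
        "8 * (r * (1 - r) * circle_mean g r) = 4 * (2 * r * ((1 - r) * circle_mean g r))"
        by (simp_all add: mult_ac)
      ultimately show ?thesis using X(2) by linarith
    qed
    then have "ennreal (w r) \<le> ennreal (1708 * x + 8 * (r * (1 - r) * circle_mean g r))"
      using r by (intro ennreal_leI) (simp add: w_def)
    also have "\<dots> = ennreal (1708 * x) + ennreal 8 * ennreal (r * (1 - r) * circle_mean g r)"
      using p X(2) by (simp only: ennreal_plus mult_nonneg_nonneg zero_le_numeral ennreal_mult)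
    finally show ?thesis using r by simp
  qed (simp add: w_def)
  have "(\<integral>\<^sup>+r. ennreal (w r) \<partial>lborel) \<le> (\<integral>\<^sup>+r. ennreal (1708 * x) * indicator {0<..<1} r + ennreal 8 * (ennreal (r * (1 - r) * circle_mean g r) * indicator {0<..<1} r) \<partial>lborel)"
    by (intro nn_integral_mono w_le)
  also have "\<dots> = ennreal (1708 * x) * emeasure lborel {0<..<1::real} + ennreal 8 * (\<integral>\<^sup>+r\<in>{0<..<1}. ennreal (r * (1 - r) * circle_mean g r) \<partial>lborel)"
  proof -
    have "(\<lambda>r. ennreal (r * (1 - r) * circle_mean g r) * indicator {0<..<1} r) = (\<lambda>r. ennreal (r * (1 - r) * (indicator {0<..<1} r *\<^sub>R circle_mean g r)))"
      by (auto simp: indicator_def)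
    then have [measurable]: "(\<lambda>r. ennreal (r * (1 - r) * circle_mean g r) * indicator {0<..<1} r) \<in> borel_measurable borel"
      using cmeas by simp
    show ?thesis
      by (subst nn_integral_add) (simp_all add: nn_integral_cmult nn_integral_cmult_indicator)
  qed
  also have "\<dots> = ennreal (1716 * x)"
  proof -
    have 1: "emeasure lborel {0<..<1::real} = 1" by simp
    have 2: "ennreal 8 * ennreal x = ennreal (8 * x)" by (rule ennreal_mult'[symmetric]) simp
    have "ennreal (1708 * x) + ennreal (8 * x) = ennreal (1708 * x + 8 * x)"
      using X(2) by (intro ennreal_plus[symmetric]) auto
    then show ?thesis unfolding Xr 1 2 by simp
  qed
  finally have w_int: "(\<integral>\<^sup>+r. ennreal (w r) \<partial>lborel) \<le> ennreal (1716 * x)" .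
  have w_leb: "(\<integral>\<^sup>+r. ennreal (w r) \<partial>lebesgue) \<le> ennreal (1716 * x)"
    using w_int by (simp add: nn_integral_completion)
  have wi: "integrable lebesgue w"
    using w_leb w_nonneg wmeas by (intro integrableI_nonneg) (auto simp: measurable_completion intro: le_less_trans)
  have wI: "(\<integral>r. w r \<partial>lebesgue) \<le> 1716 * x"
    using w_leb w_nonneg X(2) wi by (simp add: nn_integral_eq_integral ennreal_le_iff)
  define K where "K = (\<lambda>R r. indicator {0<..<R} r *\<^sub>R (complex_of_real (4 * (r * ln (R / r))) * ?m r))"
  have mcont: "continuous_on {-1<..<1} ?m" by (rule radial_pairing_continuous[OF dF])
  have Kmeas: "K R \<in> borel_measurable borel" if R: "0 < R" "R \<le> 1" for R
    unfolding K_def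
  proof (rule borel_measurable_continuous_on_indicator)
    show "continuous_on {0<..<R} (\<lambda>r. complex_of_real (4 * (r * ln (R / r))) * ?m r)"
      using R by (intro continuous_intros continuous_on_subset[OF mcont]) auto
  qed simp
  have K_le: "cmod (K R r) \<le> w r" if R: "0 < R" "R \<le> 1" for R r
  proof (cases "0 < r \<and> r < R")
    case True
    then have r: "0 < r" "r \<le> R" "r < 1" "\<bar>r\<bar> < 1" using R by auto
    note l = x_ln_inverse_le[OF r(1,2) R(2)]
    have "cmod (K R r) = 4 * (r * ln (R / r)) * cmod (?m r)"
      using True l(1) by (simp add: K_def norm_mult abs_mult)
    also have "\<dots> \<le> 4 * (1 - r) * circle_mean g r"
      using l circle_mean_nonneg[of g r] radial_pairing_le_circle_mean[OF dF r(4)] r unfolding g_def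
      by (intro mult_mono) auto
    finally show ?thesis using r by (simp add: w_def)
  next
    case False
    then show ?thesis using w_nonneg[of r] by (auto simp: K_def)
  qed
  have K_int: "(\<integral>r. K R r \<partial>lebesgue) = radial_pairing F G R" if R: "0 < R" "R < 1" for R
  proof -
    have Ki: "integrable lebesgue (K R)"
      using wi by (rule Bochner_Integration.integrable_bound)
        (use R K_le[of R] Kmeas[of R] w_nonneg in \<open>auto intro!: measurable_completion\<close>)
    then have "(K R has_integral (\<integral>r. K R r \<partial>lebesgue)) UNIV"
      by (rule has_integral_integral_lebesgue)
    moreover have "((\<lambda>r. if r \<in> {0..R} then of_real (4 * (r * ln (R / r))) * ?m r else 0) has_integral radial_pairing F G R) UNIV"
      using has_integral_radial_pairing[OF F G F0 R] by (simp only: has_integral_restrict_UNIV)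
    moreover have "K R = (\<lambda>r. if r \<in> {0..R} then of_real (4 * (r * ln (R / r))) * ?m r else 0)"
    proof
      fix r :: real
      consider "0 < r \<and> r < R" | "r = 0" | "r = R" | "r < 0" | "r > R" by linarith
      then show "K R r = (if r \<in> {0..R} then of_real (4 * (r * ln (R / r))) * ?m r else 0)"
        using R by cases (simp_all add: K_def)
    qed
    ultimately show ?thesis by (metis has_integral_unique)
  qed
  let ?L = "\<integral>r. K 1 r \<partial>lebesgue"
  have "cmod ?L \<le> (\<integral>r. w r \<partial>lebesgue)"
    using wi by (rule Bochner_Integration.integral_norm_bound_integral[rotated])
      (use K_le[of 1] Kmeas[of 1] w_nonneg wi in \<open>auto intro!: Bochner_Integration.integrable_bound[OF wi] measurable_completion\<close>)
  also note wI
  finally have bound: "cmod ?L \<le> 1716 * x" .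
  have "(radial_pairing F G \<longlongrightarrow> ?L) (at_left 1)"
  proof (rule tendsto_at_left_sequentially)
    fix S :: "nat \<Rightarrow> real"
    assume S: "\<And>n. S n < 1" "\<And>n. 0 < S n" "incseq S" "S \<longlonglongrightarrow> 1"
    have "(\<lambda>n. \<integral>r. K (S n) r \<partial>lebesgue) \<longlonglongrightarrow> ?L"
    proof (rule integral_dominated_convergence[where w = w])
      show "K 1 \<in> borel_measurable lebesgue" using Kmeas[of 1] by (simp add: measurable_completion)
      show "K (S n) \<in> borel_measurable lebesgue" for n
        using Kmeas[of "S n"] S(1)[of n] S(2)[of n] by (simp add: measurable_completion)
      show "integrable lebesgue w" by (rule wi)
      show "AE r in lebesgue. norm (K (S n) r) \<le> w r" for n
        using K_le[of "S n"] S(1)[of n] S(2)[of n] by simp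
      show "AE r in lebesgue. (\<lambda>n. K (S n) r) \<longlonglongrightarrow> K 1 r"
      proof (rule AE_I2)
        fix r :: real
        show "(\<lambda>n. K (S n) r) \<longlonglongrightarrow> K 1 r"
        proof (cases "0 < r \<and> r < 1")
          case True
          have "(\<lambda>n. complex_of_real (4 * (r * ln (S n / r))) * ?m r) \<longlonglongrightarrow> of_real (4 * (r * ln (1 / r))) * ?m r"
            using True S(4) by (intro tendsto_intros) auto
          moreover have "\<forall>\<^sub>F n in sequentially. of_real (4 * (r * ln (S n / r))) * ?m r = K (S n) r"
            using order_tendstoD(1)[OF S(4), of r] True by (auto elim!: eventually_mono simp: K_def)
          ultimately have "(\<lambda>n. K (S n) r) \<longlonglongrightarrow> of_real (4 * (r * ln (1 / r))) * ?m r"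
            by (rule Lim_transform_eventually)
          then show ?thesis using True by (simp add: K_def)
        next
          case False
          have "r \<notin> {0<..<S n}" for n using False S(1)[of n] by auto
          then have Kn: "K (S n) r = 0" for n by (simp add: K_def)
          have K1: "K 1 r = 0" using False by (simp add: K_def)
          show ?thesis unfolding Kn K1 by (rule tendsto_const)
        qed
      qed
    qed
    then show "(\<lambda>n. radial_pairing F G (S n)) \<longlonglongrightarrow> ?L"
      using K_int S by simp
  qed simp
  then show ?thesis using that bound by blast
qed

section \<open>Products of Poisson integrals and their boundary values\<close>

lemma circle_dist_ne: "cmod z < 1 \<Longrightarrow> cis t - z \<noteq> 0"
  using circle_dist_pos[of z t] by auto

lemma cauchy_kernel_integrable:
  fixes p :: "real \<Rightarrow> complex"
  assumes p: "integrable circ p" and B: "\<And>t. cmod (k t) \<le> B" and k[measurable]: "k \<in> borel_measurable circ"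
  shows "integrable circ (\<lambda>t. p t * k t)"
    and "cmod (\<integral>t. p t * k t \<partial>circ) \<le> B * (\<integral>t. cmod (p t) \<partial>circ)"
proof -
  have [measurable]: "p \<in> borel_measurable circ" using p by simp
  have le: "cmod (p t * k t) \<le> B * cmod (p t)" for t
    using B[of t] by (simp add: norm_mult mult.commute mult_right_mono)
  have B0: "0 \<le> B" using B[of 0] norm_ge_zero order_trans by blast
  have iB: "integrable circ (\<lambda>t. B * cmod (p t))" using p by simp
  show i: "integrable circ (\<lambda>t. p t * k t)"
    using iB by (rule Bochner_Integration.integrable_bound) (use le B0 in \<open>auto simp: abs_mult\<close>)
  have "cmod (\<integral>t. p t * k t \<partial>circ) \<le> (\<integral>t. cmod (p t * k t) \<partial>circ)" by (rule integral_norm_bound)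
  also have "\<dots> \<le> (\<integral>t. B * cmod (p t) \<partial>circ)"
    by (rule integral_mono[OF integrable_norm[OF i] iB le])
  finally show "cmod (\<integral>t. p t * k t \<partial>circ) \<le> B * (\<integral>t. cmod (p t) \<partial>circ)" by simp
qed

text \<open>The density is merely integrable, so the derivative is found by estimating the difference
quotient directly.\<close>

lemma cauchy_integral_holomorphic:
  fixes p :: "real \<Rightarrow> complex"
  assumes p: "integrable circ p"
  shows "(\<lambda>z. \<integral>t. p t * (2 * cis t / (cis t - z)) \<partial>circ) holomorphic_on ball 0 1"
proof (rule holomorphic_onI)
  fix z :: complex assume "z \<in> ball 0 1"
  then have z: "cmod z < 1" by simp
  \<comment> \<open>On the disc of radius \<open>\<rho>\<close> about \<open>0\<close> the distance to the circle is at least \<open>\<delta>\<close>.\<close>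
  define \<rho> where "\<rho> = (1 + cmod z) / 2"
  define \<delta> where "\<delta> = 1 - \<rho>"
  have \<rho>: "cmod z < \<rho>" "\<rho> < 1" "0 < \<delta>" using z by (auto simp: \<rho>_def \<delta>_def)
  have d: "\<delta> \<le> cmod (cis t - y)" if "cmod y < \<rho>" for y t
    using circle_dist_pos[of y t] that \<rho> by (simp add: \<delta>_def)
  let ?C = "\<lambda>z. \<integral>t. p t * (2 * cis t / (cis t - z)) \<partial>circ"
  let ?D = "\<integral>t. p t * (2 * cis t / (cis t - z)\<^sup>2) \<partial>circ"
  have i0: "integrable circ (\<lambda>t. p t * (2 * cis t / (cis t - y)))" if "cmod y < \<rho>" for y
  proof (rule cauchy_kernel_integrable(1)[OF p])
    show "cmod (2 * cis t / (cis t - y)) \<le> 2 / \<delta>" for t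
      using d[OF that, of t] \<rho>(3) by (simp add: norm_mult norm_divide frac_le)
  qed measurable
  have i1: "integrable circ (\<lambda>t. p t * (2 * cis t / (cis t - z)\<^sup>2))"
  proof (rule cauchy_kernel_integrable(1)[OF p])
    show "cmod (2 * cis t / (cis t - z)\<^sup>2) \<le> 2 / \<delta>\<^sup>2" for t
      using d[OF \<rho>(1), of t] \<rho>(3)
      by (simp add: norm_mult norm_divide norm_power) (intro frac_le power_mono, auto)
  qed measurable
  have bound: "cmod ((?C y - ?C z) / (y - z) - ?D) \<le> (2 / \<delta> ^ 3 * (\<integral>t. cmod (p t) \<partial>circ)) * cmod (y - z)"
    if y: "cmod y < \<rho>" "y \<noteq> z" for y
  proof -
    have alg: "(2 * c / (c - y) - 2 * c / (c - z)) / (y - z) - 2 * c / (c - z)\<^sup>2 = 2 * c * (y - z) / ((c - y) * (c - z)\<^sup>2)"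
      if "c - y \<noteq> 0" "c - z \<noteq> 0" for c :: complex
    proof -
      have "2 * c / (c - y) - 2 * c / (c - z) = 2 * c * (y - z) / ((c - y) * (c - z))"
      proof -
        have "2 * c / (c - y) = 2 * c * (c - z) / ((c - y) * (c - z))" "2 * c / (c - z) = 2 * c * (c - y) / ((c - y) * (c - z))"
          using that by simp_all
        then have "2 * c / (c - y) - 2 * c / (c - z) = (2 * c * (c - z) - 2 * c * (c - y)) / ((c - y) * (c - z))"
          by (simp only: diff_divide_distrib)
        also have "2 * c * (c - z) - 2 * c * (c - y) = 2 * c * (y - z)" by (simp add: algebra_simps)
        finally show ?thesis .
      qed
      then have "(2 * c / (c - y) - 2 * c / (c - z)) / (y - z) = 2 * c / ((c - y) * (c - z))"
        using y(2) by simp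
      moreover have "2 * c / ((c - y) * (c - z)) - 2 * c / (c - z)\<^sup>2 = 2 * c * (y - z) / ((c - y) * (c - z)\<^sup>2)"
      proof -
        have "2 * c / ((c - y) * (c - z)) = 2 * c * (c - z) / ((c - y) * (c - z)\<^sup>2)"
          using that by (simp add: power2_eq_square)
        moreover have "2 * c / (c - z)\<^sup>2 = 2 * c * (c - y) / ((c - y) * (c - z)\<^sup>2)"
          using that by simp
        ultimately have "2 * c / ((c - y) * (c - z)) - 2 * c / (c - z)\<^sup>2 = (2 * c * (c - z) - 2 * c * (c - y)) / ((c - y) * (c - z)\<^sup>2)"
          by (simp only: diff_divide_distrib)
        also have "2 * c * (c - z) - 2 * c * (c - y) = 2 * c * (y - z)" by (simp add: algebra_simps)
        finally show ?thesis .
      qed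
      ultimately show ?thesis by simp
    qed
    have "(?C y - ?C z) / (y - z) - ?D = (\<integral>t. (p t * (2 * cis t / (cis t - y)) - p t * (2 * cis t / (cis t - z))) / (y - z) - p t * (2 * cis t / (cis t - z)\<^sup>2) \<partial>circ)"
      using i0[OF y(1)] i0[OF \<rho>(1)] i1 by simp
    also have "\<dots> = (\<integral>t. p t * (2 * cis t * (y - z) / ((cis t - y) * (cis t - z)\<^sup>2)) \<partial>circ)"
    proof (rule Bochner_Integration.integral_cong[OF refl])
      fix t
      have "cis t - y \<noteq> 0" "cis t - z \<noteq> 0" using circle_dist_ne[of y t] circle_dist_ne[OF z, of t] y \<rho> by auto
      note a = alg[OF this]
      have "(p t * (2 * cis t / (cis t - y)) - p t * (2 * cis t / (cis t - z))) / (y - z) - p t * (2 * cis t / (cis t - z)\<^sup>2) =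
         p t * ((2 * cis t / (cis t - y) - 2 * cis t / (cis t - z)) / (y - z) - 2 * cis t / (cis t - z)\<^sup>2)"
        by (simp only: right_diff_distrib times_divide_eq_right diff_divide_distrib)
      then show "(p t * (2 * cis t / (cis t - y)) - p t * (2 * cis t / (cis t - z))) / (y - z) - p t * (2 * cis t / (cis t - z)\<^sup>2) =
         p t * (2 * cis t * (y - z) / ((cis t - y) * (cis t - z)\<^sup>2))"
        unfolding a .
    qed
    also have "cmod \<dots> \<le> (2 / \<delta> ^ 3 * cmod (y - z)) * (\<integral>t. cmod (p t) \<partial>circ)"
    proof (rule cauchy_kernel_integrable(2)[OF p])
      fix t
      have "\<delta> * \<delta>\<^sup>2 \<le> cmod (cis t - y) * (cmod (cis t - z))\<^sup>2"
        using d[OF y(1), of t] d[OF \<rho>(1), of t] \<rho>(3) by (intro mult_mono power_mono) auto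
      then have "2 * cmod (y - z) / (cmod (cis t - y) * (cmod (cis t - z))\<^sup>2) \<le> 2 * cmod (y - z) / (\<delta> * \<delta>\<^sup>2)"
        using \<rho>(3) by (intro frac_le) auto
      then show "cmod (2 * cis t * (y - z) / ((cis t - y) * (cis t - z)\<^sup>2)) \<le> 2 / \<delta> ^ 3 * cmod (y - z)"
        by (simp add: norm_mult norm_divide norm_power power3_eq_cube power2_eq_square mult.assoc)
    qed measurable
    finally show ?thesis by (simp only: mult_ac)
  qed
  have "((\<lambda>y. (?C y - ?C z) / (y - z)) \<longlongrightarrow> ?D) (at z)"
  proof (rule Lim_null[THEN iffD2], rule Lim_null_comparison)
    have "\<forall>\<^sub>F y in at z. y \<in> ball 0 \<rho>"
      using \<rho>(1) by (intro eventually_at_in_open') auto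
    moreover have "\<forall>\<^sub>F y in at z. y \<noteq> z" by (rule eventually_neq_at_within)
    ultimately show "\<forall>\<^sub>F y in at z. cmod ((?C y - ?C z) / (y - z) - ?D) \<le> (2 / \<delta> ^ 3 * (\<integral>t. cmod (p t) \<partial>circ)) * cmod (y - z)"
      by eventually_elim (rule bound, auto)
    have "((\<lambda>y. (2 / \<delta> ^ 3 * (\<integral>t. cmod (p t) \<partial>circ)) * cmod (y - z)) \<longlongrightarrow> (2 / \<delta> ^ 3 * (\<integral>t. cmod (p t) \<partial>circ)) * cmod (z - z)) (at z)"
      by (intro tendsto_intros)
    then show "((\<lambda>y. (2 / \<delta> ^ 3 * (\<integral>t. cmod (p t) \<partial>circ)) * cmod (y - z)) \<longlongrightarrow> 0) (at z)" by simp
  qed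
  then have "(?C has_field_derivative ?D) (at z)"
    unfolding has_field_derivative_iff .
  then show "?C field_differentiable at z within ball 0 1"
    by (auto simp: field_differentiable_def intro: has_field_derivative_at_within)
qed

text \<open>The Herglotz kernel \<open>(cis t + z) / (cis t - z)\<close> is analytic in \<open>z\<close> and has the Poisson kernel as
its real part. It equals \<open>2 cis t / (cis t - z) - 1\<close>.\<close>

lemma herglotz_transform:
  fixes p :: "real \<Rightarrow> real"
  assumes p: "integrable circ p"
  obtains H where "H holomorphic_on ball 0 1"
    "\<And>z. cmod z < 1 \<Longrightarrow> Re (H z) = (\<integral>t. poisson_kernel z t * p t \<partial>circ) / (2 * pi)"
proof
  let ?p = "\<lambda>t. complex_of_real (p t)"
  let ?C = "\<lambda>z. \<integral>t. ?p t * (2 * cis t / (cis t - z)) \<partial>circ"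
  let ?H = "\<lambda>z. (?C z - (\<integral>t. ?p t \<partial>circ)) / of_real (2 * pi)"
  have ip: "integrable circ ?p" using p by simp
  show "?H holomorphic_on ball 0 1"
    by (intro holomorphic_intros cauchy_integral_holomorphic ip) simp
  fix z :: complex assume z: "cmod z < 1"
  have i: "integrable circ (\<lambda>t. ?p t * (2 * cis t / (cis t - z)))"
  proof (rule cauchy_kernel_integrable(1)[OF ip])
    show "cmod (2 * cis t / (cis t - z)) \<le> 2 / (1 - cmod z)" for t
      using circle_dist_pos[OF z, of t] z by (simp add: norm_mult norm_divide frac_le)
  qed measurable
  have re: "Re (2 * cis t / (cis t - z) - 1) = poisson_kernel z t" for t
  proof -
    have nz: "cis t - z \<noteq> 0" by (rule circle_dist_ne[OF z])
    have "2 * cis t / (cis t - z) - 1 = (cis t + z) / (cis t - z)"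
    proof -
      have "2 * cis t / (cis t - z) - 1 = 2 * cis t / (cis t - z) - (cis t - z) / (cis t - z)" using nz by simp
      also have "\<dots> = (2 * cis t - (cis t - z)) / (cis t - z)" by (simp only: diff_divide_distrib)
      finally show ?thesis by (simp add: algebra_simps)
    qed
    then have "Re (2 * cis t / (cis t - z) - 1) = Re ((cis t + z) * cnj (cis t - z)) / (cmod (cis t - z))\<^sup>2"
      using complex_div_cnj[of "cis t + z" "cis t - z"] by (simp only: of_real_power[symmetric] Re_divide_of_real)
    also have "Re ((cis t + z) * cnj (cis t - z)) = 1 - (cmod z)\<^sup>2"
    proof -
      have "Re ((cis t + z) * cnj (cis t - z)) = (cos t + Re z) * (cos t - Re z) - (sin t + Im z) * (Im z - sin t)"
        by simp
      also have "(a + c) * (a - c) - (b + d) * (d - b) = (a * a + b * b) - (c * c + d * d)" for a b c d :: real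
        by (simp add: algebra_simps)
      finally have "Re ((cis t + z) * cnj (cis t - z)) = (cos t * cos t + sin t * sin t) - (Re z * Re z + Im z * Im z)" .
      moreover have "(cmod z)\<^sup>2 = Re z * Re z + Im z * Im z"
        unfolding cmod_power2 by (simp add: power2_eq_square)
      ultimately show ?thesis by (simp only: sin_cos_squared_add3)
    qed
    finally show ?thesis by (simp add: poisson_kernel_def)
  qed
  have "?C z - (\<integral>t. ?p t \<partial>circ) = (\<integral>t. ?p t * (2 * cis t / (cis t - z)) - ?p t \<partial>circ)"
    by (rule Bochner_Integration.integral_diff[OF i ip, symmetric])
  also have "Re \<dots> = (\<integral>t. Re (?p t * (2 * cis t / (cis t - z)) - ?p t) \<partial>circ)"
    by (rule integral_Re[symmetric]) (intro Bochner_Integration.integrable_diff i ip)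
  also have "\<dots> = (\<integral>t. poisson_kernel z t * p t \<partial>circ)"
  proof (rule Bochner_Integration.integral_cong[OF refl])
    fix t
    have "?p t * (2 * cis t / (cis t - z)) - ?p t = ?p t * (2 * cis t / (cis t - z) - 1)"
      by (simp add: right_diff_distrib)
    then show "Re (?p t * (2 * cis t / (cis t - z)) - ?p t) = poisson_kernel z t * p t"
      unfolding re[of t, symmetric] by (simp only: times_complex.sel Re_complex_of_real Im_complex_of_real) simp
  qed
  finally show "Re (?H z) = (\<integral>t. poisson_kernel z t * p t \<partial>circ) / (2 * pi)"
    by (simp only: Re_divide_of_real)
qed

text \<open>Convergence in \<open>L\<^sup>1\<close> gives convergence almost everywhere along a subsequence of radii; one subsequence
serves both functions.\<close>

lemma ex_radii_boundary_values:
  assumes u: "integrable circ u" and v: "integrable circ v"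
  obtains r :: "nat \<Rightarrow> real" where "\<And>n. 0 < r n" "\<And>n. r n < 1" "r \<longlonglongrightarrow> 1"
    "AE t in circ. (\<lambda>n. poisson_integral u (of_real (r n) * cis t)) \<longlonglongrightarrow> u t"
    "AE t in circ. (\<lambda>n. poisson_integral v (of_real (r n) * cis t)) \<longlonglongrightarrow> v t"
proof -
  define r where "r = (\<lambda>n. 1 - 1 / real (n + 2))"
  have r: "0 < r n" "r n < 1" for n by (auto simp: r_def)
  have rlim: "r \<longlonglongrightarrow> 1"
  proof -
    have "(\<lambda>n. 1 - 1 / real (n + 2)) \<longlonglongrightarrow> 1 - 0"
      by (intro tendsto_diff tendsto_const LIMSEQ_ignore_initial_segment[OF lim_1_over_n])
    then show ?thesis by (simp add: r_def)
  qed
  have at: "filterlim r (at_left 1) sequentially"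
    using r rlim by (auto simp: filterlim_at intro!: always_eventually less_imp_neq)
  have L1: "(\<lambda>n. \<integral>t. cmod (poisson_integral w (of_real (r n) * cis t) - w t) \<partial>circ) \<longlonglongrightarrow> 0" if "integrable circ w" for w
    by (rule filterlim_compose[OF poisson_integral_L1_convergence[OF that] at])
  have int: "integrable circ (\<lambda>t. poisson_integral w (of_real (r n) * cis t) - w t)" if "integrable circ w" for w n
    using that r(1)[of n] r(2)[of n] by (intro Bochner_Integration.integrable_diff poisson_integral_contraction(1)) auto
  obtain j where j: "strict_mono j" "AE t in circ. (\<lambda>n. poisson_integral u (of_real (r (j n)) * cis t) - u t) \<longlonglongrightarrow> 0"
    using tendsto_L1_AE_subseq[OF int[OF u] L1[OF u]] by blast
  have L1': "(\<lambda>n. \<integral>t. cmod (poisson_integral v (of_real (r (j n)) * cis t) - v t) \<partial>circ) \<longlonglongrightarrow> 0"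
    using LIMSEQ_subseq_LIMSEQ[OF L1[OF v] j(1)] by (simp add: o_def)
  obtain l where l: "strict_mono l" "AE t in circ. (\<lambda>n. poisson_integral v (of_real (r (j (l n))) * cis t) - v t) \<longlonglongrightarrow> 0"
    using tendsto_L1_AE_subseq[OF int[OF v] L1'] by blast
  show ?thesis
  proof
    show "(\<lambda>n. r (j (l n))) \<longlonglongrightarrow> 1"
      using LIMSEQ_subseq_LIMSEQ[OF rlim strict_mono_o[OF j(1) l(1)]] by (simp add: o_def)
    show "AE t in circ. (\<lambda>n. poisson_integral v (of_real (r (j (l n))) * cis t)) \<longlonglongrightarrow> v t"
      using l(2) by eventually_elim (simp add: LIM_zero_iff)
    show "AE t in circ. (\<lambda>n. poisson_integral u (of_real (r (j (l n))) * cis t)) \<longlonglongrightarrow> u t"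
      using j(2)
    proof eventually_elim
      case (elim t)
      then have "(\<lambda>n. poisson_integral u (of_real (r (j n)) * cis t)) \<longlonglongrightarrow> u t" by (simp add: LIM_zero_iff)
      from LIMSEQ_subseq_LIMSEQ[OF this l(1)] show ?case by (simp add: o_def)
    qed
  qed (rule r)+
qed

text \<open>Damping both factors by \<open>1 / (1 + \<epsilon> H)\<close>, where \<open>Re H\<close> is the Poisson integral of
  \<open>\<bar>u\<bar> + \<bar>v\<bar>\<close>, makes the product bounded without increasing its modulus. Dominated
  convergence on circles of radius tending to \<open>1\<close> and then \<open>\<epsilon> \<rightarrow> 0\<close> give the bound.\<close>

lemma smirnov_product:
  assumes u: "integrable circ u" and v: "integrable circ v" and uv: "integrable circ (\<lambda>t. u t * v t)"
    and F: "poisson_integral u holomorphic_on ball 0 1" and G: "poisson_integral v holomorphic_on ball 0 1"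
    and z: "cmod z < 1"
  shows "cmod (poisson_integral u z * poisson_integral v z) \<le> (\<integral>t. poisson_kernel z t * cmod (u t * v t) \<partial>circ) / (2 * pi)"
    (is "_ \<le> ?B")
proof -
  let ?F = "poisson_integral u" and ?G = "poisson_integral v"
  have [measurable]: "u \<in> borel_measurable circ" "v \<in> borel_measurable circ" using u v by auto
  have iu: "integrable circ (\<lambda>t. cmod (u t))" and iv: "integrable circ (\<lambda>t. cmod (v t))" using u v by auto
  then have ip: "integrable circ (\<lambda>t. cmod (u t) + cmod (v t))" by simp
  obtain H where H: "H holomorphic_on ball 0 1"
      and ReH: "\<And>z. cmod z < 1 \<Longrightarrow> Re (H z) = (\<integral>t. poisson_kernel z t * (cmod (u t) + cmod (v t)) \<partial>circ) / (2 * pi)"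
    using herglotz_transform[OF ip] by blast
  have split: "(\<integral>t. poisson_kernel y t * (cmod (u t) + cmod (v t)) \<partial>circ) / (2 * pi) =
      (\<integral>t. poisson_kernel y t * cmod (u t) \<partial>circ) / (2 * pi) + (\<integral>t. poisson_kernel y t * cmod (v t) \<partial>circ) / (2 * pi)"
    if "cmod y < 1" for y
    using real_poisson_integrable[OF iu that] real_poisson_integrable[OF iv that]
    by (simp add: distrib_left add_divide_distrib)
  have FH: "cmod (?F y) \<le> Re (H y)" and GH: "cmod (?G y) \<le> Re (H y)" if y: "cmod y < 1" for y
  proof -
    have a: "cmod (?F y) \<le> (\<integral>t. poisson_kernel y t * cmod (u t) \<partial>circ) / (2 * pi)"
      "cmod (?G y) \<le> (\<integral>t. poisson_kernel y t * cmod (v t) \<partial>circ) / (2 * pi)"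
      using poisson_integral_norm_le[OF u y] poisson_integral_norm_le[OF v y] by auto
    show "cmod (?F y) \<le> Re (H y)" "cmod (?G y) \<le> Re (H y)"
      using a norm_ge_zero[of "?F y"] norm_ge_zero[of "?G y"] unfolding ReH[OF y] split[OF y] by linarith+
  qed
  have eps: "cmod (?F z * ?G z * (1 / (1 + of_real \<epsilon> * H z))\<^sup>2) \<le> ?B" if \<epsilon>: "0 < \<epsilon>" for \<epsilon> :: real
  proof -
    define h where "h = (\<lambda>y. 1 / (1 + of_real \<epsilon> * H y))"
    define q where "q = (\<lambda>y. ?F y * ?G y * (h y)\<^sup>2)"
    have den: "1 \<le> cmod (1 + of_real \<epsilon> * H y)" "\<epsilon> * Re (H y) \<le> cmod (1 + of_real \<epsilon> * H y)" "0 \<le> Re (H y)" if y: "cmod y < 1" for y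
    proof -
      show R0: "0 \<le> Re (H y)" using FH[OF y] norm_ge_zero order_trans by blast
      have "1 + \<epsilon> * Re (H y) \<le> cmod (1 + of_real \<epsilon> * H y)"
        using complex_Re_le_cmod[of "1 + of_real \<epsilon> * H y"] by simp
      moreover have "0 \<le> \<epsilon> * Re (H y)" using R0 \<epsilon> by simp
      ultimately show "1 \<le> cmod (1 + of_real \<epsilon> * H y)" "\<epsilon> * Re (H y) \<le> cmod (1 + of_real \<epsilon> * H y)" by linarith+
    qed
    have h_hol: "h holomorphic_on ball 0 1"
    proof -
      have "1 + of_real \<epsilon> * H y \<noteq> 0" if "y \<in> ball 0 1" for y
        using den(1)[of y] that by force
      then show ?thesis unfolding h_def by (intro holomorphic_intros H) auto
    qed
    have q_hol: "q holomorphic_on ball 0 1"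
      unfolding q_def by (intro holomorphic_on_mult holomorphic_on_power F G h_hol)
    have h1: "cmod (h y) \<le> 1" if "cmod y < 1" for y
      using den(1)[OF that] by (simp add: h_def norm_divide divide_le_eq)
    have bd: "cmod w * cmod (h y) \<le> 1 / \<epsilon>" if y: "cmod y < 1" and w: "cmod w \<le> Re (H y)" for w y
    proof -
      have "\<epsilon> * cmod w \<le> 1 * cmod (1 + of_real \<epsilon> * H y)"
      proof -
        have "\<epsilon> * cmod w \<le> \<epsilon> * Re (H y)" using \<epsilon> by (intro mult_left_mono w) simp
        then show ?thesis using den(2)[OF y] by linarith
      qed
      then show ?thesis using den(1)[OF y] \<epsilon>
        by (simp add: h_def norm_divide divide_le_eq pos_le_divide_eq mult.commute)
    qed
    have q_le: "cmod (q y) \<le> min ((1 / \<epsilon>)\<^sup>2) (cmod (?F y * ?G y))" if y: "cmod y < 1" for y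
    proof -
      have "cmod (q y) = (cmod (?F y) * cmod (h y)) * (cmod (?G y) * cmod (h y))"
        by (simp add: q_def norm_mult norm_power power2_eq_square mult_ac)
      also have "\<dots> \<le> (1 / \<epsilon>) * (1 / \<epsilon>)"
        using \<epsilon> by (intro mult_mono bd[OF y] FH[OF y] GH[OF y]) auto
      finally have 1: "cmod (q y) \<le> (1 / \<epsilon>)\<^sup>2" by (simp add: power2_eq_square)
      have "cmod (q y) = cmod (?F y * ?G y) * (cmod (h y))\<^sup>2"
        by (simp add: q_def norm_mult norm_power)
      also have "\<dots> \<le> cmod (?F y * ?G y) * 1"
        using h1[OF y] by (intro mult_left_mono power_le_one) auto
      finally show ?thesis using 1 by simp
    qed
    obtain r where r: "\<And>n. 0 < r n" "\<And>n. r n < 1" and rlim: "r \<longlonglongrightarrow> 1"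
        and AEu: "AE t in circ. (\<lambda>n. poisson_integral u (of_real (r n) * cis t)) \<longlonglongrightarrow> u t"
        and AEv: "AE t in circ. (\<lambda>n. poisson_integral v (of_real (r n) * cis t)) \<longlonglongrightarrow> v t"
      by (rule ex_radii_boundary_values[OF u v]) blast
    have nr: "cmod (of_real (r n) * cis t) < 1" for n t using r(1)[of n] r(2)[of n] by (simp add: norm_mult)
    let ?M = "\<lambda>n t. min ((1 / \<epsilon>)\<^sup>2) (cmod (?F (of_real (r n) * cis t) * ?G (of_real (r n) * cis t)))"
    have fin: "integrable circ (\<lambda>_. c)" for c :: real
      using finite_measure_circ by (rule finite_measure.integrable_const)
    have lim2: "(\<lambda>n. \<integral>t. poisson_kernel z t * ?M n t \<partial>circ) \<longlonglongrightarrow> (\<integral>t. poisson_kernel z t * min ((1 / \<epsilon>)\<^sup>2) (cmod (u t * v t)) \<partial>circ)"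
    proof (rule integral_dominated_convergence[where w = "\<lambda>t. poisson_kernel z t * (1 / \<epsilon>)\<^sup>2"])
      show "integrable circ (\<lambda>t. poisson_kernel z t * (1 / \<epsilon>)\<^sup>2)" by (rule real_poisson_integrable[OF fin z])
      show "AE t in circ. (\<lambda>n. poisson_kernel z t * ?M n t) \<longlonglongrightarrow> poisson_kernel z t * min ((1 / \<epsilon>)\<^sup>2) (cmod (u t * v t))"
        using AEu AEv by eventually_elim (intro tendsto_intros)
      show "AE t in circ. norm (poisson_kernel z t * ?M n t) \<le> poisson_kernel z t * (1 / \<epsilon>)\<^sup>2" for n
        using poisson_kernel_nonneg[OF z] by (intro AE_I2) (simp add: abs_mult mult_left_mono)
    qed measurable
    have lim1: "(\<lambda>n. cmod (q (of_real (r n) * z))) \<longlonglongrightarrow> cmod (q z)"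
    proof (rule tendsto_norm)
      have "isCont q z"
        using holomorphic_on_imp_continuous_on[OF q_hol] z by (simp add: continuous_on_eq_continuous_at)
      moreover have "(\<lambda>n. of_real (r n) * z) \<longlonglongrightarrow> of_real 1 * z"
        by (intro tendsto_intros rlim)
      ultimately show "(\<lambda>n. q (of_real (r n) * z)) \<longlonglongrightarrow> q z"
        using isCont_tendsto_compose by fastforce
    qed
    have "cmod (q z) \<le> (\<integral>t. poisson_kernel z t * min ((1 / \<epsilon>)\<^sup>2) (cmod (u t * v t)) \<partial>circ) / (2 * pi)"
    proof (rule LIMSEQ_le[OF lim1 tendsto_divide[OF lim2 tendsto_const]])
      show "\<exists>N. \<forall>n\<ge>N. cmod (q (of_real (r n) * z)) \<le> (\<integral>t. poisson_kernel z t * ?M n t \<partial>circ) / (2 * pi)"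
      proof (intro exI[of _ 0] allI impI)
        fix n
        have "cmod (q (of_real (r n) * z)) \<le> (\<integral>t. poisson_kernel z t * cmod (q (of_real (r n) * cis t)) \<partial>circ) / (2 * pi)"
          by (rule holomorphic_le_poisson_dilate[OF q_hol r z])
        also have "\<dots> \<le> (\<integral>t. poisson_kernel z t * ?M n t \<partial>circ) / (2 * pi)"
        proof (intro divide_right_mono integral_mono)
          have rk: "\<bar>r n\<bar> < 1" using r(1)[of n] r(2)[of n] by simp
          show "integrable circ (\<lambda>t. poisson_kernel z t * cmod (q (of_real (r n) * cis t)))"
            by (intro real_poisson_integrable[OF _ z] integral_circ_continuous(1) continuous_on_norm holomorphic_circle_continuous1[OF q_hol rk])
          show "integrable circ (\<lambda>t. poisson_kernel z t * ?M n t)"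
          proof (intro real_poisson_integrable[OF _ z] Bochner_Integration.integrable_bound[OF fin[of "(1 / \<epsilon>)\<^sup>2"]])
            show "AE t in circ. norm (?M n t) \<le> norm ((1 / \<epsilon>)\<^sup>2)" by (intro AE_I2) simp
          qed measurable
          show "poisson_kernel z t * cmod (q (of_real (r n) * cis t)) \<le> poisson_kernel z t * ?M n t" for t
            using poisson_kernel_nonneg[OF z] by (intro mult_left_mono q_le nr)
        qed simp
        finally show "cmod (q (of_real (r n) * z)) \<le> (\<integral>t. poisson_kernel z t * ?M n t \<partial>circ) / (2 * pi)" .
      qed
    qed simp
    also have "\<dots> \<le> ?B"
    proof (intro divide_right_mono integral_mono)
      have iuv: "integrable circ (\<lambda>t. cmod (u t * v t))" using uv by (rule integrable_norm)
      show "integrable circ (\<lambda>t. poisson_kernel z t * cmod (u t * v t))"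
        by (rule real_poisson_integrable[OF iuv z])
      show "integrable circ (\<lambda>t. poisson_kernel z t * min ((1 / \<epsilon>)\<^sup>2) (cmod (u t * v t)))"
      proof (intro real_poisson_integrable[OF _ z] Bochner_Integration.integrable_bound[OF iuv])
        show "AE t in circ. norm (min ((1 / \<epsilon>)\<^sup>2) (cmod (u t * v t))) \<le> norm (cmod (u t * v t))" by (intro AE_I2) simp
      qed measurable
      show "poisson_kernel z t * min ((1 / \<epsilon>)\<^sup>2) (cmod (u t * v t)) \<le> poisson_kernel z t * cmod (u t * v t)" for t
        using poisson_kernel_nonneg[OF z] by (intro mult_left_mono) auto
    qed simp
    finally show ?thesis by (simp only: q_def h_def)
  qed
  have "((\<lambda>\<epsilon>. cmod (?F z * ?G z * (1 / (1 + of_real \<epsilon> * H z))\<^sup>2)) \<longlongrightarrow> cmod (?F z * ?G z * (1 / (1 + of_real 0 * H z))\<^sup>2)) (at_right 0)"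
    by (intro tendsto_intros) auto
  moreover have "\<forall>\<^sub>F \<epsilon> in at_right 0. cmod (?F z * ?G z * (1 / (1 + of_real \<epsilon> * H z))\<^sup>2) \<le> ?B"
    using eventually_at_right_less[of "0::real"] by eventually_elim (rule eps)
  ultimately have "cmod (?F z * ?G z * (1 / (1 + of_real 0 * H z))\<^sup>2) \<le> ?B"
    by (rule tendsto_upperbound) simp
  then show ?thesis by simp
qed

text \<open>After subtraction of \<open>\<bar>w n - W\<bar>\<close> the error has the fixed majorant \<open>2 W\<close>, so that dominated
convergence applies to it; what was subtracted is small in \<open>L\<^sup>1\<close>.\<close>

lemma integral_tendsto_dominated_L1:
  fixes f :: "nat \<Rightarrow> 'a \<Rightarrow> complex" and w :: "nat \<Rightarrow> 'a \<Rightarrow> real"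
  assumes f: "\<And>n. integrable M (f n)" and g: "integrable M g"
    and w: "\<And>n. integrable M (w n)" and W: "integrable M W"
    and lim: "AE x in M. (\<lambda>n. f n x) \<longlonglongrightarrow> g x"
    and bound: "\<And>n. AE x in M. cmod (f n x) \<le> w n x" and gW: "AE x in M. cmod (g x) \<le> W x"
    and L1: "(\<lambda>n. \<integral>x. \<bar>w n x - W x\<bar> \<partial>M) \<longlonglongrightarrow> 0"
  shows "(\<lambda>n. \<integral>x. f n x \<partial>M) \<longlonglongrightarrow> (\<integral>x. g x \<partial>M)"
proof -
  have [measurable]: "f n \<in> borel_measurable M" "g \<in> borel_measurable M" "w n \<in> borel_measurable M" "W \<in> borel_measurable M" for n
    using f g w W by auto
  define e where "e = (\<lambda>n x. max 0 (cmod (f n x - g x) - \<bar>w n x - W x\<bar>))"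
  have [measurable]: "e n \<in> borel_measurable M" for n unfolding e_def by measurable
  have e_le: "AE x in M. norm (e n x) \<le> 2 * W x" for n
    using bound[of n] gW
  proof eventually_elim
    case (elim x)
    have "cmod (f n x - g x) \<le> cmod (f n x) + cmod (g x)" by (rule norm_triangle_ineq4)
    moreover have "0 \<le> W x" by (rule order_trans[OF norm_ge_zero elim(2)])
    ultimately have "cmod (f n x - g x) - \<bar>w n x - W x\<bar> \<le> 2 * W x"
      using elim abs_ge_self[of "w n x - W x"] by linarith
    then have "e n x \<le> 2 * W x" using \<open>0 \<le> W x\<close> by (simp add: e_def)
    moreover have "0 \<le> e n x" by (simp add: e_def)
    ultimately show ?case by simp
  qed
  have e_int: "integrable M (e n)" for n
  proof (rule Bochner_Integration.integrable_bound[of M "\<lambda>x. 2 * W x"])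
    show "integrable M (\<lambda>x. 2 * W x)" using W by simp
    show "AE x in M. norm (e n x) \<le> norm (2 * W x)"
      using e_le[of n]
    proof eventually_elim
      case (elim x)
      then show ?case using abs_ge_self[of "2 * W x"] unfolding real_norm_def by linarith
    qed
  qed measurable
  have "(\<lambda>n. \<integral>x. e n x \<partial>M) \<longlonglongrightarrow> (\<integral>x. 0 \<partial>M)"
  proof (rule integral_dominated_convergence[where w = "\<lambda>x. 2 * W x"])
    show "AE x in M. (\<lambda>n. e n x) \<longlonglongrightarrow> 0"
      using lim
    proof eventually_elim
      case (elim x)
      have "(\<lambda>n. cmod (f n x - g x)) \<longlonglongrightarrow> 0"
        by (rule tendsto_norm_zero[OF LIM_zero[OF elim]])
      then show ?case
        by (rule Lim_null_comparison[rotated]) (auto simp: e_def intro!: always_eventually)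
    qed
  qed (use W e_le in auto)
  then have lim0: "(\<lambda>n. (\<integral>x. e n x \<partial>M) + (\<integral>x. \<bar>w n x - W x\<bar> \<partial>M)) \<longlonglongrightarrow> 0"
    using tendsto_add[OF _ L1] by fastforce
  have "(\<lambda>n. (\<integral>x. f n x \<partial>M) - (\<integral>x. g x \<partial>M)) \<longlonglongrightarrow> 0"
  proof (rule Lim_null_comparison[OF _ lim0], intro always_eventually allI)
    fix n
    have "cmod ((\<integral>x. f n x \<partial>M) - (\<integral>x. g x \<partial>M)) = cmod (\<integral>x. f n x - g x \<partial>M)"
      using f g by simp
    also have "\<dots> \<le> (\<integral>x. cmod (f n x - g x) \<partial>M)" by (rule integral_norm_bound)
    also have "\<dots> \<le> (\<integral>x. e n x + \<bar>w n x - W x\<bar> \<partial>M)"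
      using f g w W e_int by (intro integral_mono) (auto simp: e_def)
    also have "\<dots> = (\<integral>x. e n x \<partial>M) + (\<integral>x. \<bar>w n x - W x\<bar> \<partial>M)"
      using w W e_int by (intro Bochner_Integration.integral_add) auto
    finally show "norm ((\<integral>x. f n x \<partial>M) - (\<integral>x. g x \<partial>M)) \<le> (\<integral>x. e n x \<partial>M) + (\<integral>x. \<bar>w n x - W x\<bar> \<partial>M)" .
  qed
  then show ?thesis by (simp add: LIM_zero_iff)
qed

text \<open>The product \<open>F cnj G\<close> is not analytic, but it has the modulus of the analytic function \<open>F G\<close>, to which
\<open>smirnov_product\<close> applies.\<close>

theorem pairing_limit_eq_integral:
  assumes u: "integrable circ u" and v: "integrable circ v" and uv: "integrable circ (\<lambda>t. u t * cnj (v t))"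
    and F: "poisson_integral u holomorphic_on ball 0 1" and G: "poisson_integral v holomorphic_on ball 0 1"
    and L: "((\<lambda>r. \<integral>t. poisson_integral u (of_real r * cis t) * cnj (poisson_integral v (of_real r * cis t)) \<partial>circ) \<longlongrightarrow> L) (at_left 1)"
  shows "L = (\<integral>t. u t * cnj (v t) \<partial>circ)"
proof -
  have [measurable]: "u \<in> borel_measurable circ" "v \<in> borel_measurable circ" using u v by auto
  have uv': "integrable circ (\<lambda>t. u t * v t)"
    using uv by (rule Bochner_Integration.integrable_bound) (measurable, simp add: norm_mult)
  let ?W = "\<lambda>t. cmod (u t * v t)"
  let ?cW = "\<lambda>t. complex_of_real (?W t)"
  have W: "integrable circ ?W" using uv' by (rule integrable_norm)
  have cW: "integrable circ ?cW" using W by simp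
  obtain r where r: "\<And>n. 0 < r n" "\<And>n. r n < 1" and rlim: "r \<longlonglongrightarrow> 1"
      and AEu: "AE t in circ. (\<lambda>n. poisson_integral u (of_real (r n) * cis t)) \<longlonglongrightarrow> u t"
      and AEv: "AE t in circ. (\<lambda>n. poisson_integral v (of_real (r n) * cis t)) \<longlonglongrightarrow> v t"
    by (rule ex_radii_boundary_values[OF u v]) blast
  have at: "filterlim (\<lambda>n. r n) (at_left 1) sequentially"
    using rlim r by (auto simp: filterlim_at intro!: always_eventually less_imp_neq)
  have nr: "cmod (of_real (r n) * cis t) < 1" for n t using r(1)[of n] r(2)[of n] by (simp add: norm_mult)
  let ?f = "\<lambda>n t. poisson_integral u (of_real (r n) * cis t) * cnj (poisson_integral v (of_real (r n) * cis t))"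
  let ?w = "\<lambda>n t. Re (poisson_integral ?cW (of_real (r n) * cis t))"
  have w_eq: "poisson_integral ?cW z = of_real ((\<integral>t. poisson_kernel z t * ?W t \<partial>circ) / (2 * pi))" for z
    unfolding poisson_integral_def of_real_mult[symmetric] integral_complex_of_real by simp
  have iw: "integrable circ (\<lambda>t. poisson_integral ?cW (of_real (r n) * cis t))" for n
    using r(1)[of n] r(2)[of n] by (intro poisson_integral_contraction(1)[OF cW]) auto
  have "(\<lambda>n. \<integral>t. ?f n t \<partial>circ) \<longlonglongrightarrow> (\<integral>t. u t * cnj (v t) \<partial>circ)"
  proof (rule integral_tendsto_dominated_L1[where w = ?w and W = ?W])
    show "integrable circ (?f n)" for n
    proof (rule integral_circ_continuous(1))
      have rk: "\<bar>r n\<bar> < 1" using r(1)[of n] r(2)[of n] by simp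
      show "continuous_on {0..2 * pi} (?f n)"
        by (rule continuous_on_mult[OF holomorphic_circle_continuous1[OF F rk] continuous_on_cnj[OF holomorphic_circle_continuous1[OF G rk]]])
    qed
    show "integrable circ (?w n)" for n by (rule integrable_Re[OF iw])
    show "AE t in circ. (\<lambda>n. ?f n t) \<longlonglongrightarrow> u t * cnj (v t)"
      using AEu AEv by eventually_elim (intro tendsto_intros)
    show "AE t in circ. cmod (?f n t) \<le> ?w n t" for n
    proof (rule AE_I2)
      fix t
      show "cmod (?f n t) \<le> ?w n t"
        using smirnov_product[OF u v uv' F G nr[of n t]] unfolding w_eq by (simp add: norm_mult)
    qed
    show "AE t in circ. cmod (u t * cnj (v t)) \<le> ?W t" by (simp add: norm_mult)
    show "(\<lambda>n. \<integral>t. \<bar>?w n t - ?W t\<bar> \<partial>circ) \<longlonglongrightarrow> 0"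
    proof (rule Lim_null_comparison[OF _ filterlim_compose[OF poisson_integral_L1_convergence[OF cW] at]], intro always_eventually allI)
      fix n
      have "(\<integral>t. \<bar>?w n t - ?W t\<bar> \<partial>circ) \<le> (\<integral>t. cmod (poisson_integral ?cW (of_real (r n) * cis t) - ?cW t) \<partial>circ)"
      proof (rule integral_mono)
        show "integrable circ (\<lambda>t. \<bar>?w n t - ?W t\<bar>)"
          by (intro integrable_abs Bochner_Integration.integrable_diff integrable_Re[OF iw] W)
        show "integrable circ (\<lambda>t. cmod (poisson_integral ?cW (of_real (r n) * cis t) - ?cW t))"
          by (intro integrable_norm Bochner_Integration.integrable_diff iw cW)
        show "\<bar>?w n t - ?W t\<bar> \<le> cmod (poisson_integral ?cW (of_real (r n) * cis t) - ?cW t)" for t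
          using abs_Re_le_cmod[of "poisson_integral ?cW (of_real (r n) * cis t) - ?cW t"] by simp
      qed
      then show "norm (\<integral>t. \<bar>?w n t - ?W t\<bar> \<partial>circ) \<le> (\<integral>t. cmod (poisson_integral ?cW (of_real (r n) * cis t) - ?cW t) \<partial>circ)"
        by simp
    qed
  qed (use uv W in auto)
  moreover have "(\<lambda>n. \<integral>t. ?f n t \<partial>circ) \<longlonglongrightarrow> L"
    by (rule filterlim_compose[OF L at])
  ultimately show ?thesis by (rule LIMSEQ_unique[rotated])
qed

section \<open>The duality of BMO and H1\<close>

lemma ennreal_sqrt_mono: "x \<le> y \<Longrightarrow> ennreal_sqrt x \<le> ennreal_sqrt y"
  unfolding ennreal_sqrt_def
  by (auto simp: top_unique less_top[symmetric] intro!: ennreal_leI real_sqrt_le_mono enn2real_mono)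

lemma ennreal_sqrt_leD:
  assumes "ennreal_sqrt x \<le> ennreal n" "0 \<le> n"
  shows "x \<le> ennreal (n\<^sup>2)"
proof (cases x)
  case (real r)
  then have "sqrt r \<le> n" using assms by (simp add: ennreal_sqrt_def ennreal_le_iff)
  then have "(sqrt r)\<^sup>2 \<le> n\<^sup>2" using real by (intro power_mono) auto
  then show ?thesis using real by (simp add: ennreal_leI)
next
  case top
  then show ?thesis using assms by (simp add: ennreal_sqrt_def top_unique)
qed

lemma near_cone_subset_cone:
  assumes "0 < \<alpha>" "\<alpha> < 1 / 20" "near_cone t z"
  shows "z \<in> cone \<alpha> (cis t)"
proof -
  have z: "cmod z < 1" using le_less_trans[OF norm_ge_zero assms(3)[unfolded near_cone_def]] by simp
  have s: "0 < sin \<alpha>" using assms pi_gt3 by (intro sin_gt_zero) auto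
  have "sin \<alpha> \<le> 1 / 2" using sin_x_le_x[of \<alpha>] assms by simp
  then have "2 \<le> 1 / sin \<alpha>" using s by (simp add: pos_le_divide_eq)
  moreover have "cmod (cis t - z) / (1 - cmod z) < 2"
    using assms(3) z by (simp add: near_cone_def pos_divide_less_eq)
  ultimately show ?thesis using z by (simp add: cone_def)
qed

lemma bmo_carleson_condition:
  assumes fin: "BMO0_norm \<phi> < \<infinity>" and ab: "a < b" "b \<le> a + 2 * pi"
  shows "(\<integral>\<^sup>+z\<in>carleson_square a b. ennreal ((cmod (deriv (harmonic_ext \<phi>) z))\<^sup>2 * (1 - cmod z)) \<partial>lborel)
    \<le> ennreal ((enn2real (BMO0_norm \<phi>))\<^sup>2 * arc_length a b)"
proof -
  let ?I = "\<integral>\<^sup>+z\<in>carleson_square a b. ennreal ((cmod (deriv (harmonic_ext \<phi>) z))\<^sup>2 * (1 - cmod z)) \<partial>lebesgue"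
  let ?n = "enn2real (BMO0_norm \<phi>)"
  have arc: "0 < arc_length a b" using ab by (simp add: arc_length_def)
  have "ennreal_sqrt (ennreal (1 / arc_length a b) * ?I) \<le> BMO0_norm \<phi>"
    unfolding BMO0_norm_def by (rule SUP_upper2[of "(a, b)"]) (use ab in auto)
  also have "\<dots> = ennreal ?n" using fin by simp
  finally have "ennreal (1 / arc_length a b) * ?I \<le> ennreal (?n\<^sup>2)"
    by (rule ennreal_sqrt_leD) simp
  then have "ennreal (arc_length a b) * (ennreal (1 / arc_length a b) * ?I) \<le> ennreal (arc_length a b) * ennreal (?n\<^sup>2)"
    by (rule mult_left_mono) simp
  also have "ennreal (arc_length a b) * (ennreal (1 / arc_length a b) * ?I) = ?I"
    using arc by (simp add: mult.assoc[symmetric] ennreal_mult[symmetric])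
  also have "ennreal (arc_length a b) * ennreal (?n\<^sup>2) = ennreal (?n\<^sup>2 * arc_length a b)"
    using arc by (subst ennreal_mult[symmetric]) (simp_all add: mult.commute)
  finally show ?thesis by (simp only: nn_integral_completion)
qed

lemma derivative_measurable:
  assumes "F holomorphic_on ball 0 1" "open S" "S \<subseteq> ball 0 1"
  shows "(\<lambda>z. ennreal (cmod (deriv F z)) * indicator S z) \<in> borel_measurable borel"
proof -
  have "continuous_on S (\<lambda>z. cmod (deriv F z))"
    using holomorphic_deriv[OF assms(1)] assms(3)
    by (intro continuous_on_norm holomorphic_on_imp_continuous_on) (auto intro: holomorphic_on_subset)
  then have "(\<lambda>z. indicator S z *\<^sub>R cmod (deriv F z)) \<in> borel_measurable borel"
    using assms(2) by (intro borel_measurable_continuous_on_indicator) auto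
  from measurable_compose[OF this measurable_ennreal]
  show ?thesis
    by (rule measurable_cong[THEN iffD1, rotated]) (auto simp: indicator_def)
qed

text \<open>This is \<open>tent_estimate\<close> for \<open>A = \<bar>F'\<bar>\<close> and \<open>B = \<bar>G'\<bar>\<close>. The slack \<open>\<eta>\<close> keeps the stopping threshold
positive when the BMO norm vanishes.\<close>

lemma area_pairing_bound:
  assumes \<alpha>: "0 < \<alpha>" "\<alpha> < 1 / 20"
    and \<phi>: "harmonic_ext \<phi> holomorphic_on ball 0 1" "BMO0_norm \<phi> < \<infinity>"
    and f: "harmonic_ext f holomorphic_on ball 0 1" "H1_norm \<alpha> f < \<infinity>"
  obtains x where "0 \<le> x" "x \<le> 8 * enn2real (BMO0_norm \<phi>) * enn2real (H1_norm \<alpha> f)"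
    "(\<integral>\<^sup>+z. ennreal (cmod (deriv (harmonic_ext \<phi>) z * deriv (harmonic_ext f) z) * (1 - cmod z)) * indicator (ball 0 1) z \<partial>lborel) = ennreal x"
proof -
  let ?F = "harmonic_ext \<phi>" and ?G = "harmonic_ext f"
  let ?n = "enn2real (BMO0_norm \<phi>)" and ?h = "enn2real (H1_norm \<alpha> f)"
  define A where "A = (\<lambda>z. ennreal (cmod (deriv ?F z)) * indicator (ball 0 1 - {0}) z)"
  define B where "B = (\<lambda>z. ennreal (cmod (deriv ?G z)) * indicator (ball 0 1) z)"
  let ?X = "\<integral>\<^sup>+z. ennreal (cmod (deriv ?F z * deriv ?G z) * (1 - cmod z)) * indicator (ball 0 1) z \<partial>lborel"
  have A: "A \<in> borel_measurable borel" unfolding A_def by (intro derivative_measurable \<phi>) auto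
  have B: "B \<in> borel_measurable borel" unfolding B_def by (intro derivative_measurable f) auto
  have X_eq: "?X = (\<integral>\<^sup>+z. A z * B z * ennreal (1 - cmod z) \<partial>lborel)"
  proof (rule nn_integral_cong_AE)
    show "AE z in lborel. ennreal (cmod (deriv ?F z * deriv ?G z) * (1 - cmod z)) * indicator (ball 0 1) z = A z * B z * ennreal (1 - cmod z)"
      using AE_lborel_singleton[of "0::complex"]
      by eventually_elim (auto simp: A_def B_def indicator_def norm_mult ennreal_mult)
  qed
  have supp: "0 < cmod z \<and> cmod z < 1" if "A z \<noteq> 0" for z
    using that by (auto simp: A_def indicator_def split: if_splits)
  have carl: "(\<integral>\<^sup>+z\<in>carleson_square a b. (A z)\<^sup>2 * ennreal (1 - cmod z) \<partial>lborel) \<le> ennreal (?n\<^sup>2 * arc_length a b)"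
    if "a < b" "b \<le> a + 2 * pi" for a b
  proof -
    have "(\<integral>\<^sup>+z\<in>carleson_square a b. (A z)\<^sup>2 * ennreal (1 - cmod z) \<partial>lborel) \<le>
       (\<integral>\<^sup>+z\<in>carleson_square a b. ennreal ((cmod (deriv ?F z))\<^sup>2 * (1 - cmod z)) \<partial>lborel)"
    proof (intro nn_integral_mono mult_right_mono)
      fix z
      show "(A z)\<^sup>2 * ennreal (1 - cmod z) \<le> ennreal ((cmod (deriv ?F z))\<^sup>2 * (1 - cmod z))"
        by (cases "z \<in> ball 0 1 - {0}") (simp_all add: A_def ennreal_power ennreal_mult)
    qed simp
    also have "\<dots> \<le> ennreal (?n\<^sup>2 * arc_length a b)"
      by (rule bmo_carleson_condition[OF \<phi>(2) that])
    finally show ?thesis .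
  qed
  have sq: "(\<integral>\<^sup>+t\<in>{0..2 * pi}. ennreal_sqrt (\<integral>\<^sup>+z\<in>{z. near_cone t z}. (B z)\<^sup>2 \<partial>lborel) \<partial>lborel) \<le> H1_norm \<alpha> f"
    unfolding H1_norm_def nn_integral_completion
  proof (intro nn_integral_mono mult_right_mono ennreal_sqrt_mono)
    fix t z
    show "(B z)\<^sup>2 * indicator {z. near_cone t z} z \<le> ennreal ((cmod (deriv ?G z))\<^sup>2) * indicator (cone \<alpha> (cis t)) z"
      using near_cone_subset_cone[OF \<alpha>, of t z]
      by (cases "near_cone t z"; cases "z \<in> ball 0 1") (simp_all add: B_def ennreal_power)
  qed simp
  have X_le: "?X \<le> ennreal ((8 * ?n + \<eta>) * ?h)" if \<eta>: "0 < \<eta>" for \<eta>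
  proof -
    have n0: "0 \<le> ?n" by simp
    have M: "0 < 8 * ?n + \<eta>" using \<eta> n0 by linarith
    \<comment> \<open>The factor \<open>8\<close> is the first integer whose square exceeds \<open>54\<close>.\<close>
    have "54 * ?n\<^sup>2 \<le> (8 * ?n)\<^sup>2" by (simp add: power_mult_distrib)
    also have "\<dots> \<le> (8 * ?n + \<eta>)\<^sup>2" using \<eta> n0 by (intro power_mono) auto
    finally have M2: "54 * ?n\<^sup>2 \<le> (8 * ?n + \<eta>)\<^sup>2" .
    have "?X \<le> ennreal (8 * ?n + \<eta>) * (\<integral>\<^sup>+t\<in>{0..2 * pi}. ennreal_sqrt (\<integral>\<^sup>+z\<in>{z. near_cone t z}. (B z)\<^sup>2 \<partial>lborel) \<partial>lborel)"
      unfolding X_eq using tent_estimate[OF A B supp zero_le_power2 carl M M2] by blast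
    also have "\<dots> \<le> ennreal (8 * ?n + \<eta>) * H1_norm \<alpha> f"
      by (rule mult_left_mono[OF sq]) simp
    also have "H1_norm \<alpha> f = ennreal ?h" using f(2) by simp
    also have "ennreal (8 * ?n + \<eta>) * ennreal ?h = ennreal ((8 * ?n + \<eta>) * ?h)"
      using M by (intro ennreal_mult[symmetric]) auto
    finally show ?thesis .
  qed
  have "?X < \<infinity>" using X_le[of 1] by (simp add: le_less_trans)
  then have x: "?X = ennreal (enn2real ?X)" by simp
  have "enn2real ?X \<le> 8 * ?n * ?h"
  proof (rule field_le_epsilon)
    fix e :: real assume e: "0 < e"
    define \<eta> where "\<eta> = e / (?h + 1)"
    have h: "0 \<le> ?h" by simp
    have \<eta>: "0 < \<eta>" unfolding \<eta>_def using e h by (intro divide_pos_pos) linarith+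
    have "enn2real ?X \<le> (8 * ?n + \<eta>) * ?h"
      using X_le[OF \<eta>] \<eta> by (subst (asm) x) (simp add: ennreal_le_iff)
    also have "\<dots> = 8 * ?n * ?h + \<eta> * ?h" by (simp add: distrib_right)
    also have "\<eta> * ?h \<le> \<eta> * (?h + 1)" using \<eta> by (intro mult_left_mono) auto
    also have "\<eta> * (?h + 1) = e"
    proof -
      have "?h + 1 \<noteq> 0" using h by linarith
      then show ?thesis by (simp add: \<eta>_def)
    qed
    finally show "enn2real ?X \<le> 8 * ?n * ?h + e" by simp
  qed
  then show ?thesis using that[of "enn2real ?X"] x by simp
qed

theorem theorem3p1:
  fixes \<alpha> :: real
  assumes "0 < \<alpha>" and "\<alpha> < 1 / 20"
  shows "\<exists>C::real. \<forall>\<phi> \<in> BMO0. \<forall>f \<in> H1 \<alpha>.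
           \<exists>L. has_pairing \<phi> f L \<and>
               cmod L \<le> C * enn2real (BMO0_norm \<phi>) * enn2real (H1_norm \<alpha> f)"
proof (intro exI[of _ "13728::real"] ballI)
  fix \<phi> f assume "\<phi> \<in> BMO0" "f \<in> H1 \<alpha>"
  then have \<phi>: "\<phi> \<in> circle_L1" "harmonic_ext \<phi> holomorphic_on ball 0 1" "harmonic_ext \<phi> 0 = 0" "BMO0_norm \<phi> < \<infinity>"
    and f: "f \<in> circle_L1" "harmonic_ext f holomorphic_on ball 0 1" "H1_norm \<alpha> f < \<infinity>"
    by (auto simp: BMO0_def H1_def)
  obtain x where x: "0 \<le> x" "x \<le> 8 * enn2real (BMO0_norm \<phi>) * enn2real (H1_norm \<alpha> f)"
    "(\<integral>\<^sup>+z. ennreal (cmod (deriv (harmonic_ext \<phi>) z * deriv (harmonic_ext f) z) * (1 - cmod z)) * indicator (ball 0 1) z \<partial>lborel) = ennreal x"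
    by (rule area_pairing_bound[OF assms \<phi>(2,4) f(2,3)])
  obtain L where L: "(radial_pairing (harmonic_ext \<phi>) (harmonic_ext f) \<longlongrightarrow> L) (at_left 1)" "cmod L \<le> 1716 * x"
    by (rule radial_pairing_limit[OF \<phi>(2) f(2) \<phi>(3) x(3,1)])
  let ?P = "\<lambda>r. circle_integral (\<lambda>w. harmonic_ext \<phi> (of_real r * w) * cnj (harmonic_ext f (of_real r * w)))"
  have "\<forall>\<^sub>F r in at_left (1::real). r \<in> {0<..<1}"
    by (rule eventually_at_left_real) simp
  then have "\<forall>\<^sub>F r in at_left (1::real). radial_pairing (harmonic_ext \<phi>) (harmonic_ext f) r = ?P r"
  proof eventually_elim
    case (elim r)
    then have r: "\<bar>r\<bar> < 1" by auto
    have "continuous_on {0..2 * pi} (\<lambda>t. harmonic_ext \<phi> (of_real r * cis t) * cnj (harmonic_ext f (of_real r * cis t)))"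
      by (rule continuous_on_mult[OF holomorphic_circle_continuous1[OF \<phi>(2) r] continuous_on_cnj[OF holomorphic_circle_continuous1[OF f(2) r]]])
    then show ?case
      by (simp add: circle_integral_eq integral_circ_continuous(2) radial_pairing_def)
  qed
  then have lim: "(?P \<longlongrightarrow> L) (at_left 1)"
    by (rule Lim_transform_eventually[OF L(1)])
  have "L = circle_integral (\<lambda>w. \<phi> w * cnj (f w))" if "(\<lambda>w. \<phi> w * cnj (f w)) \<in> circle_L1"
    unfolding circle_integral_eq
  proof (rule pairing_limit_eq_integral)
    show "integrable circ (\<lambda>t. \<phi> (cis t))" "integrable circ (\<lambda>t. f (cis t))" "integrable circ (\<lambda>t. \<phi> (cis t) * cnj (f (cis t)))"
      using \<phi>(1) f(1) that by (simp_all add: circle_L1_iff)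
    show "poisson_integral (\<lambda>t. \<phi> (cis t)) holomorphic_on ball 0 1" "poisson_integral (\<lambda>t. f (cis t)) holomorphic_on ball 0 1"
      using \<phi>(2) f(2) by (simp_all only: harmonic_ext_eq[abs_def])
    show "((\<lambda>r. \<integral>t. poisson_integral (\<lambda>t. \<phi> (cis t)) (of_real r * cis t) * cnj (poisson_integral (\<lambda>t. f (cis t)) (of_real r * cis t)) \<partial>circ) \<longlongrightarrow> L) (at_left 1)"
      using lim by (simp only: circle_integral_eq harmonic_ext_eq)
  qed
  then have "has_pairing \<phi> f L" using lim by (simp add: has_pairing_def)
  moreover have "cmod L \<le> 13728 * enn2real (BMO0_norm \<phi>) * enn2real (H1_norm \<alpha> f)"
    using L(2) x(2) by simp
  ultimately show "\<exists>L. has_pairing \<phi> f L \<and> cmod L \<le> 13728 * enn2real (BMO0_norm \<phi>) * enn2real (H1_norm \<alpha> f)"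
    by blast
qed

end
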